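(* Let $R$ be a finitely generated commutative $V$-algebra equipped with the fine bornology. The canonical map $R\to R^\dagger$ extends uniquely to an isomorphism of bornological algebras from the linear growth completion $\overline R^{\mathrm{lg}}$ onto the Monsky–Washnitzer completion $R^\dagger$.
   Context: $V$ is a complete discrete valuation ring with uniformizer $\pi$; $|\pi|=\epsilon\in(0,1)$. A (convex) bornology on a $V$-module is a family of bounded subsets containing finite sets, closed under subsets and finite unions, with the $V$-submodule generated by a bounded set bounded; a bornological algebra has bounded multiplication. The fine bornology consists of all subsets of finitely generated submodules. A bornological $V$-module is complete if bounded $\pi$-adically complete submodules are cofinal among bounded sets and all bounded submodules are $\pi$-adically separated; the completion is the universal bounded map to a complete bornological module. For a bounded $V$-submodule $M$ of a bornological $V$-algebra, "$\varrho(M)\le1$" means that for every $r>1$ the set $\sum_{n\ge0}r^{-n}\star M^n$ of finite sums of elements of $\bigcup_n\pi^{\lceil\log_\epsilon r^{-n}\rceil}M^n$ is bounded. The linear growth bornology on a bornological $V$-algebra is the smallest algebra bornology containing the given one in which every bounded $V$-submodule $M$ satisfies $\varrho(M)\le1$; $\overline R^{\mathrm{lg}}$ is the completion of $R$ for it. The Monsky–Washnitzer completion $R^\dagger$ is the subset of the $\pi$-adic completion $\hat R=\varprojlim R/\pi^jR$ of elements $z=\sum_{j\ge0}\pi^jw_j$ with $w_j\in M^{\kappa_j}$, where $M\ni1$ is a finitely generated $V$-submodule of $R$ and $\kappa_j\le c(j+1)$ for a constant $c>0$; a subset of $R^\dagger$ is bounded if all its elements admit such representations with one fixed $M$ and $c$.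 *)

theory Defs
  imports Complex_Main "HOL-Algebra.Module" "HOL-Algebra.Generated_Rings"
begin

definition complete_dvr :: "'v ring \<Rightarrow> 'v \<Rightarrow> bool" where
  "complete_dvr V p \<longleftrightarrow> domain V \<and> p \<in> carrier V \<and> p \<noteq> \<zero>\<^bsub>V\<^esub> \<and> p \<notin> Units V \<and>
     (\<forall>a\<in>carrier V. a \<noteq> \<zero>\<^bsub>V\<^esub> \<longrightarrow> (\<exists>u\<in>Units V. \<exists>n::nat. a = u \<otimes>\<^bsub>V\<^esub> (p [^]\<^bsub>V\<^esub> n))) \<and>
     (\<forall>x::nat \<Rightarrow> 'v. (\<forall>n. x n \<in> carrier V) \<and>
        (\<forall>n. x (Suc n) \<ominus>\<^bsub>V\<^esub> x n \<in> {(p [^]\<^bsub>V\<^esub> n) \<otimes>\<^bsub>V\<^esub> a | a. a \<in> carrier V}) \<longrightarrow>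
        (\<exists>y\<in>carrier V. \<forall>n. y \<ominus>\<^bsub>V\<^esub> x n \<in> {(p [^]\<^bsub>V\<^esub> n) \<otimes>\<^bsub>V\<^esub> a | a. a \<in> carrier V}))"

definition vspan :: "'v ring \<Rightarrow> ('v, 'm) module \<Rightarrow> 'm set \<Rightarrow> 'm set" where
  "vspan V M S = \<Inter>{N. submodule N V M \<and> S \<subseteq> N}"

definition bornology :: "'v ring \<Rightarrow> ('v, 'm) module \<Rightarrow> 'm set set \<Rightarrow> bool" where
  "bornology V M B \<longleftrightarrow> B \<subseteq> Pow (carrier M) \<and>
     (\<forall>F. finite F \<and> F \<subseteq> carrier M \<longrightarrow> F \<in> B) \<and>
     (\<forall>S\<in>B. \<forall>T. T \<subseteq> S \<longrightarrow> T \<in> B) \<and>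
     (\<forall>S\<in>B. \<forall>T\<in>B. S \<union> T \<in> B) \<and>
     (\<forall>S\<in>B. vspan V M S \<in> B)"

definition alg_bornology :: "'v ring \<Rightarrow> ('v, 'm) module \<Rightarrow> 'm set set \<Rightarrow> bool" where
  "alg_bornology V A B \<longleftrightarrow> bornology V A B \<and>
     (\<forall>S\<in>B. \<forall>T\<in>B. {x \<otimes>\<^bsub>A\<^esub> y | x y. x \<in> S \<and> y \<in> T} \<in> B)"

definition bounded_map :: "'m set set \<Rightarrow> 'n set set \<Rightarrow> ('m \<Rightarrow> 'n) \<Rightarrow> bool" where
  "bounded_map B1 B2 f \<longleftrightarrow> (\<forall>S\<in>B1. f ` S \<in> B2)"

definition linear_map :: "'v ring \<Rightarrow> ('v, 'm) module \<Rightarrow> ('v, 'n) module \<Rightarrow> ('m \<Rightarrow> 'n) \<Rightarrow> bool" where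
  "linear_map V M N f \<longleftrightarrow> f \<in> carrier M \<rightarrow> carrier N \<and>
     (\<forall>x\<in>carrier M. \<forall>y\<in>carrier M. f (x \<oplus>\<^bsub>M\<^esub> y) = f x \<oplus>\<^bsub>N\<^esub> f y) \<and>
     (\<forall>a\<in>carrier V. \<forall>x\<in>carrier M. f (a \<odot>\<^bsub>M\<^esub> x) = a \<odot>\<^bsub>N\<^esub> f x)"

definition pmul :: "'v ring \<Rightarrow> 'v \<Rightarrow> ('v, 'm) module \<Rightarrow> nat \<Rightarrow> 'm set \<Rightarrow> 'm set" where
  "pmul V p M j N = {(p [^]\<^bsub>V\<^esub> j) \<odot>\<^bsub>M\<^esub> x | x. x \<in> N}"

definition padic_separated :: "'v ring \<Rightarrow> 'v \<Rightarrow> ('v, 'm) module \<Rightarrow> 'm set \<Rightarrow> bool" where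
  "padic_separated V p M N \<longleftrightarrow> (\<Inter>j. pmul V p M j N) = {\<zero>\<^bsub>M\<^esub>}"

definition padic_complete :: "'v ring \<Rightarrow> 'v \<Rightarrow> ('v, 'm) module \<Rightarrow> 'm set \<Rightarrow> bool" where
  "padic_complete V p M N \<longleftrightarrow>
     (\<forall>x::nat \<Rightarrow> 'm. (\<forall>n. x n \<in> N) \<and> (\<forall>n. x (Suc n) \<ominus>\<^bsub>M\<^esub> x n \<in> pmul V p M n N) \<longrightarrow>
        (\<exists>y\<in>N. \<forall>n. y \<ominus>\<^bsub>M\<^esub> x n \<in> pmul V p M n N))"

definition complete_born :: "'v ring \<Rightarrow> 'v \<Rightarrow> ('v, 'm) module \<Rightarrow> 'm set set \<Rightarrow> bool" where
  "complete_born V p M B \<longleftrightarrow>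
     (\<forall>S\<in>B. \<exists>N\<in>B. submodule N V M \<and> S \<subseteq> N \<and> padic_complete V p M N) \<and>
     (\<forall>N\<in>B. submodule N V M \<longrightarrow> padic_separated V p M N)"

text \<open>Universal property of the completion \<open>j : (M,B) \<rightarrow> (C,BC)\<close>, tested against one
  complete bornological module W (the theorem quantifies over all W of arbitrary type).\<close>
definition completion_UP ::
  "'v ring \<Rightarrow> 'v \<Rightarrow> ('v, 'm) module \<Rightarrow> 'm set set \<Rightarrow> ('v, 'c) module \<Rightarrow> 'c set set
     \<Rightarrow> ('m \<Rightarrow> 'c) \<Rightarrow> ('v, 'w) module \<Rightarrow> 'w set set \<Rightarrow> bool" where
  "completion_UP V p M B C BC j W BW \<longleftrightarrow>
     (module V W \<and> bornology V W BW \<and> complete_born V p W BW \<longrightarrow>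
       (\<forall>f. linear_map V M W f \<and> bounded_map B BW f \<longrightarrow>
          (\<exists>g. linear_map V C W g \<and> bounded_map BC BW g \<and> (\<forall>x\<in>carrier M. g (j x) = f x) \<and>
               (\<forall>g'. linear_map V C W g' \<and> bounded_map BC BW g' \<and> (\<forall>x\<in>carrier M. g' (j x) = f x)
                      \<longrightarrow> (\<forall>z\<in>carrier C. g' z = g z)))))"

definition fine_bornology :: "'v ring \<Rightarrow> ('v, 'm) module \<Rightarrow> 'm set set" where
  "fine_bornology V A = {S. S \<subseteq> carrier A \<and>
      (\<exists>F. finite F \<and> F \<subseteq> carrier A \<and> S \<subseteq> vspan V A F)}"

primrec mpow :: "'v ring \<Rightarrow> ('v, 'm) module \<Rightarrow> 'm set \<Rightarrow> nat \<Rightarrow> 'm set" where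
  "mpow V A M 0 = vspan V A {\<one>\<^bsub>A\<^esub>}"
| "mpow V A M (Suc n) = vspan V A {x \<otimes>\<^bsub>A\<^esub> y | x y. x \<in> mpow V A M n \<and> y \<in> M}"

definition fsums :: "('v, 'm) module \<Rightarrow> 'm set \<Rightarrow> 'm set" where
  "fsums A U = \<Inter>{T. \<zero>\<^bsub>A\<^esub> \<in> T \<and> U \<subseteq> T \<and> (\<forall>x\<in>T. \<forall>y\<in>T. x \<oplus>\<^bsub>A\<^esub> y \<in> T)}"

definition lg_set :: "'v ring \<Rightarrow> 'v \<Rightarrow> real \<Rightarrow> ('v, 'm) module \<Rightarrow> 'm set \<Rightarrow> real \<Rightarrow> 'm set" where
  "lg_set V p eps A M r =
     fsums A (\<Union>n. pmul V p A (nat \<lceil>log eps ((1 / r) ^ n)\<rceil>) (mpow V A M n))"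

definition rho_le1 :: "'v ring \<Rightarrow> 'v \<Rightarrow> real \<Rightarrow> ('v, 'm) module \<Rightarrow> 'm set set \<Rightarrow> 'm set \<Rightarrow> bool" where
  "rho_le1 V p eps A B M \<longleftrightarrow> (\<forall>r::real. r > 1 \<longrightarrow> lg_set V p eps A M r \<in> B)"

definition lg_bornology :: "'v ring \<Rightarrow> 'v \<Rightarrow> real \<Rightarrow> ('v, 'm) module \<Rightarrow> 'm set set \<Rightarrow> 'm set set" where
  "lg_bornology V p eps A B0 = \<Inter>{B. alg_bornology V A B \<and> B0 \<subseteq> B \<and>
      (\<forall>M\<in>B. submodule M V A \<longrightarrow> rho_le1 V p eps A B M)}"

definition fin_gen_algebra :: "'v ring \<Rightarrow> ('v, 'm) module \<Rightarrow> bool" where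
  "fin_gen_algebra V A \<longleftrightarrow> (\<exists>S. finite S \<and> S \<subseteq> carrier A \<and>
      generate_ring A (S \<union> {a \<odot>\<^bsub>A\<^esub> \<one>\<^bsub>A\<^esub> | a. a \<in> carrier V}) = carrier A)"

text \<open>An element of \<open>lim R/pi^j R\<close> is represented by its compatible sequence of cosets.\<close>
definition pcoset :: "'v ring \<Rightarrow> 'v \<Rightarrow> ('v, 'm) module \<Rightarrow> nat \<Rightarrow> 'm \<Rightarrow> 'm set" where
  "pcoset V p A j x = {x \<oplus>\<^bsub>A\<^esub> y | y. y \<in> pmul V p A j (carrier A)}"

definition hat_carrier :: "'v ring \<Rightarrow> 'v \<Rightarrow> ('v, 'm) module \<Rightarrow> (nat \<Rightarrow> 'm set) set" where
  "hat_carrier V p A = {c. \<exists>x. (\<forall>j. x j \<in> carrier A \<and> c j = pcoset V p A j (x j)) \<and>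
                                (\<forall>j. c (Suc j) \<subseteq> c j)}"

definition hrep :: "(nat \<Rightarrow> 'm set) \<Rightarrow> nat \<Rightarrow> 'm" where
  "hrep c j = (SOME x. x \<in> c j)"

definition hat_emb :: "'v ring \<Rightarrow> 'v \<Rightarrow> ('v, 'm) module \<Rightarrow> 'm \<Rightarrow> nat \<Rightarrow> 'm set" where
  "hat_emb V p A x = (\<lambda>j. pcoset V p A j x)"

definition hadd :: "'v ring \<Rightarrow> 'v \<Rightarrow> ('v, 'm) module \<Rightarrow> (nat \<Rightarrow> 'm set) \<Rightarrow> (nat \<Rightarrow> 'm set) \<Rightarrow> nat \<Rightarrow> 'm set" where
  "hadd V p A c d = (\<lambda>j. pcoset V p A j (hrep c j \<oplus>\<^bsub>A\<^esub> hrep d j))"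

definition hmul :: "'v ring \<Rightarrow> 'v \<Rightarrow> ('v, 'm) module \<Rightarrow> (nat \<Rightarrow> 'm set) \<Rightarrow> (nat \<Rightarrow> 'm set) \<Rightarrow> nat \<Rightarrow> 'm set" where
  "hmul V p A c d = (\<lambda>j. pcoset V p A j (hrep c j \<otimes>\<^bsub>A\<^esub> hrep d j))"

definition hsmul :: "'v ring \<Rightarrow> 'v \<Rightarrow> ('v, 'm) module \<Rightarrow> 'v \<Rightarrow> (nat \<Rightarrow> 'm set) \<Rightarrow> nat \<Rightarrow> 'm set" where
  "hsmul V p A a c = (\<lambda>j. pcoset V p A j (a \<odot>\<^bsub>A\<^esub> hrep c j))"

definition mw_gens :: "'v ring \<Rightarrow> ('v, 'm) module \<Rightarrow> 'm set \<Rightarrow> bool" where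
  "mw_gens V A M \<longleftrightarrow> (\<exists>F. finite F \<and> F \<subseteq> carrier A \<and> M = vspan V A F) \<and> \<one>\<^bsub>A\<^esub> \<in> M"

definition mw_rep :: "'v ring \<Rightarrow> 'v \<Rightarrow> ('v, 'm) module \<Rightarrow> 'm set \<Rightarrow> real \<Rightarrow> (nat \<Rightarrow> 'm set) \<Rightarrow> bool" where
  "mw_rep V p A M c z \<longleftrightarrow> (\<exists>(w::nat \<Rightarrow> 'm) (\<kappa>::nat \<Rightarrow> nat).
      (\<forall>j. w j \<in> mpow V A M (\<kappa> j) \<and> real (\<kappa> j) \<le> c * real (j + 1)) \<and>
      (\<forall>k. z k = pcoset V p A k (finsum A (\<lambda>j. (p [^]\<^bsub>V\<^esub> j) \<odot>\<^bsub>A\<^esub> w j) {..<k})))"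

definition dagger_carrier :: "'v ring \<Rightarrow> 'v \<Rightarrow> ('v, 'm) module \<Rightarrow> (nat \<Rightarrow> 'm set) set" where
  "dagger_carrier V p A = {z. \<exists>M c. mw_gens V A M \<and> c > 0 \<and> mw_rep V p A M c z}"

definition dagger_born :: "'v ring \<Rightarrow> 'v \<Rightarrow> ('v, 'm) module \<Rightarrow> (nat \<Rightarrow> 'm set) set set" where
  "dagger_born V p A = {S. S \<subseteq> dagger_carrier V p A \<and>
      (\<exists>M c. mw_gens V A M \<and> c > 0 \<and> (\<forall>z\<in>S. mw_rep V p A M c z))}"

definition dagger :: "'v ring \<Rightarrow> 'v \<Rightarrow> ('v, 'm) module \<Rightarrow> ('v, nat \<Rightarrow> 'm set) module" where
  "dagger V p A = \<lparr>carrier = dagger_carrier V p A, mult = hmul V p A,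
      one = hat_emb V p A \<one>\<^bsub>A\<^esub>, zero = hat_emb V p A \<zero>\<^bsub>A\<^esub>,
      add = hadd V p A, smult = hsmul V p A\<rparr>"

end

theory Submission
  imports Defs "HOL-Library.Multiset_Order"
begin

text \<open>
  Let \<open>M \<ni> 1\<close> be a finitely generated submodule of \<open>R\<close> and \<open>z = \<Sum>p\<^sup>j w\<^sub>j\<close> with
  \<open>w\<^sub>j\<close> of \<open>M\<close>-degree at most \<open>L (j + 1)\<close>. Linear growth of \<open>M\<close> puts \<open>p\<^sup>j w\<^sub>j\<close> into
  \<open>p\<^bsup>j div 2\<^esup> B\<close> for one bounded \<open>B\<close>, so a bounded map \<open>f\<close> into a complete module extends to \<open>z\<close>
  as the limit of \<open>f\<close> on partial sums. The crux is that this limit vanishes if \<open>z = 0\<close>, that is, if the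
  \<open>k\<close>-th partial sum lies in \<open>p\<^sup>k R\<close> for all \<open>k\<close>. No flatness or Noetherian property of
  \<open>R\<^sup>\<dagger>\<close> is needed: there is a constant \<open>e\<close> such that an element of degree \<open>n\<close> in \<open>p\<^sup>k R\<close> is
  \<open>p\<^sup>k\<close> times an element of degree \<open>n + e k\<close>. This follows by a Groebner-type reduction of
  monomials, performed directly in \<open>R\<close>, with Dickson's lemma providing the uniform constant. So
  the partial sums of a zero series are again \<open>p\<^bsup>k div 2\<^esup>\<close> times elements of one bounded set.
\<close>

section \<open>Modules over a ring with a distinguished element\<close>

text \<open>A class \<open>z\<close> is represented by many series, and \<open>hat_emb\<close> need
  not be injective, so continuity alone does not make the limit well defined: an element of
  \<open>R\<close> divisible by every power of \<open>p\<close> has to be killed by every admissible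
  \<open>f\<close>. The degree of the quotient may therefore grow at most linearly in
  \<open>k\<close>: linear growth trades a degree proportional to \<open>k\<close> for a fixed
  fraction of the available powers of \<open>p\<close>, and a faster growing degree could not be
  paid for. A cost per division that is independent of the divisions already made is not automatic.
  \<open>R\<close> may have \<open>p\<close>-torsion, so \<open>p^k y\<close> does not determine
  \<open>y\<close>, and more relations may become available after multiplication by a higher power
  \<open>p^i\<close>. Hence the exponent \<open>i\<close> is treated as one more coordinate beside
  the exponents of a monomial, and Dickson's lemma handles all \<open>i\<close> at once. The
  generators include the unit. This homogenises: an element of degree at most \<open>n\<close> is a
  combination of monomials of size exactly \<open>n\<close>, and reduction preserves that
  size.\<close>

locale pmodule = module V M for V :: "'v ring" and M :: "('v, 'm) module" +
  fixes p :: 'v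
  assumes p_closed [simp, intro]: "p \<in> carrier V"
begin

abbreviation pw :: "nat \<Rightarrow> 'm \<Rightarrow> 'm" where
  "pw j x \<equiv> (p [^]\<^bsub>V\<^esub> j) \<odot>\<^bsub>M\<^esub> x"

lemma ppow_closed [simp, intro]: "p [^]\<^bsub>V\<^esub> (j::nat) \<in> carrier V"
  by simp

lemma pw_pw: "x \<in> carrier M \<Longrightarrow> pw j (pw k x) = pw (j + k) x"
  by (simp add: smult_assoc1 [symmetric] R.nat_pow_mult)

lemma smult_commute:
  "\<lbrakk>a \<in> carrier V; b \<in> carrier V; x \<in> carrier M\<rbrakk> \<Longrightarrow> a \<odot>\<^bsub>M\<^esub> (b \<odot>\<^bsub>M\<^esub> x) = b \<odot>\<^bsub>M\<^esub> (a \<odot>\<^bsub>M\<^esub> x)"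
  by (simp add: smult_assoc1 [symmetric] R.m_comm)

lemma smult_r_diff:
  "\<lbrakk>a \<in> carrier V; x \<in> carrier M; y \<in> carrier M\<rbrakk>
    \<Longrightarrow> a \<odot>\<^bsub>M\<^esub> (x \<ominus>\<^bsub>M\<^esub> y) = a \<odot>\<^bsub>M\<^esub> x \<ominus>\<^bsub>M\<^esub> a \<odot>\<^bsub>M\<^esub> y"
  by (simp add: M.minus_eq smult_r_distr smult_r_minus)

lemma pmul_iff: "x \<in> pmul V p M j N \<longleftrightarrow> (\<exists>y\<in>N. x = pw j y)"
  by (auto simp: pmul_def)

lemma pmul_mono: "N \<subseteq> N' \<Longrightarrow> pmul V p M j N \<subseteq> pmul V p M j N'"
  by (auto simp: pmul_def)

lemma submodule_closed:
  assumes "submodule N V M"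
  shows "N \<subseteq> carrier M" "\<zero>\<^bsub>M\<^esub> \<in> N"
    "\<And>x y. x \<in> N \<Longrightarrow> y \<in> N \<Longrightarrow> x \<oplus>\<^bsub>M\<^esub> y \<in> N"
    "\<And>a x. a \<in> carrier V \<Longrightarrow> x \<in> N \<Longrightarrow> a \<odot>\<^bsub>M\<^esub> x \<in> N"
    "\<And>x y. x \<in> N \<Longrightarrow> y \<in> N \<Longrightarrow> x \<ominus>\<^bsub>M\<^esub> y \<in> N"
    "\<And>x. x \<in> N \<Longrightarrow> x \<in> carrier M"
  using submoduleE [OF assms] submodule.axioms(1) [OF assms] subgroup.one_closed [of N "add_monoid M"]
  by (auto simp: M.minus_eq)

lemma submoduleI':
  assumes "N \<subseteq> carrier M" "\<zero>\<^bsub>M\<^esub> \<in> N"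
    "\<And>x y. x \<in> N \<Longrightarrow> y \<in> N \<Longrightarrow> x \<oplus>\<^bsub>M\<^esub> y \<in> N"
    "\<And>a x. a \<in> carrier V \<Longrightarrow> x \<in> N \<Longrightarrow> a \<odot>\<^bsub>M\<^esub> x \<in> N"
  shows "submodule N V M"
proof (rule submoduleI)
  fix a assume "a \<in> N"
  with assms have "(\<ominus>\<^bsub>V\<^esub> \<one>\<^bsub>V\<^esub>) \<odot>\<^bsub>M\<^esub> a \<in> N" "a \<in> carrier M" by auto
  then show "\<ominus>\<^bsub>M\<^esub> a \<in> N" by (simp add: smult_l_minus)
qed (use assms in auto)

lemma pmul_submodule:
  assumes "submodule N V M"
  shows "submodule (pmul V p M j N) V M"
proof (rule submoduleI')
  note N = submodule_closed [OF assms]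
  show "pmul V p M j N \<subseteq> carrier M" using N(1) by (auto simp: pmul_def)
  show "\<zero>\<^bsub>M\<^esub> \<in> pmul V p M j N"
    unfolding pmul_iff by (rule bexI [OF _ N(2)]) simp
  show "x \<oplus>\<^bsub>M\<^esub> y \<in> pmul V p M j N"
    if "x \<in> pmul V p M j N" "y \<in> pmul V p M j N" for x y
  proof -
    obtain x' y' where "x' \<in> N" "y' \<in> N" "x = pw j x'" "y = pw j y'"
      using \<open>x \<in> _\<close> \<open>y \<in> _\<close> unfolding pmul_iff by blast
    then have "x \<oplus>\<^bsub>M\<^esub> y = pw j (x' \<oplus>\<^bsub>M\<^esub> y')" "x' \<oplus>\<^bsub>M\<^esub> y' \<in> N"
      using N by (auto simp: smult_r_distr)
    then show ?thesis unfolding pmul_iff by blast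
  qed
  show "a \<odot>\<^bsub>M\<^esub> x \<in> pmul V p M j N" if "a \<in> carrier V" "x \<in> pmul V p M j N" for a x
  proof -
    obtain x' where "x' \<in> N" "x = pw j x'"
      using \<open>x \<in> _\<close> unfolding pmul_iff by blast
    then have "a \<odot>\<^bsub>M\<^esub> x = pw j (a \<odot>\<^bsub>M\<^esub> x')" "a \<odot>\<^bsub>M\<^esub> x' \<in> N"
      using N that by (auto simp: smult_commute)
    then show ?thesis unfolding pmul_iff by blast
  qed
qed

lemma pmul_antimono:
  assumes "submodule N V M" "j \<le> k"
  shows "pmul V p M k N \<subseteq> pmul V p M j N"
proof
  note N = submodule_closed [OF assms(1)]
  fix x assume "x \<in> pmul V p M k N"
  then obtain y where "y \<in> N" "x = pw k y" unfolding pmul_iff by blast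
  then have "x = pw j (pw (k - j) y)" "pw (k - j) y \<in> N"
    using N assms(2) by (auto simp: pw_pw)
  then show "x \<in> pmul V p M j N" unfolding pmul_iff by blast
qed

lemma pmul_subset:
  assumes "submodule N V M"
  shows "pmul V p M j N \<subseteq> N"
  using submodule_closed [OF assms] by (auto simp: pmul_def)

lemma vspan_submodule:
  assumes "S \<subseteq> carrier M"
  shows "submodule (vspan V M S) V M"
proof (rule submoduleI')
  show "vspan V M S \<subseteq> carrier M"
    unfolding vspan_def using carrier_is_submodule assms by blast
qed (auto simp: vspan_def submodule_closed)

lemma vspan_incl: "S \<subseteq> vspan V M S"
  by (auto simp: vspan_def)

lemma vspan_base: "x \<in> S \<Longrightarrow> x \<in> vspan V M S"
  using vspan_incl by blast

lemma vspan_min: "submodule N V M \<Longrightarrow> S \<subseteq> N \<Longrightarrow> vspan V M S \<subseteq> N"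
  by (auto simp: vspan_def)

lemma vspan_mono: "S \<subseteq> T \<Longrightarrow> vspan V M S \<subseteq> vspan V M T"
  by (auto simp: vspan_def)

lemma vspan_carrier: "S \<subseteq> carrier M \<Longrightarrow> vspan V M S \<subseteq> carrier M"
  by (rule vspan_min [OF carrier_is_submodule])

lemma vspan_empty: "vspan V M {} = {\<zero>\<^bsub>M\<^esub>}"
proof
  have "submodule {\<zero>\<^bsub>M\<^esub>} V M" by (rule submoduleI') auto
  then show "vspan V M {} \<subseteq> {\<zero>\<^bsub>M\<^esub>}" by (rule vspan_min) simp
  show "{\<zero>\<^bsub>M\<^esub>} \<subseteq> vspan V M {}" using submodule_closed(2) vspan_submodule by auto
qed

text \<open>Used to split off the leading coefficient in the induction over monomials.\<close>

lemma vspan_insertE: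
  assumes "x \<in> vspan V M (insert b S)" "b \<in> carrier M" "S \<subseteq> carrier M"
  obtains v y where "v \<in> carrier V" "y \<in> vspan V M S" "x = v \<odot>\<^bsub>M\<^esub> b \<oplus>\<^bsub>M\<^esub> y"
proof -
  note S = submodule_closed [OF vspan_submodule [OF assms(3)]]
  let ?N = "{v \<odot>\<^bsub>M\<^esub> b \<oplus>\<^bsub>M\<^esub> y | v y. v \<in> carrier V \<and> y \<in> vspan V M S}"
  have "submodule ?N V M"
  proof (rule submoduleI')
    show "?N \<subseteq> carrier M" using S assms by auto
    show "\<zero>\<^bsub>M\<^esub> \<in> ?N" using S(2) assms(2) R.zero_closed
      by (intro CollectI exI [of _ "\<zero>\<^bsub>V\<^esub>"] exI [of _ "\<zero>\<^bsub>M\<^esub>"]) simp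
    show "x \<oplus>\<^bsub>M\<^esub> y \<in> ?N" if "x \<in> ?N" "y \<in> ?N" for x y
    proof -
      obtain v x' w y' where *: "v \<in> carrier V" "x' \<in> vspan V M S" "x = v \<odot>\<^bsub>M\<^esub> b \<oplus>\<^bsub>M\<^esub> x'"
        "w \<in> carrier V" "y' \<in> vspan V M S" "y = w \<odot>\<^bsub>M\<^esub> b \<oplus>\<^bsub>M\<^esub> y'"
        using \<open>x \<in> ?N\<close> \<open>y \<in> ?N\<close> by blast
      then have "x \<oplus>\<^bsub>M\<^esub> y = (v \<oplus>\<^bsub>V\<^esub> w) \<odot>\<^bsub>M\<^esub> b \<oplus>\<^bsub>M\<^esub> (x' \<oplus>\<^bsub>M\<^esub> y')"
        using assms(2) S by (simp add: smult_l_distr M.a_ac)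
      with * S show ?thesis by blast
    qed
    show "a \<odot>\<^bsub>M\<^esub> x \<in> ?N" if "a \<in> carrier V" "x \<in> ?N" for a x
    proof -
      obtain v x' where *: "v \<in> carrier V" "x' \<in> vspan V M S" "x = v \<odot>\<^bsub>M\<^esub> b \<oplus>\<^bsub>M\<^esub> x'"
        using \<open>x \<in> ?N\<close> by blast
      then have "a \<odot>\<^bsub>M\<^esub> x = (a \<otimes>\<^bsub>V\<^esub> v) \<odot>\<^bsub>M\<^esub> b \<oplus>\<^bsub>M\<^esub> a \<odot>\<^bsub>M\<^esub> x'"
        using assms(2) S that by (simp add: smult_r_distr smult_assoc1)
      with * S that show ?thesis by blast
    qed
  qed
  moreover have "insert b S \<subseteq> ?N"
  proof -
    have "b = \<one>\<^bsub>V\<^esub> \<odot>\<^bsub>M\<^esub> b \<oplus>\<^bsub>M\<^esub> \<zero>\<^bsub>M\<^esub>" using assms(2) by simp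
    moreover have "s = \<zero>\<^bsub>V\<^esub> \<odot>\<^bsub>M\<^esub> b \<oplus>\<^bsub>M\<^esub> s" if "s \<in> S" for s using assms that by auto
    ultimately show ?thesis using S(2) vspan_incl [of S] R.zero_closed R.one_closed by blast
  qed
  ultimately have "x \<in> ?N" using vspan_min assms(1) by blast
  then show thesis using that by blast
qed

section \<open>Partial sums of series in powers of \<open>p\<close>\<close>

primrec rsum :: "(nat \<Rightarrow> 'm) \<Rightarrow> nat \<Rightarrow> 'm" where
  "rsum f 0 = \<zero>\<^bsub>M\<^esub>"
| "rsum f (Suc k) = rsum f k \<oplus>\<^bsub>M\<^esub> f k"

lemma rsum_in_submodule:
  assumes "submodule N V M" "\<And>j. j < k \<Longrightarrow> f j \<in> N"
  shows "rsum f k \<in> N"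
  using assms(2) by (induction k) (auto intro: submodule_closed [OF assms(1)])

lemma rsum_closed [simp]: "(\<And>j. j < k \<Longrightarrow> f j \<in> carrier M) \<Longrightarrow> rsum f k \<in> carrier M"
  by (rule rsum_in_submodule [OF carrier_is_submodule])

lemma rsum_cong: "(\<And>j. j < k \<Longrightarrow> f j = g j) \<Longrightarrow> rsum f k = rsum g k"
  by (induction k) auto

lemma rsum_add:
  assumes "\<And>j. f j \<in> carrier M" "\<And>j. g j \<in> carrier M"
  shows "rsum (\<lambda>j. f j \<oplus>\<^bsub>M\<^esub> g j) k = rsum f k \<oplus>\<^bsub>M\<^esub> rsum g k"
  using assms by (induction k) (auto simp: M.a_ac)

lemma rsum_smult:
  assumes "a \<in> carrier V" "\<And>j. f j \<in> carrier M"
  shows "rsum (\<lambda>j. a \<odot>\<^bsub>M\<^esub> f j) k = a \<odot>\<^bsub>M\<^esub> rsum f k"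
  using assms by (induction k) (auto simp: smult_r_distr)

lemma rsum_shift:
  assumes "\<And>j. f j \<in> carrier M"
  shows "rsum f (Suc k) = f 0 \<oplus>\<^bsub>M\<^esub> rsum (\<lambda>j. f (Suc j)) k"
  using assms by (induction k) (auto simp: M.a_ac)

lemma rsum_finsum:
  assumes "\<And>j. f j \<in> carrier M"
  shows "rsum f k = finsum M f {..<k}"
  using assms by (induction k) (auto simp: lessThan_Suc M.finsum_insert M.a_ac)

definition psum :: "(nat \<Rightarrow> 'm) \<Rightarrow> nat \<Rightarrow> 'm" where
  "psum w = rsum (\<lambda>j. pw j (w j))"

lemma psum_0 [simp]: "psum w 0 = \<zero>\<^bsub>M\<^esub>"
  and psum_Suc [simp]: "psum w (Suc k) = psum w k \<oplus>\<^bsub>M\<^esub> pw k (w k)"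
  by (simp_all add: psum_def)

lemma psum_closed [simp]: "(\<And>j. w j \<in> carrier M) \<Longrightarrow> psum w k \<in> carrier M"
  by (simp add: psum_def)

lemma psum_add:
  assumes "\<And>j. f j \<in> carrier M" "\<And>j. g j \<in> carrier M"
  shows "psum (\<lambda>j. f j \<oplus>\<^bsub>M\<^esub> g j) k = psum f k \<oplus>\<^bsub>M\<^esub> psum g k"
  using assms by (simp add: psum_def smult_r_distr rsum_add)

lemma psum_smult:
  assumes "a \<in> carrier V" "\<And>j. f j \<in> carrier M"
  shows "psum (\<lambda>j. a \<odot>\<^bsub>M\<^esub> f j) k = a \<odot>\<^bsub>M\<^esub> psum f k"
  using assms by (simp add: psum_def smult_commute [OF ppow_closed] rsum_smult)

lemma psum_case_nat:
  assumes "x \<in> carrier M" "\<And>j. w j \<in> carrier M"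
  shows "psum (case_nat x w) (Suc k) = x \<oplus>\<^bsub>M\<^esub> pw 1 (psum w k)"
  using assms by (induction k) (auto simp: smult_r_distr M.a_ac smult_assoc1 smult_commute)

text \<open>Both sides add up \<open>p^(i+j) w i j\<close> over the triangle
  \<open>i + j < k\<close>, once by diagonals and once by rows. This is the combinatorial core of
  the Cauchy product.\<close>

lemma psum_double:
  assumes "\<And>i j. w i j \<in> carrier M"
  shows "psum (\<lambda>m. rsum (\<lambda>i. w i (m - i)) (Suc m)) k = rsum (\<lambda>i. pw i (psum (w i) (k - i))) k"
proof (induction k)
  case 0
  then show ?case by simp
next
  case (Suc k)
  have "rsum (\<lambda>i. pw i (psum (w i) (Suc k - i))) (Suc k)
      = rsum (\<lambda>i. pw i (psum (w i) (k - i)) \<oplus>\<^bsub>M\<^esub> pw k (w i (k - i))) (Suc k)"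
  proof (rule rsum_cong)
    fix i assume "i < Suc k"
    then have "Suc k - i = Suc (k - i)" "i + (k - i) = k" by auto
    then show "pw i (psum (w i) (Suc k - i)) = pw i (psum (w i) (k - i)) \<oplus>\<^bsub>M\<^esub> pw k (w i (k - i))"
      using assms by (simp add: smult_r_distr pw_pw)
  qed
  also have "\<dots> = rsum (\<lambda>i. pw i (psum (w i) (k - i))) (Suc k) \<oplus>\<^bsub>M\<^esub> pw k (rsum (\<lambda>i. w i (k - i)) (Suc k))"
    using assms by (subst rsum_add) (auto simp del: rsum.simps simp: rsum_smult)
  \<comment> \<open>The row \<open>i = k\<close> drops out because its inner sum is empty.\<close>
  also have "\<dots> = rsum (\<lambda>i. pw i (psum (w i) (k - i))) k \<oplus>\<^bsub>M\<^esub> pw k (rsum (\<lambda>i. w i (k - i)) (Suc k))"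
    using assms by simp
  finally show ?case using Suc by simp
qed

lemma psum_diff:
  assumes "\<And>j. w j \<in> carrier M" "k \<le> l"
  obtains y where "y \<in> carrier M" "psum w l = psum w k \<oplus>\<^bsub>M\<^esub> pw k y"
proof -
  have "\<exists>y\<in>carrier M. psum w l = psum w k \<oplus>\<^bsub>M\<^esub> pw k y"
    using assms(2)
  proof (induction l rule: dec_induct)
    case base
    then show ?case using assms by (intro bexI [of _ "\<zero>\<^bsub>M\<^esub>"]) auto
  next
    case (step l)
    then obtain y where y: "y \<in> carrier M" "psum w l = psum w k \<oplus>\<^bsub>M\<^esub> pw k y" by blast
    have "pw l (w l) = pw k (pw (l - k) (w l))" using step assms by (simp add: pw_pw)
    then have "psum w (Suc l) = psum w k \<oplus>\<^bsub>M\<^esub> pw k (y \<oplus>\<^bsub>M\<^esub> pw (l - k) (w l))"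
      using y assms by (simp add: smult_r_distr M.a_ac)
    then show ?case using y assms by blast
  qed
  then show thesis using that by blast
qed

text \<open>Only \<open>p^n\<close>, not \<open>p^(2n)\<close>, is taken out of the tail beyond
  \<open>2n\<close>. Place \<open>j \<ge> n\<close> then carries the coefficient
  \<open>w (n + j)\<close>, whose index is at most \<open>2j\<close>, so a linear degree bound for
  \<open>w\<close> is at most doubled, uniformly in \<open>n\<close>.\<close>

lemma psum_tail:
  assumes "\<And>j. w j \<in> carrier M"
  shows "psum w (2 * n) \<oplus>\<^bsub>M\<^esub> pw n (psum (\<lambda>j. if j < n then \<zero>\<^bsub>M\<^esub> else w (n + j)) k) = psum w (n + max k n)"
proof (induction k)
  case 0
  then show ?case using assms by (simp add: mult_2)
next
  case (Suc k)
  show ?case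
  proof (cases "k < n")
    case True
    then show ?thesis using Suc assms by (simp add: max_def Suc_le_eq)
  next
    case False
    let ?u = "\<lambda>j. if j < n then \<zero>\<^bsub>M\<^esub> else w (n + j)"
    from False have m: "n + max (Suc k) n = Suc (n + k)" "n + max k n = n + k" by linarith+
    have "psum w (n + max (Suc k) n) = psum w (n + max k n) \<oplus>\<^bsub>M\<^esub> pw (n + k) (w (n + k))"
      unfolding m by simp
    also have "\<dots> = (psum w (2 * n) \<oplus>\<^bsub>M\<^esub> pw n (psum ?u k)) \<oplus>\<^bsub>M\<^esub> pw n (pw k (w (n + k)))"
      using assms Suc by (simp add: pw_pw)
    also have "\<dots> = psum w (2 * n) \<oplus>\<^bsub>M\<^esub> pw n (psum ?u k \<oplus>\<^bsub>M\<^esub> pw k (w (n + k)))"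
      using assms by (simp add: smult_r_distr M.a_assoc)
    finally show ?thesis using False by simp
  qed
qed

lemma bornologyD:
  assumes "bornology V M B"
  shows "\<And>S. S \<in> B \<Longrightarrow> S \<subseteq> carrier M"
    "\<And>F. finite F \<Longrightarrow> F \<subseteq> carrier M \<Longrightarrow> F \<in> B"
    "\<And>S T. S \<in> B \<Longrightarrow> T \<subseteq> S \<Longrightarrow> T \<in> B"
    "\<And>S T. S \<in> B \<Longrightarrow> T \<in> B \<Longrightarrow> S \<union> T \<in> B"
    "\<And>S. S \<in> B \<Longrightarrow> vspan V M S \<in> B"
proof -
  note * = assms [unfolded bornology_def]
  note 1 = * [THEN conjunct1] and 2 = * [THEN conjunct2, THEN conjunct1]
    and 3 = * [THEN conjunct2, THEN conjunct2, THEN conjunct1]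
    and 4 = * [THEN conjunct2, THEN conjunct2, THEN conjunct2, THEN conjunct1]
    and 5 = * [THEN conjunct2, THEN conjunct2, THEN conjunct2, THEN conjunct2]
  show "\<And>S. S \<in> B \<Longrightarrow> S \<subseteq> carrier M" using 1 by blast
  show "\<And>F. finite F \<Longrightarrow> F \<subseteq> carrier M \<Longrightarrow> F \<in> B" using 2 by blast
  show "\<And>S T. S \<in> B \<Longrightarrow> T \<subseteq> S \<Longrightarrow> T \<in> B" using 3 by blast
  show "\<And>S T. S \<in> B \<Longrightarrow> T \<in> B \<Longrightarrow> S \<union> T \<in> B" using 4 by blast
  show "\<And>S. S \<in> B \<Longrightarrow> vspan V M S \<in> B" using 5 by blast
qed

lemma bornology_submodule_Un:
  assumes "bornology V M B" "S \<in> B" "T \<in> B"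
  obtains N where "N \<in> B" "submodule N V M" "S \<subseteq> N" "T \<subseteq> N"
proof
  note B = bornologyD [OF assms(1)]
  have ST: "S \<union> T \<in> B" using B(4) assms(2,3) .
  show "vspan V M (S \<union> T) \<in> B" using B(5) ST .
  show "submodule (vspan V M (S \<union> T)) V M" using vspan_submodule B(1) ST .
  show "S \<subseteq> vspan V M (S \<union> T)" "T \<subseteq> vspan V M (S \<union> T)" using vspan_incl [of "S \<union> T"] by auto
qed

end

section \<open>Divisibility by powers of \<open>p\<close> and growth of degrees\<close>

locale palgebra = A: cring A + pmodule V A p for V :: "'v ring" and A :: "('v, 'r) module" and p +
  assumes smult_assoc2:
    "\<lbrakk>a \<in> carrier V; x \<in> carrier A; y \<in> carrier A\<rbrakk> \<Longrightarrow> (a \<odot>\<^bsub>A\<^esub> x) \<otimes>\<^bsub>A\<^esub> y = a \<odot>\<^bsub>A\<^esub> (x \<otimes>\<^bsub>A\<^esub> y)"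
begin

lemma smult_assoc3:
  "\<lbrakk>a \<in> carrier V; x \<in> carrier A; y \<in> carrier A\<rbrakk> \<Longrightarrow> x \<otimes>\<^bsub>A\<^esub> (a \<odot>\<^bsub>A\<^esub> y) = a \<odot>\<^bsub>A\<^esub> (x \<otimes>\<^bsub>A\<^esub> y)"
  using smult_assoc2 [of a y x] by (simp add: A.m_comm)

text \<open>This colon submodule turns the minimality of a span into bilinear induction: products
  are controlled as soon as products of generators are.\<close>

lemma submodule_mult_preimage:
  assumes "submodule N V A" "Y \<subseteq> carrier A"
  shows "submodule {x \<in> carrier A. \<forall>y\<in>Y. x \<otimes>\<^bsub>A\<^esub> y \<in> N} V A"
proof (rule submoduleI')
  note N = submodule_closed [OF assms(1)]
  show "\<zero>\<^bsub>A\<^esub> \<in> {x \<in> carrier A. \<forall>y\<in>Y. x \<otimes>\<^bsub>A\<^esub> y \<in> N}"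
    using N assms(2) by (auto simp: subset_iff)
qed (use submodule_closed [OF assms(1)] assms(2) in \<open>auto simp: subset_iff A.l_distr smult_assoc2\<close>)

lemma vspan_mult:
  assumes "submodule N V A" "S \<subseteq> carrier A" "T \<subseteq> carrier A"
    "\<And>x y. x \<in> S \<Longrightarrow> y \<in> T \<Longrightarrow> x \<otimes>\<^bsub>A\<^esub> y \<in> N"
    "x \<in> vspan V A S" "y \<in> vspan V A T"
  shows "x \<otimes>\<^bsub>A\<^esub> y \<in> N"
proof -
  have "S \<subseteq> {x \<in> carrier A. \<forall>y\<in>T. x \<otimes>\<^bsub>A\<^esub> y \<in> N}" using assms by blast
  then have 1: "vspan V A S \<subseteq> {x \<in> carrier A. \<forall>y\<in>T. x \<otimes>\<^bsub>A\<^esub> y \<in> N}"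
    by (rule vspan_min [OF submodule_mult_preimage [OF assms(1,3)]])
  then have "T \<subseteq> {y \<in> carrier A. \<forall>x\<in>vspan V A S. y \<otimes>\<^bsub>A\<^esub> x \<in> N}"
    using assms(3) vspan_carrier [OF assms(2)] A.m_comm by (smt (verit) mem_Collect_eq subset_iff)
  then have "vspan V A T \<subseteq> {y \<in> carrier A. \<forall>x\<in>vspan V A S. y \<otimes>\<^bsub>A\<^esub> x \<in> N}"
    by (rule vspan_min [OF submodule_mult_preimage [OF assms(1) vspan_carrier [OF assms(2)]]])
  moreover have "x \<in> carrier A" using 1 assms(5) by blast
  ultimately show ?thesis using assms(5,6) A.m_comm [of x y] by (auto simp: subset_iff)
qed

lemma mpow_submodule:
  assumes "S \<subseteq> carrier A"
  shows "submodule (mpow V A S n) V A"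
proof (induction n)
  case 0
  then show ?case by (simp add: vspan_submodule)
next
  case (Suc n)
  then show ?case using assms submodule_closed(1) [OF Suc] by (auto intro!: vspan_submodule)
qed

lemmas mpow_closed = submodule_closed [OF mpow_submodule]

lemma mpow_Suc_mult:
  assumes "x \<in> mpow V A S n" "y \<in> S"
  shows "x \<otimes>\<^bsub>A\<^esub> y \<in> mpow V A S (Suc n)"
  using assms vspan_incl [of "{x \<otimes>\<^bsub>A\<^esub> y |x y. x \<in> mpow V A S n \<and> y \<in> S}"] by auto

lemma mpow_Suc_min:
  assumes "submodule N V A" "\<And>x y. x \<in> mpow V A S n \<Longrightarrow> y \<in> S \<Longrightarrow> x \<otimes>\<^bsub>A\<^esub> y \<in> N"
  shows "mpow V A S (Suc n) \<subseteq> N"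
  unfolding mpow.simps by (rule vspan_min [OF assms(1)]) (use assms(2) in blast)

lemma one_mpow_0: "\<one>\<^bsub>A\<^esub> \<in> mpow V A S 0"
  using vspan_incl [of "{\<one>\<^bsub>A\<^esub>}"] by simp

lemma subset_mpow_1: "S \<subseteq> carrier A \<Longrightarrow> S \<subseteq> mpow V A S 1"
  using mpow_Suc_mult [OF one_mpow_0, of _ S] by force

text \<open>A counterpart of \<open>mpow_mult\<close>: the power with exponent \<open>a + b\<close>
  is no larger than the span of the products. It allows a degree to be split into a constant and a
  linear part.\<close>

lemma mpow_add_min:
  assumes "submodule N V A" "S \<subseteq> carrier A"
    "\<And>x y. x \<in> mpow V A S a \<Longrightarrow> y \<in> mpow V A S b \<Longrightarrow> x \<otimes>\<^bsub>A\<^esub> y \<in> N"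
  shows "mpow V A S (a + b) \<subseteq> N"
  using assms(1,3)
proof (induction b arbitrary: N)
  case 0
  then show ?case using mpow_closed(6) [OF assms(2)] one_mpow_0 by force
next
  case (Suc b)
  \<comment> \<open>The last factor is moved into the target: the colon submodule by
    \<open>S\<close> takes the place of \<open>N\<close>, which is why \<open>N\<close> is
    generalised in the induction.\<close>
  let ?N = "{x \<in> carrier A. \<forall>y\<in>S. x \<otimes>\<^bsub>A\<^esub> y \<in> N}"
  have "mpow V A S (a + b) \<subseteq> ?N"
  proof (rule Suc.IH)
    show "submodule ?N V A" using submodule_mult_preimage Suc assms(2) by blast
    fix x y assume xy: "x \<in> mpow V A S a" "y \<in> mpow V A S b"
    then have c: "x \<in> carrier A" "y \<in> carrier A" using mpow_closed(6) [OF assms(2)] by auto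
    have "x \<otimes>\<^bsub>A\<^esub> y \<otimes>\<^bsub>A\<^esub> s \<in> N" if "s \<in> S" for s
      using Suc.prems(2) [OF xy(1) mpow_Suc_mult [OF xy(2) that]] c that assms(2)
      by (auto simp: A.m_assoc)
    then show "x \<otimes>\<^bsub>A\<^esub> y \<in> ?N" using c by simp
  qed
  then have "mpow V A S (Suc (a + b)) \<subseteq> N"
    by (intro mpow_Suc_min [OF Suc.prems(1)]) blast
  then show ?case by simp
qed

lemma mpow_mult:
  assumes "S \<subseteq> carrier A" "x \<in> mpow V A S a" "y \<in> mpow V A S b"
  shows "x \<otimes>\<^bsub>A\<^esub> y \<in> mpow V A S (a + b)"
  using assms(3)
proof (induction b arbitrary: y)
  case 0
  have x: "x \<in> carrier A" using mpow_closed(6) assms by blast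
  show ?case
    by (rule vspan_mult [OF mpow_submodule [OF assms(1)], of "{x}" "{\<one>\<^bsub>A\<^esub>}"])
      (use x 0 assms(2) vspan_incl [of "{x}"] in auto)
next
  case (Suc b)
  have x: "x \<in> carrier A" using mpow_closed(6) assms by blast
  have sub: "{x \<otimes>\<^bsub>A\<^esub> y |x y. x \<in> mpow V A S b \<and> y \<in> S} \<subseteq> carrier A"
    using mpow_closed(6) [OF assms(1)] assms(1) by blast
  show ?case
  proof (rule vspan_mult [OF mpow_submodule [OF assms(1)] _ sub])
    show "{x} \<subseteq> carrier A" using x by simp
    show "x \<in> vspan V A {x}" by (simp add: vspan_base)
    show "y \<in> vspan V A {x \<otimes>\<^bsub>A\<^esub> y |x y. x \<in> mpow V A S b \<and> y \<in> S}" using Suc.prems by simp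
    fix x' y' assume "x' \<in> {x}" "y' \<in> {x \<otimes>\<^bsub>A\<^esub> y |x y. x \<in> mpow V A S b \<and> y \<in> S}"
    then obtain u s where *: "x' = x" "y' = u \<otimes>\<^bsub>A\<^esub> s" "u \<in> mpow V A S b" "s \<in> S" by blast
    then have "x' \<otimes>\<^bsub>A\<^esub> y' = (x \<otimes>\<^bsub>A\<^esub> u) \<otimes>\<^bsub>A\<^esub> s"
      using x assms(1) mpow_closed(6) [OF assms(1), of u b] by (auto simp: A.m_assoc)
    then show "x' \<otimes>\<^bsub>A\<^esub> y' \<in> mpow V A S (a + Suc b)"
      using mpow_Suc_mult [OF Suc.IH [OF *(3)] *(4)] by simp
  qed
qed

lemma mpow_mono:
  assumes "S \<subseteq> carrier A" "\<one>\<^bsub>A\<^esub> \<in> S" "a \<le> b"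
  shows "mpow V A S a \<subseteq> mpow V A S b"
  using assms(3)
proof (induction b rule: dec_induct)
  case (step b)
  have "x \<in> mpow V A S (Suc b)" if "x \<in> mpow V A S b" for x
    using mpow_Suc_mult [OF that assms(2)] mpow_closed(6) [OF assms(1) that] by simp
  then show ?case using step by blast
qed simp

lemma mpow_mono_set:
  assumes "S \<subseteq> T" "T \<subseteq> carrier A"
  shows "mpow V A S n \<subseteq> mpow V A T n"
proof (induction n)
  case (Suc n)
  show ?case
    by (rule mpow_Suc_min [OF mpow_submodule [OF assms(2)]])
      (use Suc assms(1) in \<open>blast intro: mpow_Suc_mult\<close>)
qed simp

end

lemma algebra_palgebra:
  assumes "algebra V A" "p \<in> carrier V"
  shows "palgebra V A p"
proof -
  interpret algebra V A by fact
  show ?thesis by unfold_locales (use assms(2) smult_assoc2 in auto)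
qed

section \<open>Dickson's lemma, in the form of nondecreasing subsequences\<close>

lemma dickson_nat:
  fixes s :: "nat \<Rightarrow> nat"
  shows "\<exists>f. strict_mono f \<and> incseq (\<lambda>n. s (f n))"
proof -
  obtain f where f: "strict_mono f" "monoseq (\<lambda>n. s (f n))" using seq_monosub by blast
  show ?thesis
  proof (cases "incseq (\<lambda>n. s (f n))")
    case False
    then have dec: "decseq (\<lambda>n. s (f n))" using f(2) by (simp add: monoseq_iff)
    \<comment> \<open>A nonincreasing sequence of naturals is constant from the point where it
      attains its least value, and a constant sequence is nondecreasing.\<close>
    define l where "l = (LEAST v. \<exists>n. v = s (f n))"
    obtain n where n: "l = s (f n)" unfolding l_def using LeastI_ex [of "\<lambda>v. \<exists>n. v = s (f n)"] by blast
    have "s (f (n + k)) = l" for k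
    proof (rule antisym)
      show "s (f (n + k)) \<le> l" using decseqD [OF dec, of n "n + k"] n by simp
      show "l \<le> s (f (n + k))" unfolding l_def by (rule Least_le) blast
    qed
    moreover have "strict_mono (\<lambda>k. f (n + k))" using f(1) by (simp add: strict_mono_def)
    ultimately show ?thesis by (intro exI [of _ "\<lambda>k. f (n + k)"]) (simp add: incseq_def)
  qed (use f in blast)
qed

text \<open>Coordinates are treated one at a time; thinning the sequence further keeps the
  coordinates already treated nondecreasing.\<close>

lemma dickson:
  fixes s :: "nat \<Rightarrow> 'j \<Rightarrow> nat"
  assumes "finite J"
  shows "\<exists>f. strict_mono f \<and> (\<forall>j\<in>J. incseq (\<lambda>n. s (f n) j))"
  using assms
proof induction
  case empty
  show ?case using strict_mono_id by blast
next
  case (insert j J)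
  then obtain f where f: "strict_mono f" "\<forall>j\<in>J. incseq (\<lambda>n. s (f n) j)" by blast
  obtain g where g: "strict_mono g" "incseq (\<lambda>n. s (f (g n)) j)"
    using dickson_nat [of "\<lambda>n. s (f n) j"] by blast
  have "strict_mono (\<lambda>n. f (g n))" using strict_mono_o [OF f(1) g(1)] by (simp add: o_def)
  moreover have "incseq (\<lambda>n. s (f (g n)) i)" if "i \<in> J" for i
    using f(2) that g(1) by (auto simp: incseq_def strict_mono_less_eq)
  ultimately show ?case using g(2) by (intro exI [of _ "\<lambda>n. f (g n)"]) simp
qed

section \<open>Reduction of monomials and division by powers of \<open>p\<close>\<close>

locale generated_palgebra = palgebra V A p for V :: "'v ring" and A :: "('v, 'r) module" and p +
  fixes a :: "nat \<Rightarrow> 'r" and m :: nat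
  assumes a_closed [simp, intro]: "a i \<in> carrier A"
    and a_0: "a 0 = \<one>\<^bsub>A\<^esub>"
    and unit_or_p_multiple: "v \<in> carrier V \<Longrightarrow> v \<in> Units V \<or> (\<exists>v'\<in>carrier V. v = p \<otimes>\<^bsub>V\<^esub> v')"
    and exhaust: "x \<in> carrier A \<Longrightarrow> \<exists>n. x \<in> mpow V A (vspan V A (a ` {..m})) n"
begin

abbreviation G where "G \<equiv> vspan V A (a ` {..m})"
abbreviation Rn where "Rn n \<equiv> mpow V A G n"

lemma G_carrier: "G \<subseteq> carrier A" by (rule vspan_carrier) auto

lemma a_in_G: "i \<le> m \<Longrightarrow> a i \<in> G" using vspan_incl [of "a ` {..m}"] by blast

lemmas Rn_submodule = mpow_submodule [OF G_carrier]
lemmas Rn_closed = submodule_closed [OF mpow_submodule [OF G_carrier]]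

definition mon :: "nat multiset \<Rightarrow> 'r" where
  "mon \<mu> = finprod A (\<lambda>i. a i [^]\<^bsub>A\<^esub> count \<mu> i) {..m}"

lemma mon_closed [simp, intro]: "mon \<mu> \<in> carrier A"
  unfolding mon_def by (rule A.finprod_closed) auto

lemma mon_add: "mon (\<mu> + \<nu>) = mon \<mu> \<otimes>\<^bsub>A\<^esub> mon \<nu>"
proof -
  have "mon (\<mu> + \<nu>) = finprod A (\<lambda>i. a i [^]\<^bsub>A\<^esub> count \<mu> i \<otimes>\<^bsub>A\<^esub> a i [^]\<^bsub>A\<^esub> count \<nu> i) {..m}"
    unfolding mon_def by (rule A.finprod_cong') (auto simp: A.nat_pow_mult)
  also have "\<dots> = mon \<mu> \<otimes>\<^bsub>A\<^esub> mon \<nu>"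
    unfolding mon_def by (rule A.finprod_multf) auto
  finally show ?thesis .
qed

lemma mon_empty [simp]: "mon {#} = \<one>\<^bsub>A\<^esub>"
  unfolding mon_def by (simp add: A.finprod_one_eqI)

lemma mon_single:
  assumes "i \<le> m"
  shows "mon {#i#} = a i"
proof -
  have "mon {#i#} = finprod A (\<lambda>j. if i = j then a j else \<one>\<^bsub>A\<^esub>) {..m}"
    unfolding mon_def by (rule A.finprod_cong') auto
  also have "\<dots> = a i" using assms by (subst A.finprod_singleton) auto
  finally show ?thesis .
qed

abbreviation Mons where "Mons n \<equiv> {\<mu>. set_mset \<mu> \<subseteq> {..m} \<and> size \<mu> = n}"

lemma finite_Mons: "finite (Mons n)"
  using finite_multisets_of_size [of "{..m}" n] by (simp add: multisets_of_size_def)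

lemma mon_in_Rn: "set_mset \<mu> \<subseteq> {..m} \<Longrightarrow> mon \<mu> \<in> Rn (size \<mu>)"
proof (induction \<mu>)
  case empty
  then show ?case using one_mpow_0 by simp
next
  case (add i \<mu>)
  then have "mon \<mu> \<otimes>\<^bsub>A\<^esub> a i \<in> Rn (Suc (size \<mu>))"
    by (intro mpow_Suc_mult a_in_G) auto
  moreover have "mon (add_mset i \<mu>) = mon \<mu> \<otimes>\<^bsub>A\<^esub> a i"
    using mon_add [of \<mu> "{#i#}"] mon_single [of i] add.prems by simp
  ultimately show ?case by simp
qed

lemma mon_image_carrier [simp]: "mon ` X \<subseteq> carrier A" by auto

lemma Rn_spanned: "Rn n \<subseteq> vspan V A (mon ` Mons n)"
proof (induction n)
  case 0
  have "Mons 0 = {{#}}" by auto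
  then show ?case by simp
next
  case (Suc n)
  show ?case
  proof (rule mpow_Suc_min [OF vspan_submodule [OF mon_image_carrier]])
    fix x y assume "x \<in> Rn n" "y \<in> G"
    then show "x \<otimes>\<^bsub>A\<^esub> y \<in> vspan V A (mon ` Mons (Suc n))"
    proof (intro vspan_mult [of "vspan V A (mon ` Mons (Suc n))" "mon ` Mons n" "a ` {..m}" x y])
      fix x y assume "x \<in> mon ` Mons n" "y \<in> a ` {..m}"
      then obtain \<mu> i where *: "\<mu> \<in> Mons n" "x = mon \<mu>" "i \<le> m" "y = a i" by auto
      then have "x \<otimes>\<^bsub>A\<^esub> y = mon (add_mset i \<mu>)" "add_mset i \<mu> \<in> Mons (Suc n)"
        using mon_add [of \<mu> "{#i#}"] mon_single [of i] by auto
      then have "x \<otimes>\<^bsub>A\<^esub> y \<in> mon ` Mons (Suc n)" by blast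
      then show "x \<otimes>\<^bsub>A\<^esub> y \<in> vspan V A (mon ` Mons (Suc n))" by (rule vspan_base)
    qed (use Suc in \<open>auto intro!: vspan_submodule\<close>)
  qed
qed

text \<open>The monomial order is the multiset order on exponents: a total well-order that is
  compatible with multiplication. Comparing only monomials of equal size loses nothing, since
  \<open>a 0\<close> is the unit and pads lower degrees.\<close>

definition low where
  "low \<mu> = vspan V A (mon ` {\<nu> \<in> Mons (size \<mu>). \<nu> < \<mu>})"

lemma low_submodule: "submodule (low \<mu>) V A"
  unfolding low_def by (rule vspan_submodule) simp

lemma low_mult:
  assumes "y \<in> low \<mu>" "set_mset \<beta> \<subseteq> {..m}"
  shows "y \<otimes>\<^bsub>A\<^esub> mon \<beta> \<in> low (\<mu> + \<beta>)"
proof (rule vspan_mult [OF low_submodule])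
  show "y \<in> vspan V A (mon ` {\<nu> \<in> Mons (size \<mu>). \<nu> < \<mu>})" using assms(1) by (simp add: low_def)
  show "mon \<beta> \<in> vspan V A {mon \<beta>}" by (simp add: vspan_base)
  fix x y assume "x \<in> mon ` {\<nu> \<in> Mons (size \<mu>). \<nu> < \<mu>}" "y \<in> {mon \<beta>}"
  then obtain \<nu> where *: "\<nu> \<in> Mons (size \<mu>)" "\<nu> < \<mu>" "x = mon \<nu>" "y = mon \<beta>" by blast
  then have "x \<otimes>\<^bsub>A\<^esub> y = mon (\<nu> + \<beta>)" "\<nu> + \<beta> \<in> {\<nu> \<in> Mons (size (\<mu> + \<beta>)). \<nu> < \<mu> + \<beta>}"
    using assms(2) by (auto simp: mon_add)
  then have "x \<otimes>\<^bsub>A\<^esub> y \<in> mon ` {\<nu> \<in> Mons (size (\<mu> + \<beta>)). \<nu> < \<mu> + \<beta>}" by blast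
  then show "x \<otimes>\<^bsub>A\<^esub> y \<in> low (\<mu> + \<beta>)" unfolding low_def by (rule vspan_base)
qed auto

text \<open>The pairs \<open>(i, \<mu>)\<close> satisfying the premise correspond to the leading monomials \<open>\<mu>\<close> of the
  reductions modulo \<open>p\<close> of polynomials \<open>F\<close> such that \<open>p\<^sup>i F\<close> is a relation in the algebra. They are
  closed upwards, so Dickson's lemma bounds the degree of the correction term uniformly.\<close>
lemma uniform_reduction:
  "\<exists>e. \<forall>i \<mu>. set_mset \<mu> \<subseteq> {..m} \<longrightarrow>
     (\<exists>y\<in>low \<mu>. \<exists>z\<in>carrier A. pw i (mon \<mu>) = pw i y \<oplus>\<^bsub>A\<^esub> pw (Suc i) z) \<longrightarrow>
     (\<exists>y\<in>low \<mu>. \<exists>z\<in>Rn (size \<mu> + e). pw i (mon \<mu>) = pw i y \<oplus>\<^bsub>A\<^esub> pw (Suc i) z)"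
proof -
  define P where "P e i \<mu> \<longleftrightarrow>
    (\<exists>y\<in>low \<mu>. \<exists>z\<in>Rn (size \<mu> + e). pw i (mon \<mu>) = pw i y \<oplus>\<^bsub>A\<^esub> pw (Suc i) z)" for e i \<mu>
  define Q where "Q i \<mu> \<longleftrightarrow>
    (\<exists>y\<in>low \<mu>. \<exists>z\<in>carrier A. pw i (mon \<mu>) = pw i y \<oplus>\<^bsub>A\<^esub> pw (Suc i) z)" for i \<mu>
  have Rn_mono: "Rn k \<subseteq> Rn l" if "k \<le> l" for k l
    using mpow_mono [OF G_carrier _ that] a_in_G [of 0] a_0 by simp
  have P_mono: "P e' i \<mu>" if "P e i \<mu>" "e \<le> e'" for e e' i \<mu>
    using that Rn_mono [of "size \<mu> + e" "size \<mu> + e'"] unfolding P_def by auto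
  have QP: "\<exists>e. P e i \<mu>" if Q: "Q i \<mu>" for i \<mu>
  proof -
    obtain y z where yz: "y \<in> low \<mu>" "z \<in> carrier A" "pw i (mon \<mu>) = pw i y \<oplus>\<^bsub>A\<^esub> pw (Suc i) z"
      using Q unfolding Q_def by blast
    obtain n where "z \<in> Rn n" using exhaust [OF yz(2)] by blast
    then have "z \<in> Rn (size \<mu> + n)" using Rn_mono [of n "size \<mu> + n"] by auto
    then show ?thesis using yz unfolding P_def by blast
  qed
  have P_up: "P e (i + c) (\<mu> + \<beta>)" if P: "P e i \<mu>" and \<beta>: "set_mset \<beta> \<subseteq> {..m}" for e i c \<mu> \<beta>
  proof -
    obtain y z where yz: "y \<in> low \<mu>" "z \<in> Rn (size \<mu> + e)"
        "pw i (mon \<mu>) = pw i y \<oplus>\<^bsub>A\<^esub> pw (Suc i) z"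
      using P unfolding P_def by blast
    have c: "y \<in> carrier A" "z \<in> carrier A"
      using yz submodule_closed(6) [OF low_submodule] Rn_closed(6) by auto
    have "pw (i + c) (mon (\<mu> + \<beta>)) = pw c (pw i (mon \<mu>) \<otimes>\<^bsub>A\<^esub> mon \<beta>)"
      by (simp add: mon_add smult_assoc2 pw_pw add.commute [of i])
    also have "\<dots> = pw c (pw i (y \<otimes>\<^bsub>A\<^esub> mon \<beta>)) \<oplus>\<^bsub>A\<^esub> pw c (pw (Suc i) (z \<otimes>\<^bsub>A\<^esub> mon \<beta>))"
      unfolding yz(3) using c by (simp add: A.l_distr smult_assoc2 smult_r_distr)
    also have "\<dots> = pw (i + c) (y \<otimes>\<^bsub>A\<^esub> mon \<beta>) \<oplus>\<^bsub>A\<^esub> pw (Suc (i + c)) (z \<otimes>\<^bsub>A\<^esub> mon \<beta>)"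
      by (simp only: pw_pw A.m_closed mon_closed c add_Suc add_Suc_right add.commute [of c])
    finally have "pw (i + c) (mon (\<mu> + \<beta>)) = \<dots>" .
    moreover have "y \<otimes>\<^bsub>A\<^esub> mon \<beta> \<in> low (\<mu> + \<beta>)" using low_mult yz(1) \<beta> .
    moreover have "z \<otimes>\<^bsub>A\<^esub> mon \<beta> \<in> Rn (size (\<mu> + \<beta>) + e)"
      using mpow_mult [OF G_carrier yz(2) mon_in_Rn [OF \<beta>]] by (simp add: ac_simps)
    ultimately show ?thesis unfolding P_def by blast
  qed
  have "\<exists>e. \<forall>i \<mu>. set_mset \<mu> \<subseteq> {..m} \<longrightarrow> Q i \<mu> \<longrightarrow> P e i \<mu>"
  proof (rule ccontr)
    assume "\<not> ?thesis"
    then have "\<forall>e. \<exists>i \<mu>. set_mset \<mu> \<subseteq> {..m} \<and> Q i \<mu> \<and> \<not> P e i \<mu>" by blast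
    then obtain I W where IW: "\<And>e. set_mset (W e) \<subseteq> {..m}" "\<And>e. Q (I e) (W e)" "\<And>e. \<not> P e (I e) (W e)"
      by metis
    \<comment> \<open>Dickson's lemma is applied in \<open>m + 2\<close> coordinates: the slots up
      to \<open>m\<close> hold the exponents of the generators, the slot \<open>Suc m\<close> holds
      the exponent of \<open>p\<close>.\<close>
    obtain f where f: "strict_mono f"
      "\<forall>j\<in>{..Suc m}. incseq (\<lambda>n. if j \<le> m then count (W (f n)) j else I (f n))"
      using dickson [of "{..Suc m}" "\<lambda>n j. if j \<le> m then count (W n) j else I n"] by auto
    obtain e where e: "P e (I (f 0)) (W (f 0))" using QP IW(2) by blast
    have W: "W (f 0) \<subseteq># W (f e)"
    proof (rule mset_subset_eqI)
      fix j
      show "count (W (f 0)) j \<le> count (W (f e)) j"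
      proof (cases "j \<le> m")
        case True
        then show ?thesis using f(2) [rule_format, of j] by (auto dest: incseqD [of _ 0 e])
      next
        case False
        then have "count (W (f 0)) j = 0" using IW(1) [of "f 0"] by (auto simp: count_eq_zero_iff)
        then show ?thesis by simp
      qed
    qed
    have I: "I (f 0) \<le> I (f e)" using f(2) [rule_format, of "Suc m"] by (auto dest: incseqD [of _ 0 e])
    have "set_mset (W (f e) - W (f 0)) \<subseteq> {..m}" using IW(1) [of "f e"] by (auto dest: in_diffD)
    from P_up [OF e this, of "I (f e) - I (f 0)"] have "P e (I (f e)) (W (f e))"
      using W I by simp
    \<comment> \<open>Any constant that works for the first term of the subsequence works for all
      later ones. At place \<open>e\<close> this contradicts the choice of a pair failing for
      \<open>f e\<close>, because \<open>e \<le> f e\<close>.\<close>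
    then have "P (f e) (I (f e)) (W (f e))" using P_mono seq_suble [OF f(1)] by blast
    then show False using IW(3) by blast
  qed
  then show ?thesis unfolding P_def Q_def .
qed

text \<open>Multivariate division, performed on \<open>p^i x\<close> rather than on \<open>x\<close>
  because \<open>p\<close> may be a zero divisor. Each reduction lowers the leading monomial and
  keeps the size \<open>n\<close>; the parts of degree up to \<open>n + e\<close> are already
  divisible by \<open>p^(i+1)\<close> and are set aside. So the degree rises by \<open>e\<close>
  once in total, not once per reduction.\<close>

lemma division_step:
  "\<exists>e. \<forall>i n x. x \<in> Rn n \<longrightarrow> pw i x \<in> pmul V p A (Suc i) (carrier A) \<longrightarrow>
     pw i x \<in> pmul V p A (Suc i) (Rn (n + e))"
proof -
  obtain e where e: "\<And>i \<mu> y z. \<lbrakk>set_mset \<mu> \<subseteq> {..m}; y \<in> low \<mu>; z \<in> carrier A;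
        pw i (mon \<mu>) = pw i y \<oplus>\<^bsub>A\<^esub> pw (Suc i) z\<rbrakk> \<Longrightarrow>
      \<exists>y\<in>low \<mu>. \<exists>z\<in>Rn (size \<mu> + e). pw i (mon \<mu>) = pw i y \<oplus>\<^bsub>A\<^esub> pw (Suc i) z"
    using uniform_reduction by blast
  define C where "C i = pmul V p A (Suc i) (carrier A)" for i
  define D where "D i n = pmul V p A (Suc i) (Rn (n + e))" for i n
  have subC: "submodule (C i) V A" and subD: "submodule (D i n) V A" for i n
    unfolding C_def D_def using pmul_submodule carrier_is_submodule Rn_submodule by auto
  note Cc = submodule_closed [OF subC] and Dc = submodule_closed [OF subD]
  have D_C: "D i n \<subseteq> C i" for i n
    unfolding C_def D_def by (rule pmul_mono) (rule Rn_closed)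
  define S where "S n X = vspan V A (mon ` {\<nu> \<in> Mons n. \<nu> \<in> X})" for n X
  have Sc: "submodule (S n X) V A" for n X unfolding S_def by (rule vspan_submodule) simp
  have low_S: "low \<mu> = S (size \<mu>) {..<\<mu>}" for \<mu> by (simp add: low_def S_def)
  have step: "pw i x \<in> D i n" if "\<mu> \<in> Mons n" "x \<in> S n {..\<mu>}" "pw i x \<in> C i" for i n \<mu> x
    using that
  proof (induction \<mu> arbitrary: x rule: wf_induct_rule [OF wf])
    case (1 \<mu>)
    note c = submodule_closed(6) [OF Sc]
    \<comment> \<open>There are finitely many monomials of size \<open>n\<close>, so a strict bound
      by \<open>\<mu>\<close> is a weak bound by the largest monomial below \<open>\<mu>\<close>, to
      which the well-founded induction applies.\<close>
    have IH: "pw i y \<in> D i n" if y: "y \<in> S n {..<\<mu>}" and yC: "pw i y \<in> C i" for y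
    proof (cases "{\<nu> \<in> Mons n. \<nu> < \<mu>} = {}")
      case True
      then have "S n {..<\<mu>} = {\<zero>\<^bsub>A\<^esub>}" unfolding S_def lessThan_iff by (simp only: image_empty vspan_empty)
      then have "y = \<zero>\<^bsub>A\<^esub>" using y by simp
      then show ?thesis using Dc(2) by simp
    next
      case False
      let ?X = "{\<nu> \<in> Mons n. \<nu> < \<mu>}"
      have fin: "finite ?X" using finite_Mons [of n] by (rule finite_subset [rotated]) auto
      have mx: "Max ?X \<in> ?X" using Max_in [OF fin False] .
      have "?X \<subseteq> {\<nu> \<in> Mons n. \<nu> \<le> Max ?X}" using Max_ge [OF fin] by auto
      then have "S n {..<\<mu>} \<subseteq> S n {..Max ?X}"
        unfolding S_def by (intro vspan_mono image_mono) auto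
      then show ?thesis using 1(1) [of "Max ?X" y] mx y yC by auto
    qed
    have "{\<nu> \<in> Mons n. \<nu> \<in> {..\<mu>}} = insert \<mu> {\<nu> \<in> Mons n. \<nu> \<in> {..<\<mu>}}"
      using 1(2) by auto
    then have "x \<in> vspan V A (insert (mon \<mu>) (mon ` {\<nu> \<in> Mons n. \<nu> \<in> {..<\<mu>}}))"
      using 1(3) by (simp add: S_def)
    then obtain v y where vy: "v \<in> carrier V" "y \<in> S n {..<\<mu>}" "x = v \<odot>\<^bsub>A\<^esub> mon \<mu> \<oplus>\<^bsub>A\<^esub> y"
      by (rule vspan_insertE) (auto simp: S_def)
    have yc: "y \<in> carrier A" using c vy(2) .
    have x: "pw i x = v \<odot>\<^bsub>A\<^esub> pw i (mon \<mu>) \<oplus>\<^bsub>A\<^esub> pw i y"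
      using vy yc by (simp add: smult_r_distr smult_commute [of v])
    show ?case
    proof (cases "v \<in> Units V")
      \<comment> \<open>If \<open>p\<close> divides the leading coefficient, the leading term lies
        in \<open>D i n\<close> as it stands and can be subtracted.\<close>
      case False
      then obtain v' where v': "v' \<in> carrier V" "v = p \<otimes>\<^bsub>V\<^esub> v'" using unit_or_p_multiple vy(1) by blast
      have "v \<odot>\<^bsub>A\<^esub> pw i (mon \<mu>) = pw (Suc i) (v' \<odot>\<^bsub>A\<^esub> mon \<mu>)"
        using v' by (simp add: smult_assoc1 [symmetric] R.m_ac)
      moreover have "v' \<odot>\<^bsub>A\<^esub> mon \<mu> \<in> Rn (n + e)"
        using mon_in_Rn [of \<mu>] 1(2) mpow_mono [OF G_carrier _ le_add1, of n e] a_in_G [of 0] a_0 v'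
        by (auto intro!: Rn_closed(4))
      ultimately have vD: "v \<odot>\<^bsub>A\<^esub> pw i (mon \<mu>) \<in> D i n"
        unfolding D_def pmul_iff by blast
      have "pw i y = pw i x \<ominus>\<^bsub>A\<^esub> v \<odot>\<^bsub>A\<^esub> pw i (mon \<mu>)"
        unfolding x using vy(1) yc by (simp add: A.minus_eq A.a_ac A.r_neg1 A.r_neg)
      then have "pw i y \<in> C i" using Cc(5) [OF 1(4) subsetD [OF D_C vD]] by simp
      then have "pw i y \<in> D i n" using IH vy(2) by blast
      then show ?thesis unfolding x using Dc(3) vD by blast
    next
      \<comment> \<open>Dividing by the unit \<open>v\<close> shows that
        \<open>p^i mon \<mu>\<close> is congruent to lower terms modulo \<open>p^(i+1)\<close>,
        which is the premise of the uniform reduction. Replacing it by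
        \<open>p^i q + p^(i+1) z\<close> leaves \<open>p^i (q + y')\<close>, which has a smaller
        leading monomial and still lies in \<open>p^(i+1) A\<close>.\<close>
      case True
      define u where "u = inv\<^bsub>V\<^esub> v"
      have u: "u \<in> carrier V" "u \<otimes>\<^bsub>V\<^esub> v = \<one>\<^bsub>V\<^esub>" "v \<otimes>\<^bsub>V\<^esub> u = \<one>\<^bsub>V\<^esub>" using True by (auto simp: u_def)
      have uv: "u \<odot>\<^bsub>A\<^esub> (v \<odot>\<^bsub>A\<^esub> z) = z" "v \<odot>\<^bsub>A\<^esub> (u \<odot>\<^bsub>A\<^esub> z) = z" if "z \<in> carrier A" for z
        using u vy(1) that by (simp_all add: smult_assoc1 [symmetric])
      define y' where "y' = u \<odot>\<^bsub>A\<^esub> y"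
      have y': "y' \<in> S n {..<\<mu>}" "y' \<in> carrier A"
        using submodule_closed(4) [OF Sc] u(1) vy(2) yc by (auto simp: y'_def)
      have ux: "u \<odot>\<^bsub>A\<^esub> pw i x = pw i (mon \<mu>) \<oplus>\<^bsub>A\<^esub> pw i y'"
        unfolding x y'_def using u vy(1) yc
        by (simp add: smult_r_distr uv smult_commute [of u "p [^]\<^bsub>V\<^esub> i"])
      have "u \<odot>\<^bsub>A\<^esub> pw i x \<in> C i" using Cc(4) u(1) 1(4) by blast
      then obtain t where t: "t \<in> carrier A" "pw i (mon \<mu>) \<oplus>\<^bsub>A\<^esub> pw i y' = pw (Suc i) t"
        unfolding ux C_def pmul_iff by blast
      have "pw i (mon \<mu>) = pw i (\<ominus>\<^bsub>A\<^esub> y') \<oplus>\<^bsub>A\<^esub> pw (Suc i) t"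
        unfolding t(2) [symmetric] using y'(2) by (simp add: smult_r_minus A.a_ac A.r_neg2)
      moreover have "\<ominus>\<^bsub>A\<^esub> y' \<in> low \<mu>"
        using y'(1) submoduleE(3) [OF Sc] 1(2) by (simp add: low_S)
      ultimately obtain q z where qz: "q \<in> low \<mu>" "z \<in> Rn (n + e)"
          "pw i (mon \<mu>) = pw i q \<oplus>\<^bsub>A\<^esub> pw (Suc i) z"
        using e [of \<mu> "\<ominus>\<^bsub>A\<^esub> y'" t i] t(1) 1(2) by auto
      have qS: "q \<in> S n {..<\<mu>}" using qz(1) 1(2) by (simp add: low_S)
      have qc: "q \<in> carrier A" "z \<in> carrier A" using c [OF qS] qz(2) Rn_closed(6) by auto
      have zD: "pw (Suc i) z \<in> D i n" unfolding D_def pmul_iff using qz(2) by blast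
      have zc: "pw (Suc i) z \<in> carrier A" using qc by (intro smult_closed ppow_closed)
      have uxD: "u \<odot>\<^bsub>A\<^esub> pw i x = pw i (q \<oplus>\<^bsub>A\<^esub> y') \<oplus>\<^bsub>A\<^esub> pw (Suc i) z"
        unfolding ux qz(3) using qc y'(2) zc by (simp add: smult_r_distr A.a_ac del: R.nat_pow_Suc)
      have "pw i (q \<oplus>\<^bsub>A\<^esub> y') = u \<odot>\<^bsub>A\<^esub> pw i x \<ominus>\<^bsub>A\<^esub> pw (Suc i) z"
        unfolding uxD using qc y'(2) zc
        by (simp add: A.minus_eq A.a_assoc A.r_neg del: R.nat_pow_Suc)
      then have "pw i (q \<oplus>\<^bsub>A\<^esub> y') \<in> C i"
        using Cc(5) [OF \<open>u \<odot>\<^bsub>A\<^esub> pw i x \<in> C i\<close> subsetD [OF D_C zD]] by simp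
      then have "pw i (q \<oplus>\<^bsub>A\<^esub> y') \<in> D i n"
        using IH submodule_closed(3) [OF Sc qS y'(1)] by blast
      then have "u \<odot>\<^bsub>A\<^esub> pw i x \<in> D i n" unfolding uxD using Dc(3) zD by blast
      then have "v \<odot>\<^bsub>A\<^esub> (u \<odot>\<^bsub>A\<^esub> pw i x) \<in> D i n" using Dc(4) vy(1) by blast
      moreover have "x \<in> carrier A" unfolding vy(3) using vy(1) yc by simp
      ultimately show ?thesis by (simp add: uv)
    qed
  qed
  have "pw i x \<in> D i n" if x: "x \<in> Rn n" "pw i x \<in> C i" for i n x
  proof (cases "Mons n = {}")
    case True
    have "x \<in> vspan V A (mon ` Mons n)" using x(1) Rn_spanned [of n] by blast
    then have "x = \<zero>\<^bsub>A\<^esub>" unfolding True by (simp add: vspan_empty)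
    then show ?thesis using Dc(2) by simp
  next
    case False
    have "Mons n \<subseteq> {\<nu> \<in> Mons n. \<nu> \<in> {..Max (Mons n)}}" using Max_ge [OF finite_Mons] by auto
    then have "x \<in> S n {..Max (Mons n)}"
      unfolding S_def
      using subsetD [OF vspan_mono [OF image_mono] subsetD [OF Rn_spanned x(1)]] by simp
    then show ?thesis using step [OF Max_in [OF finite_Mons False]] x(2) by blast
  qed
  then show ?thesis unfolding C_def D_def by blast
qed

text \<open>An effective substitute for the Noetherian arguments (Artin--Rees, Krull).\<close>
theorem linear_division:
  obtains e where "\<And>n k x. x \<in> Rn n \<Longrightarrow> x \<in> pmul V p A k (carrier A) \<Longrightarrow> x \<in> pmul V p A k (Rn (n + e * k))"
proof -
  obtain e where e: "\<And>i n x. x \<in> Rn n \<Longrightarrow> pw i x \<in> pmul V p A (Suc i) (carrier A) \<Longrightarrow>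
     pw i x \<in> pmul V p A (Suc i) (Rn (n + e))"
    using division_step by blast
  have "x \<in> pmul V p A k (Rn (n + e * k))" if "x \<in> Rn n" "x \<in> pmul V p A k (carrier A)" for n k x
    using that(2)
  proof (induction k)
    case 0
    show ?case unfolding pmul_iff using that(1) Rn_closed(6) by force
  next
    case (Suc k)
    have "x \<in> pmul V p A k (carrier A)"
      using Suc.prems pmul_antimono [OF carrier_is_submodule, of k "Suc k"] by auto
    then obtain y where y: "y \<in> Rn (n + e * k)" "x = pw k y" using Suc.IH unfolding pmul_iff by blast
    \<comment> \<open>The next factor \<open>p\<close> costs \<open>e\<close> again, independently
      of \<open>k\<close> and of the degree reached, so the total cost is linear.\<close>
    then show ?case using e [OF y(1), of k] Suc.prems by (simp add: ac_simps)
  qed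
  then show thesis using that by blast
qed

end

section \<open>Overconvergent series\<close>

context palgebra
begin

abbreviation cong :: "nat \<Rightarrow> 'r \<Rightarrow> 'r \<Rightarrow> bool" where
  "cong j x y \<equiv> x \<ominus>\<^bsub>A\<^esub> y \<in> pmul V p A j (carrier A)"

lemmas P_closed = submodule_closed [OF pmul_submodule [OF carrier_is_submodule]]

lemma congI:
  assumes "x = y \<oplus>\<^bsub>A\<^esub> pw j z" "y \<in> carrier A" "z \<in> carrier A"
  shows "cong j x y"
proof -
  have "x \<ominus>\<^bsub>A\<^esub> y = pw j z" using assms by (simp add: A.minus_eq A.a_ac A.r_neg1 A.r_neg2)
  then show ?thesis using assms(3) unfolding pmul_iff by blast
qed

lemma congE:
  assumes "cong j x y" "x \<in> carrier A" "y \<in> carrier A"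
  obtains z where "z \<in> carrier A" "x = y \<oplus>\<^bsub>A\<^esub> pw j z"
proof -
  obtain z where z: "z \<in> carrier A" "x \<ominus>\<^bsub>A\<^esub> y = pw j z" using assms(1) unfolding pmul_iff by blast
  have "x = y \<oplus>\<^bsub>A\<^esub> (x \<ominus>\<^bsub>A\<^esub> y)" using assms(2,3) by (simp add: A.minus_eq A.a_ac A.r_neg)
  then show thesis using that z by simp
qed

lemma cong_refl: "x \<in> carrier A \<Longrightarrow> cong j x x"
  using P_closed(2) by (simp add: A.minus_eq A.r_neg)

lemma cong_sym:
  assumes "cong j x y" "x \<in> carrier A" "y \<in> carrier A"
  shows "cong j y x"
proof -
  obtain z where z: "z \<in> carrier A" "x = y \<oplus>\<^bsub>A\<^esub> pw j z" using congE [OF assms] .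
  have "y = x \<oplus>\<^bsub>A\<^esub> pw j (\<ominus>\<^bsub>A\<^esub> z)" unfolding z(2) using z(1) assms(3)
    by (simp add: smult_r_minus A.a_assoc A.r_neg)
  then show ?thesis using congI z(1) assms(2) by blast
qed

lemma cong_trans:
  assumes "cong j x y" "cong j y z" "x \<in> carrier A" "y \<in> carrier A" "z \<in> carrier A"
  shows "cong j x z"
proof -
  obtain u where u: "u \<in> carrier A" "x = y \<oplus>\<^bsub>A\<^esub> pw j u" using congE assms by blast
  obtain v where v: "v \<in> carrier A" "y = z \<oplus>\<^bsub>A\<^esub> pw j v" using congE assms by blast
  have "x = z \<oplus>\<^bsub>A\<^esub> pw j (v \<oplus>\<^bsub>A\<^esub> u)" unfolding u(2) v(2) using u(1) v(1) assms(5)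
    by (simp add: smult_r_distr A.a_assoc)
  then show ?thesis using congI u(1) v(1) assms(5) by blast
qed

lemma cong_add:
  assumes "cong j x x'" "cong j y y'" "x \<in> carrier A" "y \<in> carrier A" "x' \<in> carrier A" "y' \<in> carrier A"
  shows "cong j (x \<oplus>\<^bsub>A\<^esub> y) (x' \<oplus>\<^bsub>A\<^esub> y')"
proof -
  obtain u where u: "u \<in> carrier A" "x = x' \<oplus>\<^bsub>A\<^esub> pw j u" using congE assms by blast
  obtain v where v: "v \<in> carrier A" "y = y' \<oplus>\<^bsub>A\<^esub> pw j v" using congE assms by blast
  have "x \<oplus>\<^bsub>A\<^esub> y = (x' \<oplus>\<^bsub>A\<^esub> y') \<oplus>\<^bsub>A\<^esub> pw j (u \<oplus>\<^bsub>A\<^esub> v)"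
    unfolding u(2) v(2) using u(1) v(1) assms(5,6) by (simp add: smult_r_distr A.a_ac)
  then show ?thesis using congI u(1) v(1) assms(5,6) by blast
qed

lemma cong_smult:
  assumes "cong j x x'" "a \<in> carrier V" "x \<in> carrier A" "x' \<in> carrier A"
  shows "cong j (a \<odot>\<^bsub>A\<^esub> x) (a \<odot>\<^bsub>A\<^esub> x')"
  using P_closed(4) [OF assms(2,1)] assms by (simp add: smult_r_diff)

lemma cong_mult:
  assumes "cong j x x'" "cong j y y'" "x \<in> carrier A" "y \<in> carrier A" "x' \<in> carrier A" "y' \<in> carrier A"
  shows "cong j (x \<otimes>\<^bsub>A\<^esub> y) (x' \<otimes>\<^bsub>A\<^esub> y')"
proof -
  obtain u where u: "u \<in> carrier A" "x = x' \<oplus>\<^bsub>A\<^esub> pw j u" using congE assms by blast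
  obtain v where v: "v \<in> carrier A" "y = y' \<oplus>\<^bsub>A\<^esub> pw j v" using congE assms by blast
  have yc: "y \<in> carrier A" by fact
  have "x \<otimes>\<^bsub>A\<^esub> y = x' \<otimes>\<^bsub>A\<^esub> y \<oplus>\<^bsub>A\<^esub> pw j (u \<otimes>\<^bsub>A\<^esub> y)"
    unfolding u(2) using u(1) yc assms(5) by (simp add: A.l_distr smult_assoc2)
  also have "x' \<otimes>\<^bsub>A\<^esub> y = x' \<otimes>\<^bsub>A\<^esub> y' \<oplus>\<^bsub>A\<^esub> pw j (x' \<otimes>\<^bsub>A\<^esub> v)"
    unfolding v(2) using v(1) assms(5,6) by (simp add: A.r_distr smult_assoc3)
  finally have "x \<otimes>\<^bsub>A\<^esub> y = x' \<otimes>\<^bsub>A\<^esub> y' \<oplus>\<^bsub>A\<^esub> pw j (x' \<otimes>\<^bsub>A\<^esub> v \<oplus>\<^bsub>A\<^esub> u \<otimes>\<^bsub>A\<^esub> y)"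
    using u(1) v(1) yc assms(5,6) by (simp add: smult_r_distr A.a_assoc)
  then show ?thesis using congI u(1) v(1) yc assms(5,6) by blast
qed

lemma cong_pw:
  assumes "cong j x y" "x \<in> carrier A" "y \<in> carrier A"
  shows "cong (i + j) (pw i x) (pw i y)"
proof -
  obtain z where z: "z \<in> carrier A" "x = y \<oplus>\<^bsub>A\<^esub> pw j z" using congE [OF assms] .
  have "pw i x = pw i y \<oplus>\<^bsub>A\<^esub> pw (i + j) z"
    unfolding z(2) using z(1) assms(3) by (simp add: smult_r_distr pw_pw)
  then show ?thesis using congI z(1) assms(3) by blast
qed

lemma cong_rsum:
  assumes "\<And>i. f i \<in> carrier A" "\<And>i. g i \<in> carrier A" "\<And>i. i < k \<Longrightarrow> cong j (f i) (g i)"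
  shows "cong j (rsum f k) (rsum g k)"
  using assms(3)
proof (induction k)
  case (Suc k)
  then show ?case using assms(1,2) by (auto intro!: cong_add)
qed (auto intro: cong_refl)

lemma cong_psum:
  assumes "\<And>j. w j \<in> carrier A" "k \<le> l"
  shows "cong k (psum w l) (psum w k)"
proof -
  obtain y where "y \<in> carrier A" "psum w l = psum w k \<oplus>\<^bsub>A\<^esub> pw k y" using psum_diff [OF assms] .
  then show ?thesis using congI assms(1) by simp
qed

lemma pcoset_iff:
  "x \<in> carrier A \<Longrightarrow> y \<in> pcoset V p A j x \<longleftrightarrow> y \<in> carrier A \<and> cong j y x"
proof -
  assume x: "x \<in> carrier A"
  have "y = x \<oplus>\<^bsub>A\<^esub> (y \<ominus>\<^bsub>A\<^esub> x)" if "y \<in> carrier A"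
    using x that A.a_lcomm [of x y "\<ominus>\<^bsub>A\<^esub> x"] by (simp add: A.minus_eq A.r_neg)
  moreover have "y \<in> carrier A \<and> cong j y x" if "y = x \<oplus>\<^bsub>A\<^esub> pw j u" "u \<in> carrier A" for u
    using congI [OF that(1) x that(2)] x that by simp
  ultimately show ?thesis unfolding pcoset_def by (auto simp: pmul_iff)
qed

lemma pcoset_eqI:
  assumes "cong j x y" "x \<in> carrier A" "y \<in> carrier A"
  shows "pcoset V p A j x = pcoset V p A j y"
proof -
  note sym = cong_sym [OF assms]
  show ?thesis
    using assms(2,3) cong_trans [OF _ assms(1)] cong_trans [OF _ sym] by (auto simp: pcoset_iff)
qed

lemma pcoset_eqD:
  assumes "pcoset V p A j x = pcoset V p A j y" "x \<in> carrier A" "y \<in> carrier A"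
  shows "cong j x y"
  using assms pcoset_iff [of x x j] pcoset_iff [of y x j] cong_refl by auto

text \<open>No coherence of \<open>s\<close> is demanded. The operations of the completion act level
  by level on cosets, so their identities can be checked on arbitrary sequences of
  representatives.\<close>

definition cl :: "(nat \<Rightarrow> 'r) \<Rightarrow> nat \<Rightarrow> 'r set" where
  "cl s = (\<lambda>k. pcoset V p A k (s k))"

lemma cl_eqI:
  assumes "\<And>k. s k \<in> carrier A" "\<And>k. t k \<in> carrier A" "\<And>k. cong k (s k) (t k)"
  shows "cl s = cl t"
  unfolding cl_def using assms by (intro ext pcoset_eqI)

lemma cl_eqD:
  assumes "cl s = cl t" "\<And>k. s k \<in> carrier A" "\<And>k. t k \<in> carrier A"
  shows "cong k (s k) (t k)"
  using assms pcoset_eqD by (auto simp: cl_def fun_eq_iff)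

lemma hrep_cl:
  assumes "s k \<in> carrier A"
  shows "hrep (cl s) k \<in> carrier A" "cong k (hrep (cl s) k) (s k)"
proof -
  have "s k \<in> cl s k" using assms cong_refl by (simp add: cl_def pcoset_iff)
  then have "hrep (cl s) k \<in> cl s k" unfolding hrep_def by (rule someI)
  then show "hrep (cl s) k \<in> carrier A" "cong k (hrep (cl s) k) (s k)"
    using assms by (simp_all add: cl_def pcoset_iff)
qed

lemma hadd_cl:
  assumes "\<And>k. s k \<in> carrier A" "\<And>k. t k \<in> carrier A"
  shows "hadd V p A (cl s) (cl t) = cl (\<lambda>k. s k \<oplus>\<^bsub>A\<^esub> t k)"
  unfolding hadd_def cl_def [of "\<lambda>k. s k \<oplus>\<^bsub>A\<^esub> t k"]
  using assms hrep_cl by (intro ext pcoset_eqI cong_add) auto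

lemma hmul_cl:
  assumes "\<And>k. s k \<in> carrier A" "\<And>k. t k \<in> carrier A"
  shows "hmul V p A (cl s) (cl t) = cl (\<lambda>k. s k \<otimes>\<^bsub>A\<^esub> t k)"
  unfolding hmul_def cl_def [of "\<lambda>k. s k \<otimes>\<^bsub>A\<^esub> t k"]
  using assms hrep_cl by (intro ext pcoset_eqI cong_mult) auto

lemma hsmul_cl:
  assumes "a \<in> carrier V" "\<And>k. s k \<in> carrier A"
  shows "hsmul V p A a (cl s) = cl (\<lambda>k. a \<odot>\<^bsub>A\<^esub> s k)"
  unfolding hsmul_def cl_def [of "\<lambda>k. a \<odot>\<^bsub>A\<^esub> s k"]
  using assms hrep_cl by (intro ext pcoset_eqI cong_smult) auto

lemma hat_emb_cl: "hat_emb V p A x = cl (\<lambda>_. x)"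
  by (simp add: hat_emb_def cl_def)

section \<open>Series with coefficients in prescribed submodules\<close>

definition ser :: "(nat \<Rightarrow> 'r set) \<Rightarrow> (nat \<Rightarrow> 'r set) set" where
  "ser G = {cl (psum w) | w. \<forall>j. w j \<in> G j}"

lemma serI: "(\<And>j. w j \<in> G j) \<Longrightarrow> cl (psum w) \<in> ser G"
  by (auto simp: ser_def)

lemma ser_mono: "(\<And>j. G j \<subseteq> H j) \<Longrightarrow> ser G \<subseteq> ser H"
  by (auto simp: ser_def subset_iff)

lemma psum_single:
  assumes "x \<in> carrier A"
  shows "psum (case_nat x (\<lambda>_. \<zero>\<^bsub>A\<^esub>)) (Suc k) = x"
proof -
  have "psum (\<lambda>_. \<zero>\<^bsub>A\<^esub>) k = \<zero>\<^bsub>A\<^esub>" by (induction k) auto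
  then show ?thesis using psum_case_nat [of x "\<lambda>_. \<zero>\<^bsub>A\<^esub>" k] assms by simp
qed

lemma hat_emb_psum:
  assumes x: "x \<in> carrier A"
  shows "hat_emb V p A x = cl (psum (case_nat x (\<lambda>_. \<zero>\<^bsub>A\<^esub>)))"
  unfolding hat_emb_cl
proof (rule cl_eqI)
  let ?w = "case_nat x (\<lambda>_. \<zero>\<^bsub>A\<^esub>)"
  fix k
  show "psum ?w k \<in> carrier A" using x by (intro psum_closed) (auto split: nat.split)
  show "cong k x (psum ?w k)"
  proof (cases k)
    \<comment> \<open>At level 0 the empty partial sum is zero instead of \<open>x\<close>, but
      congruence modulo \<open>p^0\<close> says nothing.\<close>
    case 0
    then show ?thesis using x by (intro congI [of _ _ _ x]) auto
  next
    case (Suc l)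
    then show ?thesis using x cong_refl by (simp only: psum_single)
  qed
qed (use x in simp)

text \<open>Multiplication by \<open>p\<close> moves every coefficient one place up. This is how
  powers of \<open>p\<close> pay for degree: a linear bound allows larger degrees at later
  places.\<close>

lemma hsmul_p_cl:
  assumes "\<And>j. w j \<in> carrier A"
  shows "hsmul V p A p (cl (psum w)) = cl (psum (case_nat \<zero>\<^bsub>A\<^esub> w))"
proof -
  let ?w = "case_nat \<zero>\<^bsub>A\<^esub> w"
  have ps: "psum ?w (Suc k) = pw 1 (psum w k)" for k
    using psum_case_nat [of "\<zero>\<^bsub>A\<^esub>" w k] assms by simp
  have wc: "psum ?w k \<in> carrier A" for k using assms by (intro psum_closed) (auto split: nat.split)
  have "cl (\<lambda>k. p \<odot>\<^bsub>A\<^esub> psum w k) = cl (psum ?w)"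
  proof (rule cl_eqI)
    fix k
    show "cong k (p \<odot>\<^bsub>A\<^esub> psum w k) (psum ?w k)"
    proof (cases k)
      case 0
      then show ?thesis using wc P_closed(2) by (simp add: A.minus_eq)
    next
      case (Suc l)
      \<comment> \<open>The shifted partial sum lags behind by the term \<open>p^l w l\<close>,
        which becomes divisible by \<open>p^(l+1)\<close> after multiplication by
        \<open>p\<close>.\<close>
      have "cong (1 + l) (pw 1 (psum w (Suc l))) (pw 1 (psum w l))"
        using cong_psum [OF assms, of l "Suc l"] assms by (intro cong_pw psum_closed) auto
      then show ?thesis unfolding Suc ps by simp
    qed
  qed (use wc assms in auto)
  then show ?thesis by (subst hsmul_cl) (use assms in auto)
qed

context
  fixes G :: "nat \<Rightarrow> 'r set"
  assumes G: "\<And>j. submodule (G j) V A"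
begin

lemma ser_cl:
  assumes "z \<in> ser G"
  shows "\<exists>s. (\<forall>k. s k \<in> carrier A) \<and> z = cl s"
proof -
  obtain w where w: "\<And>j. w j \<in> G j" "z = cl (psum w)" using assms by (auto simp: ser_def)
  have "\<And>j. w j \<in> carrier A" using submodule_closed(6) [OF G] w(1) by blast
  then have "psum w k \<in> carrier A" for k by simp
  then show ?thesis using w(2) by blast
qed

lemma ser_hadd:
  assumes "z \<in> ser G" "z' \<in> ser G"
  shows "hadd V p A z z' \<in> ser G"
proof -
  obtain w w' where w: "\<And>j. w j \<in> G j" "z = cl (psum w)" "\<And>j. w' j \<in> G j" "z' = cl (psum w')"
    using assms by (auto simp: ser_def)
  have c: "\<And>j. w j \<in> carrier A" "\<And>j. w' j \<in> carrier A" using submodule_closed(6) [OF G] w by blast+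
  have "hadd V p A z z' = cl (psum (\<lambda>j. w j \<oplus>\<^bsub>A\<^esub> w' j))"
    unfolding w by (subst hadd_cl) (use c in \<open>simp_all add: psum_add cl_def\<close>)
  then show ?thesis using submodule_closed(3) [OF G] w by (auto intro!: serI)
qed

lemma ser_hsmul:
  assumes "a \<in> carrier V" "z \<in> ser G"
  shows "hsmul V p A a z \<in> ser G"
proof -
  obtain w where w: "\<And>j. w j \<in> G j" "z = cl (psum w)" using assms by (auto simp: ser_def)
  have c: "\<And>j. w j \<in> carrier A" using submodule_closed(6) [OF G] w by blast
  have "hsmul V p A a z = cl (psum (\<lambda>j. a \<odot>\<^bsub>A\<^esub> w j))"
    unfolding w by (subst hsmul_cl) (use c assms(1) in \<open>simp_all add: psum_smult cl_def\<close>)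
  then show ?thesis using submodule_closed(4) [OF G] w assms(1) by (auto intro!: serI)
qed

lemma ser_hat:
  assumes "x \<in> G 0"
  shows "hat_emb V p A x \<in> ser G"
proof -
  have x: "x \<in> carrier A" using submodule_closed(6) [OF G] assms .
  show ?thesis unfolding hat_emb_psum [OF x] using assms submodule_closed(2) [OF G]
    by (auto intro!: serI split: nat.split)
qed

lemma ser_shift:
  assumes "z \<in> ser G" "\<And>j. submodule (H j) V A" "\<And>j. G j \<subseteq> H (Suc j)"
  shows "hsmul V p A p z \<in> ser H"
proof -
  obtain w where w: "\<And>j. w j \<in> G j" "z = cl (psum w)" using assms by (auto simp: ser_def)
  have c: "\<And>j. w j \<in> carrier A" using submodule_closed(6) [OF G] w by blast
  have "case_nat \<zero>\<^bsub>A\<^esub> w j \<in> H j" for j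
    using w assms(2,3) submodule_closed(2) by (auto split: nat.split)
  then show ?thesis unfolding w(2) hsmul_p_cl [OF c] by (rule serI)
qed

text \<open>Cauchy product. Three separate filtrations are allowed because the power estimate
  multiplies series whose degree bounds have different shapes.\<close>

lemma ser_hmul:
  assumes H: "\<And>j. submodule (H j) V A" and K: "\<And>j. submodule (K j) V A"
    and GHK: "\<And>i j x y. x \<in> G i \<Longrightarrow> y \<in> H j \<Longrightarrow> x \<otimes>\<^bsub>A\<^esub> y \<in> K (i + j)"
    and "z \<in> ser G" "z' \<in> ser H"
  shows "hmul V p A z z' \<in> ser K"
proof -
  obtain w w' where w: "\<And>j. w j \<in> G j" "z = cl (psum w)" "\<And>j. w' j \<in> H j" "z' = cl (psum w')"
    using assms(4,5) by (auto simp: ser_def)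
  have c: "\<And>j. w j \<in> carrier A" "\<And>j. w' j \<in> carrier A"
    using submodule_closed(6) [OF G] submodule_closed(6) [OF H] w by blast+
  define u where "u i j = w i \<otimes>\<^bsub>A\<^esub> w' j" for i j
  have uc: "u i j \<in> carrier A" for i j using c by (simp add: u_def)
  define v where "v m = rsum (\<lambda>i. u i (m - i)) (Suc m)" for m
  have vc: "v m \<in> carrier A" for m unfolding v_def using uc by (intro rsum_closed)
  have left: "psum w k \<otimes>\<^bsub>A\<^esub> y = rsum (\<lambda>i. pw i (w i \<otimes>\<^bsub>A\<^esub> y)) k" if "y \<in> carrier A" for y k
    using c that by (induction k) (auto simp: A.l_distr smult_assoc2)
  have right: "w i \<otimes>\<^bsub>A\<^esub> psum w' k = psum (u i) k" for i k
    using c by (induction k) (auto simp: A.r_distr smult_assoc3 u_def)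
  have "cl (\<lambda>k. psum w k \<otimes>\<^bsub>A\<^esub> psum w' k) = cl (psum v)"
  proof (rule cl_eqI)
    fix k
    have "psum w k \<otimes>\<^bsub>A\<^esub> psum w' k = rsum (\<lambda>i. pw i (psum (u i) k)) k"
      using left [of "psum w' k" k] c by (simp add: right)
    moreover have "psum v k = rsum (\<lambda>i. pw i (psum (u i) (k - i))) k"
      unfolding v_def using psum_double [of u k] uc by simp
    \<comment> \<open>The product of the partial sums runs over the square, \<open>psum v k\<close>
      over the triangle \<open>i + j < k\<close>; every remaining term carries a factor
      \<open>p^k\<close>.\<close>
    moreover have "cong k (pw i (psum (u i) k)) (pw i (psum (u i) (k - i)))" if "i < k" for i
      using cong_pw [OF cong_psum [of "u i" "k - i" k], of i] uc that by simp
    ultimately show "cong k (psum w k \<otimes>\<^bsub>A\<^esub> psum w' k) (psum v k)"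
      using uc by (auto intro!: cong_rsum)
  qed (use c vc in auto)
  then have "hmul V p A z z' = cl (psum v)" unfolding w by (subst hmul_cl) (use c in auto)
  moreover have "v m \<in> K m" for m
    unfolding v_def
  proof (rule rsum_in_submodule [OF K])
    fix i assume "i < Suc m"
    then show "u i (m - i) \<in> K m" using GHK [OF w(1) w(3), of i "m - i"] by (simp add: u_def)
  qed
  ultimately show ?thesis using serI by metis
qed

end

section \<open>The overconvergent completion and its bounded sets\<close>

abbreviation D where "D \<equiv> dagger V p A"

lemma dagger_simps [simp]:
  "monoid.mult D = hmul V p A" "add D = hadd V p A" "smult D = hsmul V p A"
  "one D = hat_emb V p A \<one>\<^bsub>A\<^esub>" "zero D = hat_emb V p A \<zero>\<^bsub>A\<^esub>"
  by (simp_all add: dagger_def)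

text \<open>A normal form of the degree bound: an integer constant replaces the real one, and the
  exponent is exactly \<open>L * Suc j\<close>. When the unit lies in \<open>M\<close>, the powers
  of \<open>M\<close> increase, so all smaller exponents are covered.\<close>

definition dag :: "'r set \<Rightarrow> nat \<Rightarrow> (nat \<Rightarrow> 'r set) set" where
  "dag M L = ser (\<lambda>j. mpow V A M (L * Suc j))"

lemma mw_gensD:
  assumes "mw_gens V A M"
  shows "M \<subseteq> carrier A" "\<one>\<^bsub>A\<^esub> \<in> M" "submodule M V A"
  using assms vspan_submodule vspan_carrier by (auto simp: mw_gens_def)

lemma mw_gens_Un:
  assumes "mw_gens V A M" "finite F" "F \<subseteq> carrier A"
  shows "\<exists>M'. mw_gens V A M' \<and> M \<subseteq> M' \<and> F \<subseteq> M'"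
proof -
  obtain F' where F': "finite F'" "F' \<subseteq> carrier A" "M = vspan V A F'" "\<one>\<^bsub>A\<^esub> \<in> M"
    using assms(1) by (auto simp: mw_gens_def)
  have "M \<subseteq> vspan V A (F' \<union> F)" unfolding F'(3) by (rule vspan_mono) simp
  moreover have "F \<subseteq> vspan V A (F' \<union> F)" using vspan_incl [of "F' \<union> F"] by simp
  moreover have "finite (F' \<union> F)" "F' \<union> F \<subseteq> carrier A" using F' assms by auto
  ultimately show ?thesis
    using F'(4) unfolding mw_gens_def by (intro exI [of _ "vspan V A (F' \<union> F)"]) blast
qed

lemma mw_gens_one: "mw_gens V A (vspan V A {\<one>\<^bsub>A\<^esub>})"
  unfolding mw_gens_def by (intro conjI exI [of _ "{\<one>\<^bsub>A\<^esub>}"]) (auto simp: vspan_base)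

lemma mw_gens_fine:
  assumes "finite F" "F \<subseteq> carrier A"
  shows "\<exists>M. mw_gens V A M \<and> vspan V A F \<subseteq> M"
proof -
  obtain M where "mw_gens V A M" "F \<subseteq> M" using mw_gens_Un [OF mw_gens_one assms] by blast
  then show ?thesis using vspan_min mw_gensD(3) by blast
qed

lemma mw_gens_Un2:
  assumes "mw_gens V A M" "mw_gens V A N"
  shows "\<exists>M'. mw_gens V A M' \<and> M \<subseteq> M' \<and> N \<subseteq> M'"
proof -
  obtain F where F: "finite F" "F \<subseteq> carrier A" "N = vspan V A F" using assms(2) by (auto simp: mw_gens_def)
  obtain M' where M': "mw_gens V A M'" "M \<subseteq> M'" "F \<subseteq> M'" using mw_gens_Un [OF assms(1) F(1,2)] by blast
  have "N \<subseteq> M'" unfolding F(3) by (rule vspan_min [OF mw_gensD(3) [OF M'(1)] M'(3)])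
  then show ?thesis using M' by blast
qed

lemma dag_mono:
  assumes "mw_gens V A M'" "M \<subseteq> M'" "L \<le> L'"
  shows "dag M L \<subseteq> dag M' L'"
  unfolding dag_def
proof (rule ser_mono)
  fix j
  have "L * Suc j \<le> L' * Suc j" using assms(3) by (rule mult_le_mono1)
  then show "mpow V A M (L * Suc j) \<subseteq> mpow V A M' (L' * Suc j)"
    using mpow_mono_set [OF assms(2)] mpow_mono mw_gensD [OF assms(1)] by blast
qed

lemma dag_directed:
  assumes "mw_gens V A M" "mw_gens V A N"
  shows "\<exists>M' L'. mw_gens V A M' \<and> dag M K \<subseteq> dag M' L' \<and> dag N L \<subseteq> dag M' L'"
proof -
  obtain M' where M': "mw_gens V A M'" "M \<subseteq> M'" "N \<subseteq> M'" using mw_gens_Un2 [OF assms] by blast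
  have "dag M K \<subseteq> dag M' (max K L)" "dag N L \<subseteq> dag M' (max K L)"
    using dag_mono [OF M'(1)] M'(2,3) by auto
  then show ?thesis using M'(1) by blast
qed

lemma mw_rep_dag:
  assumes "mw_gens V A M" "mw_rep V p A M c z"
  shows "z \<in> dag M (nat \<lceil>c\<rceil>)"
proof -
  obtain w \<kappa> where w: "\<And>j. w j \<in> mpow V A M (\<kappa> j)" "\<And>j. real (\<kappa> j) \<le> c * real (j + 1)"
    "\<And>k. z k = pcoset V p A k (finsum A (\<lambda>j. pw j (w j)) {..<k})"
    using assms(2) unfolding mw_rep_def by blast
  note M = mw_gensD [OF assms(1)]
  have c: "w j \<in> carrier A" for j using mpow_closed(6) [OF M(1) w(1)] .
  have "z = cl (psum w)"
    using rsum_finsum [of "\<lambda>j. pw j (w j)"] c by (auto simp: w(3) cl_def psum_def)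
  moreover have "w j \<in> mpow V A M (nat \<lceil>c\<rceil> * Suc j)" for j
  proof -
    have "c \<le> real (nat \<lceil>c\<rceil>)" by linarith
    then have "c * real (j + 1) \<le> real (nat \<lceil>c\<rceil>) * real (j + 1)" by (rule mult_right_mono) simp
    then have "real (\<kappa> j) \<le> real (nat \<lceil>c\<rceil> * (j + 1))" using w(2) [of j] by (simp only: of_nat_mult)
    then have "\<kappa> j \<le> nat \<lceil>c\<rceil> * Suc j" unfolding of_nat_le_iff by simp
    then show ?thesis using mpow_mono [OF M(1,2)] w(1) by blast
  qed
  ultimately show ?thesis unfolding dag_def using serI by metis
qed

text \<open>The constant is \<open>Suc L\<close> because it has to be positive even if
  \<open>L\<close> is zero.\<close>

lemma dag_mw_rep:
  assumes "mw_gens V A M" "z \<in> dag M L"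
  shows "mw_rep V p A M (real (Suc L)) z"
proof -
  obtain w where w: "\<And>j. w j \<in> mpow V A M (L * Suc j)" "z = cl (psum w)"
    using assms(2) unfolding dag_def ser_def by auto
  have c: "w j \<in> carrier A" for j using mpow_closed(6) [OF mw_gensD(1) [OF assms(1)] w(1)] .
  have "real (L * Suc j) \<le> real (Suc L) * real (j + 1)" for j by (simp add: algebra_simps)
  then show ?thesis unfolding mw_rep_def
    using w rsum_finsum [of "\<lambda>j. pw j (w j)"] c
    by (intro exI [of _ w] exI [of _ "\<lambda>j. L * Suc j"]) (auto simp: cl_def psum_def)
qed

lemma dagger_carrier_iff: "z \<in> carrier D \<longleftrightarrow> (\<exists>M L. mw_gens V A M \<and> z \<in> dag M L)"
proof
  assume "z \<in> carrier D"
  then show "\<exists>M L. mw_gens V A M \<and> z \<in> dag M L"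
    using mw_rep_dag unfolding dagger_def dagger_carrier_def by (auto) blast
next
  assume "\<exists>M L. mw_gens V A M \<and> z \<in> dag M L"
  then obtain M L where "mw_gens V A M" "mw_rep V p A M (real (Suc L)) z" using dag_mw_rep by blast
  then have "z \<in> dagger_carrier V p A"
    unfolding dagger_carrier_def by (intro CollectI exI [of _ M] exI [of _ "real (Suc L)"]) auto
  then show "z \<in> carrier D" by (simp add: dagger_def)
qed

lemma dagger_born_iff: "S \<in> dagger_born V p A \<longleftrightarrow> (\<exists>M L. mw_gens V A M \<and> S \<subseteq> dag M L)"
proof
  assume "S \<in> dagger_born V p A"
  then show "\<exists>M L. mw_gens V A M \<and> S \<subseteq> dag M L"
    using mw_rep_dag unfolding dagger_born_def by blast
next
  assume "\<exists>M L. mw_gens V A M \<and> S \<subseteq> dag M L"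
  then obtain M L where gens: "mw_gens V A M" "S \<subseteq> dag M L" by blast
  then have "S \<subseteq> carrier D" using dagger_carrier_iff by blast
  moreover have "\<forall>z\<in>S. mw_rep V p A M (real (Suc L)) z" using gens dag_mw_rep by blast
  moreover have "real (Suc L) > 0" by simp
  ultimately show "S \<in> dagger_born V p A"
    using gens(1) unfolding dagger_born_def dagger_def
    by (intro CollectI conjI exI [of _ M] exI [of _ "real (Suc L)"]) auto
qed

lemma dag_filtration: "mw_gens V A M \<Longrightarrow> submodule (mpow V A M n) V A"
  using mw_gensD mpow_submodule by blast

lemma dagger_cl: "z \<in> carrier D \<Longrightarrow> \<exists>s. (\<forall>k. s k \<in> carrier A) \<and> z = cl s"
  unfolding dagger_carrier_iff dag_def by (metis ser_cl dag_filtration)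

lemma dag_hadd: "mw_gens V A M \<Longrightarrow> x \<in> dag M L \<Longrightarrow> y \<in> dag M L \<Longrightarrow> hadd V p A x y \<in> dag M L"
  unfolding dag_def by (rule ser_hadd [OF dag_filtration])

lemma dag_hsmul: "mw_gens V A M \<Longrightarrow> a \<in> carrier V \<Longrightarrow> x \<in> dag M L \<Longrightarrow> hsmul V p A a x \<in> dag M L"
  unfolding dag_def by (rule ser_hsmul [OF dag_filtration])

lemma dag_hat: "mw_gens V A M \<Longrightarrow> x \<in> M \<Longrightarrow> hat_emb V p A x \<in> dag M 1"
  unfolding dag_def
  by (rule ser_hat [OF dag_filtration]) (use subset_mpow_1 [OF mw_gensD(1)] in auto)

lemma dag_hmul:
  assumes "mw_gens V A M" "x \<in> dag M L" "y \<in> dag M L"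
  shows "hmul V p A x y \<in> dag M (2 * L)"
  unfolding dag_def
proof (rule ser_hmul [OF dag_filtration [OF assms(1)] dag_filtration [OF assms(1)] dag_filtration [OF assms(1)]])
  note M = mw_gensD [OF assms(1)]
  show "x \<in> ser (\<lambda>j. mpow V A M (L * Suc j))" "y \<in> ser (\<lambda>j. mpow V A M (L * Suc j))"
    using assms by (auto simp: dag_def)
  fix i j x y assume xy: "x \<in> mpow V A M (L * Suc i)" "y \<in> mpow V A M (L * Suc j)"
  have "L * Suc i + L * Suc j \<le> 2 * L * Suc (i + j)" by (simp add: algebra_simps)
  then show "x \<otimes>\<^bsub>A\<^esub> y \<in> mpow V A M (2 * L * Suc (i + j))"
    using mpow_mult [OF M(1) xy] mpow_mono [OF M(1,2)] by blast
qed

lemma dagger_directed: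
  assumes "x \<in> carrier D" "y \<in> carrier D"
  shows "\<exists>M L. mw_gens V A M \<and> x \<in> dag M L \<and> y \<in> dag M L"
  using assms dag_directed unfolding dagger_carrier_iff by (meson subsetD)

lemma hat_closed: "x \<in> carrier A \<Longrightarrow> hat_emb V p A x \<in> carrier D"
  unfolding dagger_carrier_iff
  using mw_gens_fine [of "{x}"] vspan_base [of x "{x}"] dag_hat by blast

text \<open>The degree bounds enter only through closure under the operations; the laws are
  inherited from \<open>A\<close> level by level.\<close>

theorem dagger_algebra: "algebra V D"
proof (rule algebraI)
  have add_closed: "x \<oplus>\<^bsub>D\<^esub> y \<in> carrier D" if "x \<in> carrier D" "y \<in> carrier D" for x y
    using dagger_directed [OF that] dag_hadd unfolding dagger_simps dagger_carrier_iff by blast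
  have mult_closed: "x \<otimes>\<^bsub>D\<^esub> y \<in> carrier D" if "x \<in> carrier D" "y \<in> carrier D" for x y
    using dagger_directed [OF that] dag_hmul unfolding dagger_simps dagger_carrier_iff by blast
  have sm_closed: "a \<odot>\<^bsub>D\<^esub> x \<in> carrier D" if "a \<in> carrier V" "x \<in> carrier D" for a x
    using that dag_hsmul unfolding dagger_simps dagger_carrier_iff by blast
  note simps = hat_emb_cl hadd_cl hmul_cl hsmul_cl
  show "cring V" by (rule R.is_cring)
  show "cring D"
  proof (rule cringI)
    show "abelian_group D"
    proof (rule abelian_groupI)
      fix x assume x: "x \<in> carrier D"
      then obtain s where s: "\<And>k. s k \<in> carrier A" "x = cl s" using dagger_cl by blast
      show "\<exists>y\<in>carrier D. y \<oplus>\<^bsub>D\<^esub> x = \<zero>\<^bsub>D\<^esub>"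
      proof (rule bexI [OF _ sm_closed [OF _ x, of "\<ominus>\<^bsub>V\<^esub> \<one>\<^bsub>V\<^esub>"]])
        show "\<ominus>\<^bsub>V\<^esub> \<one>\<^bsub>V\<^esub> \<odot>\<^bsub>D\<^esub> x \<oplus>\<^bsub>D\<^esub> x = \<zero>\<^bsub>D\<^esub>"
          using s by (simp add: simps smult_l_minus A.l_neg)
      qed simp
      show "\<zero>\<^bsub>D\<^esub> \<oplus>\<^bsub>D\<^esub> x = x" using s by (simp add: simps)
      fix y assume y: "y \<in> carrier D"
      then obtain t where t: "\<And>k. t k \<in> carrier A" "y = cl t" using dagger_cl by blast
      show "x \<oplus>\<^bsub>D\<^esub> y = y \<oplus>\<^bsub>D\<^esub> x" using s t by (simp add: simps A.a_comm)
      fix z assume z: "z \<in> carrier D"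
      then obtain u where u: "\<And>k. u k \<in> carrier A" "z = cl u" using dagger_cl by blast
      show "x \<oplus>\<^bsub>D\<^esub> y \<oplus>\<^bsub>D\<^esub> z = x \<oplus>\<^bsub>D\<^esub> (y \<oplus>\<^bsub>D\<^esub> z)" using s t u by (simp add: simps A.a_assoc)
    qed (use add_closed hat_closed in auto)
    show "comm_monoid D"
    proof (rule comm_monoidI)
      fix x assume x: "x \<in> carrier D"
      then obtain s where s: "\<And>k. s k \<in> carrier A" "x = cl s" using dagger_cl by blast
      show "\<one>\<^bsub>D\<^esub> \<otimes>\<^bsub>D\<^esub> x = x" using s by (simp add: simps)
      fix y assume y: "y \<in> carrier D"
      then obtain t where t: "\<And>k. t k \<in> carrier A" "y = cl t" using dagger_cl by blast
      show "x \<otimes>\<^bsub>D\<^esub> y = y \<otimes>\<^bsub>D\<^esub> x" using s t by (simp add: simps A.m_comm)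
      fix z assume z: "z \<in> carrier D"
      then obtain u where u: "\<And>k. u k \<in> carrier A" "z = cl u" using dagger_cl by blast
      show "x \<otimes>\<^bsub>D\<^esub> y \<otimes>\<^bsub>D\<^esub> z = x \<otimes>\<^bsub>D\<^esub> (y \<otimes>\<^bsub>D\<^esub> z)" using s t u by (simp add: simps A.m_assoc)
    qed (use mult_closed hat_closed in auto)
    fix x y z assume x: "x \<in> carrier D" and y: "y \<in> carrier D" and z: "z \<in> carrier D"
    obtain s where s: "\<And>k. s k \<in> carrier A" "x = cl s" using x using dagger_cl by blast
    obtain t where t: "\<And>k. t k \<in> carrier A" "y = cl t" using y using dagger_cl by blast
    obtain u where u: "\<And>k. u k \<in> carrier A" "z = cl u" using z using dagger_cl by blast
    show "(x \<oplus>\<^bsub>D\<^esub> y) \<otimes>\<^bsub>D\<^esub> z = x \<otimes>\<^bsub>D\<^esub> z \<oplus>\<^bsub>D\<^esub> y \<otimes>\<^bsub>D\<^esub> z"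
      using s t u by (simp add: simps A.l_distr)
  qed
  fix x assume x: "x \<in> carrier D"
  then obtain s where s: "\<And>k. s k \<in> carrier A" "x = cl s" using dagger_cl by blast
  show "\<one>\<^bsub>V\<^esub> \<odot>\<^bsub>D\<^esub> x = x" using s by (simp add: simps)
  fix a assume a: "a \<in> carrier V"
  show "a \<odot>\<^bsub>D\<^esub> x \<in> carrier D" using sm_closed a x .
  show "(a \<oplus>\<^bsub>V\<^esub> b) \<odot>\<^bsub>D\<^esub> x = a \<odot>\<^bsub>D\<^esub> x \<oplus>\<^bsub>D\<^esub> b \<odot>\<^bsub>D\<^esub> x" if "b \<in> carrier V" for b
    using s a that by (simp add: simps smult_l_distr)
  show "(a \<otimes>\<^bsub>V\<^esub> b) \<odot>\<^bsub>D\<^esub> x = a \<odot>\<^bsub>D\<^esub> (b \<odot>\<^bsub>D\<^esub> x)" if "b \<in> carrier V" for b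
    using s a that by (simp add: simps smult_assoc1)
  fix y assume y: "y \<in> carrier D"
  then obtain t where t: "\<And>k. t k \<in> carrier A" "y = cl t" using dagger_cl by blast
  show "a \<odot>\<^bsub>D\<^esub> (x \<oplus>\<^bsub>D\<^esub> y) = a \<odot>\<^bsub>D\<^esub> x \<oplus>\<^bsub>D\<^esub> a \<odot>\<^bsub>D\<^esub> y"
    using s t a by (simp add: simps smult_r_distr)
  show "(a \<odot>\<^bsub>D\<^esub> x) \<otimes>\<^bsub>D\<^esub> y = a \<odot>\<^bsub>D\<^esub> (x \<otimes>\<^bsub>D\<^esub> y)"
    using s t a by (simp add: simps smult_assoc2)
qed

theorem hat_ring_hom: "hat_emb V p A \<in> ring_hom A D"
  by (rule ring_hom_memI) (auto simp: hat_closed [unfolded hat_emb_cl] hat_emb_cl hadd_cl hmul_cl)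

theorem hat_linear: "linear_map V A D (hat_emb V p A)"
  unfolding linear_map_def by (auto simp: hat_closed [unfolded hat_emb_cl] hat_emb_cl hadd_cl hsmul_cl)

end

text \<open>The logarithm equals \<open>n d\<close> with \<open>d = log eps (1 / r) > 0\<close>, and
  \<open>K\<close> is an integer above \<open>1 / d\<close>. Thus the power of \<open>p\<close>
  attached to the \<open>n\<close>-th power of a submodule grows at least linearly in
  \<open>n\<close>.\<close>

lemma nat_ceiling_log_lower:
  fixes eps r :: real
  assumes "0 < eps" "eps < 1" "r > 1"
  shows "\<exists>K. \<forall>n. n \<le> K * nat \<lceil>log eps ((1 / r) ^ n)\<rceil>"
proof -
  define d where "d = log eps (1 / r)"
  have d: "d > 0" using assms by (simp add: d_def log_def ln_div divide_pos_neg)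
  have "n \<le> nat \<lceil>1 / d\<rceil> * nat \<lceil>log eps ((1 / r) ^ n)\<rceil>" for n
  proof -
    have h: "real n * d \<le> real (nat \<lceil>log eps ((1 / r) ^ n)\<rceil>)"
      using assms by (simp add: d_def log_nat_power) linarith
    have k: "1 / d \<le> real (nat \<lceil>1 / d\<rceil>)" by linarith
    have "1 / d * (real n * d) \<le> real (nat \<lceil>1 / d\<rceil>) * real (nat \<lceil>log eps ((1 / r) ^ n)\<rceil>)"
      by (rule mult_mono [OF k h of_nat_0_le_iff]) (use d in auto)
    then have "real n \<le> real (nat \<lceil>1 / d\<rceil> * nat \<lceil>log eps ((1 / r) ^ n)\<rceil>)" using d by simp
    then show ?thesis by (simp only: of_nat_le_iff)
  qed
  then show ?thesis by blast
qed

section \<open>Completeness of the overconvergent algebra and boundedness of the canonical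
  map\<close>

context palgebra
begin

interpretation Dg: palgebra V D p
  by (rule algebra_palgebra [OF dagger_algebra p_closed])

lemma ser_submodule:
  assumes "\<And>j. submodule (G j) V A" "ser G \<subseteq> carrier D"
  shows "submodule (ser G) V D"
proof (rule Dg.submoduleI')
  show "\<zero>\<^bsub>D\<^esub> \<in> ser G"
    using ser_hat [OF assms(1), of "\<zero>\<^bsub>A\<^esub>"] submodule_closed(2) [OF assms(1)] by simp
qed (use assms ser_hadd ser_hsmul in auto)

lemma dag_carrier: "mw_gens V A M \<Longrightarrow> dag M L \<subseteq> carrier D"
  using dagger_carrier_iff by blast

lemma dag_submodule: "mw_gens V A M \<Longrightarrow> submodule (dag M L) V D"
  using ser_submodule [of "\<lambda>j. mpow V A M (L * Suc j)"] dag_filtration dag_carrier [of M L]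
  by (simp add: dag_def)

theorem dagger_bornology: "alg_bornology V D (dagger_born V p A)"
  unfolding alg_bornology_def bornology_def
proof (intro conjI allI ballI impI)
  show "dagger_born V p A \<subseteq> Pow (carrier D)" by (auto simp: dagger_born_def dagger_def)
  show "F \<in> dagger_born V p A" if "finite F \<and> F \<subseteq> carrier D" for F
    using that [THEN conjunct1] that [THEN conjunct2]
  proof (induction F)
    case empty
    then show ?case unfolding dagger_born_iff using mw_gens_one by blast
  next
    case (insert x F)
    then obtain M L where F: "mw_gens V A M" "F \<subseteq> dag M L" unfolding dagger_born_iff by auto
    obtain N K where x: "mw_gens V A N" "x \<in> dag N K" using insert.prems dagger_carrier_iff by auto
    show ?case using dag_directed [OF F(1) x(1), of L K] F(2) x(2) unfolding dagger_born_iff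
      by (meson insert_subset subset_trans subsetD)
  qed
  show "T \<in> dagger_born V p A" if "S \<in> dagger_born V p A" "T \<subseteq> S" for S T
    using that unfolding dagger_born_iff by (meson subset_trans)
  show "vspan V D S \<in> dagger_born V p A" if "S \<in> dagger_born V p A" for S
  proof -
    obtain M L where "mw_gens V A M" "S \<subseteq> dag M L" using \<open>S \<in> _\<close> unfolding dagger_born_iff by blast
    then show ?thesis unfolding dagger_born_iff using Dg.vspan_min [OF dag_submodule] by blast
  qed
  fix S T assume "S \<in> dagger_born V p A" "T \<in> dagger_born V p A"
  then obtain M L N K where *: "mw_gens V A M" "S \<subseteq> dag M L" "mw_gens V A N" "T \<subseteq> dag N K"
    unfolding dagger_born_iff by blast
  obtain M' L' where M': "mw_gens V A M'" "dag M L \<subseteq> dag M' L'" "dag N K \<subseteq> dag M' L'"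
    using dag_directed [OF *(1,3)] by blast
  have ST: "S \<subseteq> dag M' L'" "T \<subseteq> dag M' L'" using * M' by blast+
  then show "S \<union> T \<in> dagger_born V p A" unfolding dagger_born_iff using M'(1) by blast
  have "{x \<otimes>\<^bsub>D\<^esub> y |x y. x \<in> S \<and> y \<in> T} \<subseteq> dag M' (2 * L')"
    using subsetD [OF ST(1)] subsetD [OF ST(2)] dag_hmul [OF M'(1)] by auto
  then show "{x \<otimes>\<^bsub>D\<^esub> y |x y. x \<in> S \<and> y \<in> T} \<in> dagger_born V p A"
    unfolding dagger_born_iff using M'(1) by blast
qed

text \<open>If consecutive differences are \<open>p^n\<close> times the series with coefficients
  \<open>w n\<close>, collecting equal powers of \<open>p\<close> gives a limit whose coefficient at
  place \<open>m\<close> is the sum of \<open>w i (m - i)\<close> over \<open>i \<le> m\<close>. For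
  increasing \<open>G\<close> it lies in \<open>G m\<close> again, so no degree is lost.\<close>

lemma ser_padic_complete:
  assumes G: "\<And>j. submodule (G j) V A" and mono: "\<And>i j. i \<le> j \<Longrightarrow> G i \<subseteq> G j"
    and sub: "ser G \<subseteq> carrier D"
  shows "padic_complete V p D (ser G)"
  unfolding padic_complete_def
proof (intro allI impI)
  note N = Dg.submodule_closed [OF ser_submodule [OF G sub]]
  fix x assume x: "(\<forall>n. x n \<in> ser G) \<and> (\<forall>n. x (Suc n) \<ominus>\<^bsub>D\<^esub> x n \<in> pmul V p D n (ser G))"
  then have "\<forall>n. \<exists>w. (\<forall>j. w j \<in> G j) \<and> x (Suc n) \<ominus>\<^bsub>D\<^esub> x n = Dg.pw n (cl (psum w))"
    unfolding Dg.pmul_iff by (fastforce simp: ser_def)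
  then obtain w where w: "\<And>n j. w n j \<in> G j"
    "\<And>n. x (Suc n) \<ominus>\<^bsub>D\<^esub> x n = Dg.pw n (cl (psum (w n)))" by metis
  have wc: "w n j \<in> carrier A" for n j using submodule_closed(6) [OF G w(1)] .
  have xc: "x n \<in> carrier D" for n using x sub by blast
  \<comment> \<open>\<open>v n\<close> is the series of the remainder from step \<open>n\<close> on,
    divided by \<open>p^n\<close>. All \<open>n\<close> are needed, because the remainder must be
    \<open>p^n\<close> times an element of \<open>ser G\<close> itself.\<close>
  define v where "v n m = rsum (\<lambda>i. w (n + i) (m - i)) (Suc m)" for n m
  have v: "v n m \<in> G m" for n m
    unfolding v_def using w(1) mono by (intro rsum_in_submodule [OF G]) (meson diff_le_self subsetD)
  have vc: "v n m \<in> carrier A" for n m using submodule_closed(6) [OF G v] .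
  define d where "d n = cl (psum (w n))" for n
  define e where "e n = cl (psum (v n))" for n
  have e: "e n \<in> ser G" and d: "d n \<in> ser G" for n unfolding e_def d_def using w v by (auto intro: serI)
  have c: "e n \<in> carrier D" "d n \<in> carrier D" for n using e d sub by auto
  have e_Suc: "e n = d n \<oplus>\<^bsub>D\<^esub> p \<odot>\<^bsub>D\<^esub> e (Suc n)" for n
  proof -
    have "v n m = w n m \<oplus>\<^bsub>A\<^esub> case_nat \<zero>\<^bsub>A\<^esub> (v (Suc n)) m" for m
      unfolding v_def using rsum_shift [of "\<lambda>i. w (n + i) (m - i)" m] wc
      by (cases m) (auto simp del: rsum.simps(2))
    then have "v n = (\<lambda>m. w n m \<oplus>\<^bsub>A\<^esub> case_nat \<zero>\<^bsub>A\<^esub> (v (Suc n)) m)" by auto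
    moreover have "case_nat \<zero>\<^bsub>A\<^esub> (v (Suc n)) m \<in> carrier A" for m using vc by (auto split: nat.split)
    ultimately show ?thesis
      unfolding e_def d_def using wc vc
      by (simp add: hsmul_p_cl hadd_cl psum_add cl_def [of "\<lambda>k. psum _ k \<oplus>\<^bsub>A\<^esub> _ k"]) (simp add: cl_def psum_add)
  qed
  have x_Suc: "x (Suc n) = x n \<oplus>\<^bsub>D\<^esub> Dg.pw n (d n)" for n
  proof -
    have "x (Suc n) = x n \<oplus>\<^bsub>D\<^esub> (x (Suc n) \<ominus>\<^bsub>D\<^esub> x n)"
      using xc [of n] xc [of "Suc n"] Dg.A.a_lcomm [of "x n" "x (Suc n)" "\<ominus>\<^bsub>D\<^esub> x n"]
      by (simp add: Dg.A.minus_eq Dg.A.r_neg del: dagger_simps)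
    then show ?thesis unfolding w(2) d_def .
  qed
  \<comment> \<open>Telescoping \<open>e_Suc\<close> gives the remainder as an exact identity, so
    the convergence estimate is read off from it.\<close>
  have y: "x 0 \<oplus>\<^bsub>D\<^esub> e 0 = x n \<oplus>\<^bsub>D\<^esub> Dg.pw n (e n)" for n
  proof (induction n)
    case 0
    then show ?case using c by (simp del: dagger_simps)
  next
    case (Suc n)
    have "Dg.pw n (e n) = Dg.pw n (d n) \<oplus>\<^bsub>D\<^esub> Dg.pw (Suc n) (e (Suc n))"
      using c by (subst e_Suc) (simp add: Dg.smult_r_distr Dg.smult_assoc1 del: dagger_simps)
    then show ?case
      unfolding Suc x_Suc [of n] using c xc by (simp add: Dg.A.a_assoc del: dagger_simps R.nat_pow_Suc)
  qed
  show "\<exists>y\<in>ser G. \<forall>n. y \<ominus>\<^bsub>D\<^esub> x n \<in> pmul V p D n (ser G)"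
  proof (intro bexI allI)
    show "x 0 \<oplus>\<^bsub>D\<^esub> e 0 \<in> ser G" using N(3) x e by blast
    fix n
    have "(x 0 \<oplus>\<^bsub>D\<^esub> e 0) \<ominus>\<^bsub>D\<^esub> x n = Dg.pw n (e n)"
      unfolding y [of n] using c xc
      by (simp add: Dg.A.minus_eq Dg.A.a_ac Dg.A.r_neg1 Dg.A.r_neg2 del: dagger_simps)
    then show "(x 0 \<oplus>\<^bsub>D\<^esub> e 0) \<ominus>\<^bsub>D\<^esub> x n \<in> pmul V p D n (ser G)"
      unfolding Dg.pmul_iff using e by blast
  qed
qed

theorem dagger_complete: "complete_born V p D (dagger_born V p A)"
  unfolding complete_born_def
proof (intro conjI ballI impI)
  fix S assume "S \<in> dagger_born V p A"
  then obtain M L where *: "mw_gens V A M" "S \<subseteq> dag M L" unfolding dagger_born_iff by blast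
  note M = mw_gensD [OF *(1)]
  have "padic_complete V p D (dag M L)"
    unfolding dag_def
  proof (rule ser_padic_complete)
    show "ser (\<lambda>j. mpow V A M (L * Suc j)) \<subseteq> carrier D"
      using dag_carrier [OF *(1)] by (simp add: dag_def)
    fix i j :: nat assume "i \<le> j"
    then show "mpow V A M (L * Suc i) \<subseteq> mpow V A M (L * Suc j)"
      by (intro mpow_mono [OF M(1,2)] mult_le_mono2) simp
  qed (rule dag_filtration [OF *(1)])
  then show "\<exists>N\<in>dagger_born V p A. submodule N V D \<and> S \<subseteq> N \<and> padic_complete V p D N"
    using * dag_submodule [OF *(1)] dagger_born_iff by blast
next
  fix N assume N: "N \<in> dagger_born V p A" "submodule N V D"
  have "z = \<zero>\<^bsub>D\<^esub>" if z: "\<And>j. z \<in> pmul V p D j N" for z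
  proof -
    have "z \<in> carrier D"
      using z [of 0] Dg.pmul_subset [OF N(2)] Dg.submodule_closed(1) [OF N(2)] by blast
    then obtain s where s: "\<And>k. s k \<in> carrier A" "z = cl s" using dagger_cl by blast
    \<comment> \<open>Level \<open>j\<close> of a multiple of \<open>p^j\<close> is the zero
      coset.\<close>
    have "cong j (s j) \<zero>\<^bsub>A\<^esub>" for j
    proof -
      obtain y where y: "y \<in> N" "z = Dg.pw j y" using z [of j] unfolding Dg.pmul_iff by blast
      then have "y \<in> carrier D" using Dg.submodule_closed(1) [OF N(2)] by blast
      then obtain t where t: "\<And>k. t k \<in> carrier A" "y = cl t" using dagger_cl by blast
      have "cl s = cl (\<lambda>k. pw j (t k))" using y t s by (simp add: hsmul_cl)
      then have "cong j (s j) (pw j (t j))" by (rule cl_eqD) (use s t in auto)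
      moreover have "cong j (pw j (t j)) \<zero>\<^bsub>A\<^esub>" using t by (intro congI [of _ _ _ "t j"]) auto
      ultimately show ?thesis using cong_trans s t by (meson A.zero_closed ppow_closed smult_closed)
    qed
    then have "cl s = cl (\<lambda>_. \<zero>\<^bsub>A\<^esub>)" by (intro cl_eqI) (use s in auto)
    then show ?thesis using s by (simp add: hat_emb_cl)
  qed
  moreover have "\<zero>\<^bsub>D\<^esub> \<in> pmul V p D j N" for j
    using Dg.submodule_closed(2) [OF Dg.pmul_submodule [OF N(2)]] .
  ultimately show "padic_separated V p D N" unfolding padic_separated_def by blast
qed

lemma hat_preimage_submodule:
  assumes "submodule N V D"
  shows "submodule {x \<in> carrier A. hat_emb V p A x \<in> N} V A"
proof (rule submoduleI')
  note N = Dg.submodule_closed [OF assms]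
  note lin = hat_linear [unfolded linear_map_def]
  show "\<zero>\<^bsub>A\<^esub> \<in> {x \<in> carrier A. hat_emb V p A x \<in> N}" using N(2) by simp
  show "x \<oplus>\<^bsub>A\<^esub> y \<in> {x \<in> carrier A. hat_emb V p A x \<in> N}"
    if "x \<in> {x \<in> carrier A. hat_emb V p A x \<in> N}" "y \<in> {x \<in> carrier A. hat_emb V p A x \<in> N}" for x y
    using that N(3) lin by (simp del: dagger_simps)
  show "a \<odot>\<^bsub>A\<^esub> x \<in> {x \<in> carrier A. hat_emb V p A x \<in> N}"
    if "a \<in> carrier V" "x \<in> {x \<in> carrier A. hat_emb V p A x \<in> N}" for a x
    using that N(4) lin by (simp del: dagger_simps)
qed auto

lemma ser_mpow_carrier:
  assumes "mw_gens V A M"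
  shows "ser (\<lambda>j. mpow V A M (L * (j + n))) \<subseteq> carrier D"
proof -
  have "ser (\<lambda>j. mpow V A M (L * (j + n))) \<subseteq> dag M (L * Suc n)"
    unfolding dag_def
  proof (rule ser_mono)
    fix j
    have "L * (j + n) \<le> L * Suc n * Suc j" by (simp add: algebra_simps)
    then show "mpow V A M (L * (j + n)) \<subseteq> mpow V A M (L * Suc n * Suc j)"
      by (rule mpow_mono [OF mw_gensD(1,2) [OF assms]])
  qed
  then show ?thesis using dag_carrier [OF assms] by blast
qed

text \<open>A product of \<open>n\<close> series with bound \<open>L (j + 1)\<close> has bound
  \<open>L (j + n)\<close>: the excess is added. Iterating \<open>dag_hmul\<close> would instead
  double the constant at each factor and destroy linearity in \<open>n\<close>.\<close>

lemma hat_mpow: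
  assumes "mw_gens V A M" "M0 \<subseteq> carrier A" "hat_emb V p A ` M0 \<subseteq> dag M L" "x \<in> mpow V A M0 n"
  shows "hat_emb V p A x \<in> ser (\<lambda>j. mpow V A M (L * (j + n)))"
  using assms(4)
proof (induction n arbitrary: x)
  note M = mw_gensD [OF assms(1)] and filt = dag_filtration [OF assms(1)]
  have sub: "submodule (ser (\<lambda>j. mpow V A M (L * (j + n)))) V D" for n
    by (rule ser_submodule [OF filt ser_mpow_carrier [OF assms(1)]])
  {
    case 0
    have "\<one>\<^bsub>A\<^esub> \<in> mpow V A M (L * (0 + 0))" using one_mpow_0 by simp
    then have "hat_emb V p A \<one>\<^bsub>A\<^esub> \<in> ser (\<lambda>j. mpow V A M (L * (j + 0)))"
      by (rule ser_hat [OF filt])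
    then show ?case
      using 0 vspan_min [OF hat_preimage_submodule [OF sub [of 0]], of "{\<one>\<^bsub>A\<^esub>}"] by auto
  next
    case (Suc n)
    have "mpow V A M0 (Suc n) \<subseteq> {x \<in> carrier A. hat_emb V p A x \<in> ser (\<lambda>j. mpow V A M (L * (j + Suc n)))}"
    proof (rule mpow_Suc_min [OF hat_preimage_submodule [OF sub]])
      fix x y assume xy: "x \<in> mpow V A M0 n" "y \<in> M0"
      then have c: "x \<in> carrier A" "y \<in> carrier A" using mpow_closed(6) [OF assms(2)] assms(2) by blast+
      have "hmul V p A (hat_emb V p A x) (hat_emb V p A y) \<in> ser (\<lambda>j. mpow V A M (L * (j + Suc n)))"
      proof (rule ser_hmul [OF filt filt filt _ Suc.IH [OF xy(1)]])
        show "hat_emb V p A y \<in> ser (\<lambda>j. mpow V A M (L * Suc j))"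
          using assms(3) xy(2) by (auto simp: dag_def)
        fix i j x y assume "x \<in> mpow V A M (L * (i + n))" "y \<in> mpow V A M (L * Suc j)"
        from mpow_mult [OF M(1) this] show "x \<otimes>\<^bsub>A\<^esub> y \<in> mpow V A M (L * (i + j + Suc n))"
          by (simp add: algebra_simps)
      qed
      moreover have "hat_emb V p A (x \<otimes>\<^bsub>A\<^esub> y) = hmul V p A (hat_emb V p A x) (hat_emb V p A y)"
        using ring_hom_mult [OF hat_ring_hom c] by simp
      ultimately show "x \<otimes>\<^bsub>A\<^esub> y \<in> {x \<in> carrier A. hat_emb V p A x \<in> ser (\<lambda>j. mpow V A M (L * (j + Suc n)))}"
        using c by simp
    qed
    then show ?case using Suc.prems by blast
  }
qed

lemma ser_shift_pow:
  assumes G: "\<And>j. submodule (G j) V A" and sub: "ser G \<subseteq> carrier D" and z: "z \<in> ser G"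
  shows "Dg.pw h z \<in> ser (\<lambda>j. if j < h then {\<zero>\<^bsub>A\<^esub>} else G (j - h))"
proof (induction h)
  have z0: "submodule {\<zero>\<^bsub>A\<^esub>} V A" using vspan_submodule [of "{}"] by (simp add: vspan_empty)
  {
    case 0
    then show ?case using z sub by (auto simp del: dagger_simps)
  next
    case (Suc h)
    have "Dg.pw (Suc h) z = p \<odot>\<^bsub>D\<^esub> Dg.pw h z"
      using z sub Dg.pw_pw [of z 1 h] by (auto simp del: dagger_simps)
    moreover have "p \<odot>\<^bsub>D\<^esub> Dg.pw h z \<in> ser (\<lambda>j. if j < Suc h then {\<zero>\<^bsub>A\<^esub>} else G (j - Suc h))"
      unfolding dagger_simps
      by (rule ser_shift [OF _ Suc [unfolded dagger_simps]]) (use G z0 in auto)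
    ultimately show ?case by simp
  }
qed

text \<open>With \<open>h\<close> factors \<open>p\<close> attached to the \<open>n\<close>-th
  power, the coefficients move up \<open>h\<close> places, and \<open>n \<le> K h\<close>. At place
  \<open>j \<ge> h\<close> the degree is at most \<open>L (j - h + n)\<close>, hence at most
  \<open>L (K + 1) (j + 1)\<close>. The bound does not involve \<open>n\<close>, so one bounded set
  contains all the powers.\<close>

theorem hat_rho:
  assumes "0 < eps" "eps < 1" "r > 1" "M0 \<subseteq> carrier A" "hat_emb V p A ` M0 \<in> dagger_born V p A"
  shows "lg_set V p eps A M0 r \<subseteq> carrier A" "hat_emb V p A ` lg_set V p eps A M0 r \<in> dagger_born V p A"
proof -
  obtain M L where M0: "mw_gens V A M" "hat_emb V p A ` M0 \<subseteq> dag M L"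
    using assms(5) unfolding dagger_born_iff by blast
  note M = mw_gensD [OF M0(1)] and filt = dag_filtration [OF M0(1)]
  define h where "h n = nat \<lceil>log eps ((1 / r) ^ n)\<rceil>" for n
  obtain K where K: "\<And>n. n \<le> K * h n" using nat_ceiling_log_lower [OF assms(1-3)] unfolding h_def by blast
  define T where "T = {x \<in> carrier A. hat_emb V p A x \<in> dag M (L * Suc K)}"
  have T: "submodule T V A" unfolding T_def by (rule hat_preimage_submodule [OF dag_submodule [OF M0(1)]])
  have "pmul V p A (h n) (mpow V A M0 n) \<subseteq> T" for n
  proof
    fix x assume "x \<in> pmul V p A (h n) (mpow V A M0 n)"
    then obtain y where y: "y \<in> mpow V A M0 n" "x = pw (h n) y" unfolding pmul_iff by blast
    let ?G = "\<lambda>j. mpow V A M (L * (j + n))"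
    have sub: "ser ?G \<subseteq> carrier D" by (rule ser_mpow_carrier [OF M0(1)])
    have "Dg.pw (h n) (hat_emb V p A y) \<in> ser (\<lambda>j. if j < h n then {\<zero>\<^bsub>A\<^esub>} else ?G (j - h n))"
      by (rule ser_shift_pow [OF filt sub hat_mpow [OF M0(1) assms(4) M0(2) y(1)]])
    also have "\<dots> \<subseteq> dag M (L * Suc K)"
      unfolding dag_def
    proof (rule ser_mono)
      fix j
      have "mpow V A M (L * (j - h n + n)) \<subseteq> mpow V A M (L * Suc K * Suc j)" if "\<not> j < h n"
      proof (rule mpow_mono [OF M(1,2)])
        have "n \<le> K * j" using K [of n] that by (meson le_trans mult_le_mono2 not_less)
        then have "j - h n + n \<le> Suc K * Suc j" by simp
        then show "L * (j - h n + n) \<le> L * Suc K * Suc j" by (simp only: mult.assoc mult_le_mono2)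
      qed
      then show "(if j < h n then {\<zero>\<^bsub>A\<^esub>} else ?G (j - h n)) \<subseteq> mpow V A M (L * Suc K * Suc j)"
        using submodule_closed(2) [OF filt] by auto
    qed
    finally show "x \<in> T"
      using hat_linear mpow_closed(6) [OF assms(4) y(1)] unfolding T_def y(2) linear_map_def by simp
  qed
  then have lg: "lg_set V p eps A M0 r \<subseteq> T"
    unfolding lg_set_def fsums_def h_def [symmetric]
    by (intro Inter_lower CollectI conjI UN_least ballI submodule_closed(2,3) [OF T])
  then show "lg_set V p eps A M0 r \<subseteq> carrier A" using submodule_closed(1) [OF T] by blast
  show "hat_emb V p A ` lg_set V p eps A M0 r \<in> dagger_born V p A"
    unfolding dagger_born_iff using lg M0(1) by (auto simp: T_def)
qed

text \<open>The sets with bounded image form an algebra bornology that has linear growth and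
  contains the fine one; the linear growth bornology is the smallest such.\<close>

theorem hat_bounded:
  assumes "0 < eps" "eps < 1"
  shows "bounded_map (lg_bornology V p eps A (fine_bornology V A)) (dagger_born V p A) (hat_emb V p A)"
proof -
  define B where "B = {S. S \<subseteq> carrier A \<and> hat_emb V p A ` S \<in> dagger_born V p A}"
  note ab = dagger_bornology [unfolded alg_bornology_def]
  note DB = Dg.bornologyD [OF ab [THEN conjunct1]]
  have B_iff: "S \<in> B \<longleftrightarrow> S \<subseteq> carrier A \<and> (\<exists>M L. mw_gens V A M \<and> hat_emb V p A ` S \<subseteq> dag M L)" for S
    by (simp add: B_def dagger_born_iff)
  have "alg_bornology V A B"
    unfolding alg_bornology_def bornology_def
  proof (intro conjI allI ballI impI)
    show "B \<subseteq> Pow (carrier A)" by (auto simp: B_def)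
    show "F \<in> B" if "finite F \<and> F \<subseteq> carrier A" for F
      using that DB(2) [of "hat_emb V p A ` F"] hat_closed by (auto simp: B_def)
    show "T \<in> B" if "S \<in> B" "T \<subseteq> S" for S T
      using that DB(3) [of "hat_emb V p A ` S" "hat_emb V p A ` T"] by (auto simp: B_def)
    show "S \<union> T \<in> B" if "S \<in> B" "T \<in> B" for S T
      using that DB(4) by (auto simp: B_def image_Un)
    show "vspan V A S \<in> B" if S: "S \<in> B" for S
    proof -
      obtain M L where M: "mw_gens V A M" "hat_emb V p A ` S \<subseteq> dag M L" "S \<subseteq> carrier A"
        using S unfolding B_iff by blast
      then have "vspan V A S \<subseteq> {x \<in> carrier A. hat_emb V p A x \<in> dag M L}"
        by (intro vspan_min hat_preimage_submodule dag_submodule) auto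
      then show ?thesis unfolding B_iff using M(1) by blast
    qed
    fix S T assume ST: "S \<in> B" "T \<in> B"
    have sub: "S \<subseteq> carrier A" "T \<subseteq> carrier A" using ST by (auto simp: B_def)
    have "hat_emb V p A ` {x \<otimes>\<^bsub>A\<^esub> y |x y. x \<in> S \<and> y \<in> T}
        \<subseteq> {x \<otimes>\<^bsub>D\<^esub> y |x y. x \<in> hat_emb V p A ` S \<and> y \<in> hat_emb V p A ` T}"
    proof
      fix z assume "z \<in> hat_emb V p A ` {x \<otimes>\<^bsub>A\<^esub> y |x y. x \<in> S \<and> y \<in> T}"
      then obtain x y where xy: "x \<in> S" "y \<in> T" "z = hat_emb V p A (x \<otimes>\<^bsub>A\<^esub> y)" by blast
      then have "z = hat_emb V p A x \<otimes>\<^bsub>D\<^esub> hat_emb V p A y"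
        using ring_hom_mult [OF hat_ring_hom subsetD [OF sub(1)] subsetD [OF sub(2)]] by simp
      then show "z \<in> {x \<otimes>\<^bsub>D\<^esub> y |x y. x \<in> hat_emb V p A ` S \<and> y \<in> hat_emb V p A ` T}"
        using xy by blast
    qed
    moreover have "{x \<otimes>\<^bsub>D\<^esub> y |x y. x \<in> hat_emb V p A ` S \<and> y \<in> hat_emb V p A ` T} \<in> dagger_born V p A"
      using ab [THEN conjunct2, rule_format] ST [unfolded B_def] by blast
    ultimately have "hat_emb V p A ` {x \<otimes>\<^bsub>A\<^esub> y |x y. x \<in> S \<and> y \<in> T} \<in> dagger_born V p A"
      using DB(3) by blast
    then show "{x \<otimes>\<^bsub>A\<^esub> y |x y. x \<in> S \<and> y \<in> T} \<in> B" using sub by (auto simp: B_def)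
  qed
  moreover have "fine_bornology V A \<subseteq> B"
  proof
    fix S assume "S \<in> fine_bornology V A"
    then obtain F where F: "S \<subseteq> carrier A" "finite F" "F \<subseteq> carrier A" "S \<subseteq> vspan V A F"
      unfolding fine_bornology_def by blast
    obtain M where "mw_gens V A M" "vspan V A F \<subseteq> M" using mw_gens_fine [OF F(2,3)] by blast
    then show "S \<in> B" unfolding B_iff using F dag_hat by (metis image_subsetI subsetD)
  qed
  moreover have "\<forall>M\<in>B. submodule M V A \<longrightarrow> rho_le1 V p eps A B M"
    unfolding rho_le1_def using hat_rho [OF assms] by (simp add: B_def)
  ultimately have "lg_bornology V p eps A (fine_bornology V A) \<subseteq> B"
    unfolding lg_bornology_def by blast
  then show ?thesis unfolding bounded_map_def B_def by blast
qed

end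

section \<open>The universal property\<close>

context palgebra
begin

abbreviation lg :: "real \<Rightarrow> 'r set set" where
  "lg eps \<equiv> lg_bornology V p eps A (fine_bornology V A)"

lemma lg_fine: "S \<in> fine_bornology V A \<Longrightarrow> S \<in> lg eps"
  unfolding lg_bornology_def by blast

lemma lg_vspan: "S \<in> lg eps \<Longrightarrow> vspan V A S \<in> lg eps"
  unfolding lg_bornology_def alg_bornology_def using bornologyD(5) by blast

lemma lg_mult: "S \<in> lg eps \<Longrightarrow> T \<in> lg eps \<Longrightarrow> {x \<otimes>\<^bsub>A\<^esub> y |x y. x \<in> S \<and> y \<in> T} \<in> lg eps"
  unfolding lg_bornology_def alg_bornology_def by (intro InterI) (drule InterD, assumption, force)

lemma lg_rho: "M \<in> lg eps \<Longrightarrow> submodule M V A \<Longrightarrow> r > 1 \<Longrightarrow> lg_set V p eps A M r \<in> lg eps"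
  unfolding lg_bornology_def rho_le1_def by blast

lemma lg_mpow:
  assumes "mw_gens V A M"
  shows "mpow V A M n \<in> lg eps"
proof (induction n)
  have "M \<in> lg eps"
  proof (rule lg_fine)
    show "M \<in> fine_bornology V A"
      using assms mw_gensD(1) [OF assms] unfolding fine_bornology_def mw_gens_def by blast
  qed
  {
    case 0
    have "{\<one>\<^bsub>A\<^esub>} \<in> fine_bornology V A"
      unfolding fine_bornology_def by (intro CollectI conjI exI [of _ "{\<one>\<^bsub>A\<^esub>}"]) (auto simp: vspan_base)
    then show ?case using lg_fine lg_vspan by simp
  next
    case (Suc n)
    then show ?case using lg_mult [OF Suc \<open>M \<in> lg eps\<close>] lg_vspan by simp
  }
qed

text \<open>The radius is \<open>eps\<close> to the power \<open>-1/(2L)\<close>, chosen so that the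
  logarithm is \<open>j / 2\<close>. Its ceiling \<open>j - j div 2\<close> leaves precisely
  \<open>j div 2\<close> factors \<open>p\<close> over.\<close>

lemma exists_growth_radius:
  fixes eps :: real
  assumes "0 < eps" "eps < 1" "L > 0"
  shows "\<exists>r>1. \<forall>j. nat \<lceil>log eps ((1 / r) ^ (L * j))\<rceil> = j - j div 2"
proof (intro exI [of _ "eps powr (- (1 / (2 * real L)))"] conjI allI)
  let ?r = "eps powr (- (1 / (2 * real L)))"
  have r: "?r > 0" using assms by simp
  show "1 < ?r" using assms by (simp add: powr_def mult_neg_neg divide_neg_pos)
  fix j
  have "log eps ((1 / ?r) ^ (L * j)) = real (L * j) * log eps (1 / ?r)"
    using r by (subst log_nat_power) auto
  also have "log eps (1 / ?r) = 1 / (2 * real L)"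
    using assms r by (simp add: log_divide log_powr)
  finally have "log eps ((1 / ?r) ^ (L * j)) = real j / 2" using assms(3) by simp
  moreover have "nat \<lceil>real j / 2\<rceil> = j - j div 2" 
  proof (cases "even j")
    case False
    then obtain k where k: "j = 2 * k + 1" by (rule oddE)
    have "\<lceil>real (2 * k + 1) / 2\<rceil> = int (k + 1)" by (rule ceiling_unique) auto
    then show ?thesis unfolding k by simp
  qed (auto elim!: evenE)
  ultimately show "nat \<lceil>log eps ((1 / ?r) ^ (L * j))\<rceil> = j - j div 2" by (simp only:)
qed

lemma lg_set_carrier:
  assumes "M \<subseteq> carrier A"
  shows "lg_set V p eps A M r \<subseteq> carrier A"
proof -
  have "pmul V p A k (mpow V A M n) \<subseteq> carrier A" for k n
    using mpow_closed(6) [OF assms] by (auto simp: pmul_def)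
  then show ?thesis unfolding lg_set_def fsums_def by (intro Inter_lower) auto
qed

text \<open>Half of the factor \<open>p\<^sup>j\<close> pays for the linear growth of the degree; the other half
  makes the series converge.\<close>
lemma lg_bound:
  assumes "0 < eps" "eps < 1" "mw_gens V A M"
  shows "\<exists>B\<in>lg eps. submodule B V A \<and> (\<forall>j. \<forall>x\<in>mpow V A M (L * Suc j). pw j x \<in> pmul V p A (j div 2) B)"
proof -
  note M = mw_gensD [OF assms(3)] and Mc = mpow_closed(6) [OF mw_gensD(1) [OF assms(3)]]
  \<comment> \<open>\<open>Suc L\<close> is positive even for \<open>L = 0\<close>, and
    \<open>L (j + 1)\<close> is at most \<open>(L + 1) + (L + 1) j\<close>, a constant degree plus a
    multiple of \<open>j\<close>.\<close>
  obtain r where r: "r > 1" "\<And>j. nat \<lceil>log eps ((1 / r) ^ (Suc L * j))\<rceil> = j - j div 2"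
    using exists_growth_radius [OF assms(1,2), of "Suc L"] by blast
  define U where "U = lg_set V p eps A M r"
  have Uc: "U \<subseteq> carrier A" unfolding U_def by (rule lg_set_carrier [OF M(1)])
  have "M \<in> lg eps"
    using assms(3) M(1) unfolding mw_gens_def by (intro lg_fine) (auto simp: fine_bornology_def)
  then have U: "U \<in> lg eps" unfolding U_def using lg_rho M(3) r(1) by blast
  \<comment> \<open>\<open>U\<close> takes up the part of degree \<open>(L + 1) j\<close> together
    with \<open>j - j div 2\<close> factors \<open>p\<close>; the constant part is multiplied on
    afterwards, which preserves boundedness.\<close>
  let ?S = "{x \<otimes>\<^bsub>A\<^esub> y |x y. x \<in> mpow V A M (Suc L) \<and> y \<in> U}"
  define B where "B = vspan V A ?S"
  have Sc: "?S \<subseteq> carrier A" using Mc Uc by blast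
  have B: "B \<in> lg eps" unfolding B_def by (rule lg_vspan [OF lg_mult [OF lg_mpow [OF assms(3)] U]])
  have Bs: "submodule B V A" unfolding B_def by (rule vspan_submodule [OF Sc])
  have "pw j x \<in> pmul V p A (j div 2) B" if "x \<in> mpow V A M (L * Suc j)" for j x
  proof -
    let ?N = "{x \<in> carrier A. pw j x \<in> pmul V p A (j div 2) B}"
    note PB = submodule_closed [OF pmul_submodule [OF Bs]]
    have N: "submodule ?N V A"
    proof (rule submoduleI')
      show "\<zero>\<^bsub>A\<^esub> \<in> ?N" using PB(2) by simp
    qed (use PB(3,4) in \<open>auto simp: smult_r_distr smult_commute [OF ppow_closed]\<close>)
    have "mpow V A M (Suc L + Suc L * j) \<subseteq> ?N"
    proof (rule mpow_add_min [OF N M(1)])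
      fix x y assume xy: "x \<in> mpow V A M (Suc L)" "y \<in> mpow V A M (Suc L * j)"
      have c: "x \<in> carrier A" "y \<in> carrier A" using Mc [OF xy(1)] Mc [OF xy(2)] .
      have "pw (j - j div 2) y \<in> (\<Union>n. pmul V p A (nat \<lceil>log eps ((1 / r) ^ n)\<rceil>) (mpow V A M n))"
        using xy(2) r(2) [of j] unfolding pmul_iff by (intro UN_I [of "Suc L * j"]) (auto simp: pmul_iff)
      then have "pw (j - j div 2) y \<in> U" unfolding U_def lg_set_def fsums_def by blast
      then have "x \<otimes>\<^bsub>A\<^esub> pw (j - j div 2) y \<in> B"
        unfolding B_def using xy(1) by (intro vspan_base) blast
      moreover have "pw j (x \<otimes>\<^bsub>A\<^esub> y) = pw (j div 2) (x \<otimes>\<^bsub>A\<^esub> pw (j - j div 2) y)"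
        using c by (simp add: smult_assoc3 pw_pw)
      ultimately show "x \<otimes>\<^bsub>A\<^esub> y \<in> ?N" using c unfolding pmul_iff by auto
    qed
    moreover have "mpow V A M (L * Suc j) \<subseteq> mpow V A M (Suc L + Suc L * j)"
      by (rule mpow_mono [OF M(1,2)]) simp
    ultimately show ?thesis using that by blast
  qed
  then show ?thesis using B Bs by blast
qed

text \<open>One list contains the unit, generators of \<open>M\<close> and algebra generators.
  Degrees in \<open>M\<close> are then also degrees in the larger span, whose powers exhaust
  \<open>A\<close>, so monomial reduction applies to series given by any \<open>M\<close>.\<close>

lemma fin_gen_presentation:
  assumes "complete_dvr V p" "fin_gen_algebra V A" "mw_gens V A M"
  shows "\<exists>a m. generated_palgebra V A p a m \<and> M \<subseteq> vspan V A (a ` {..m}) \<and> mw_gens V A (vspan V A (a ` {..m}))"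
proof -
  obtain F where F: "finite F" "F \<subseteq> carrier A" "M = vspan V A F" using assms(3) by (auto simp: mw_gens_def)
  obtain S where S: "finite S" "S \<subseteq> carrier A"
    "generate_ring A (S \<union> {a \<odot>\<^bsub>A\<^esub> \<one>\<^bsub>A\<^esub> |a. a \<in> carrier V}) = carrier A"
    using assms(2) by (auto simp: fin_gen_algebra_def)
  obtain xs where xs: "set xs = F \<union> S" using finite_list F(1) S(1) by blast
  \<comment> \<open>The unit comes first and is also the default value beyond the list, so that
    every \<open>a i\<close> lies in the carrier.\<close>
  define a where "a i = (if i \<le> length xs then (\<one>\<^bsub>A\<^esub> # xs) ! i else \<one>\<^bsub>A\<^esub>)" for i
  define m where "m = length xs"
  have im: "a ` {..m} = insert \<one>\<^bsub>A\<^esub> (F \<union> S)"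
  proof -
    have "a ` {..m} = (!) (\<one>\<^bsub>A\<^esub> # xs) ` {0..<length (\<one>\<^bsub>A\<^esub> # xs)}"
      by (rule image_cong) (auto simp: a_def m_def)
    also have "\<dots> = set (map ((!) (\<one>\<^bsub>A\<^esub> # xs)) [0..<length (\<one>\<^bsub>A\<^esub> # xs)])"
      by (simp only: set_map set_upt)
    also have "\<dots> = insert \<one>\<^bsub>A\<^esub> (F \<union> S)" by (simp only: map_nth list.set xs)
    finally show ?thesis .
  qed
  have a: "a i \<in> carrier A" for i
  proof (cases "i \<le> m")
    case True
    then have "a i \<in> a ` {..m}" by simp
    then show ?thesis unfolding im using F(2) S(2) by auto
  qed (simp add: a_def m_def)
  define G where "G = vspan V A (a ` {..m})"
  have imc: "a ` {..m} \<subseteq> carrier A" using a by blast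
  have G: "mw_gens V A G" unfolding mw_gens_def G_def
    by (intro conjI exI [of _ "a ` {..m}"]) (use F(1,2) S(1,2) in \<open>auto simp: im intro!: vspan_base\<close>)
  note Gg = mw_gensD [OF G]
  note sub = mpow_submodule [OF Gg(1)]
  have "\<exists>n. x \<in> mpow V A G n" if "x \<in> carrier A" for x
    using that unfolding S(3) [symmetric]
  proof induction
    case one
    then show ?case using one_mpow_0 by blast
  next
    case (incl h)
    then show ?case
    proof
      assume "h \<in> S"
      then have "h \<in> G" unfolding G_def im by (intro vspan_base) simp
      then show ?thesis using subset_mpow_1 [OF Gg(1)] by blast
    next
      assume "h \<in> {a \<odot>\<^bsub>A\<^esub> \<one>\<^bsub>A\<^esub> |a. a \<in> carrier V}"
      then show ?thesis using submodule_closed(4) [OF sub _ one_mpow_0] by blast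
    qed
  next
    case (a_inv h)
    then show ?case using submoduleE(3) [OF sub] by blast
  next
    case (eng_add x y)
    then obtain k l where "x \<in> mpow V A G k" "y \<in> mpow V A G l" by blast
    then have "x \<in> mpow V A G (max k l)" "y \<in> mpow V A G (max k l)"
      using mpow_mono [OF Gg(1,2), of k "max k l"] mpow_mono [OF Gg(1,2), of l "max k l"] by auto
    then show ?case using submodule_closed(3) [OF sub] by blast
  next
    case (eng_mult x y)
    then show ?case using mpow_mult [OF Gg(1)] by blast
  qed
  moreover have "v \<in> Units V \<or> (\<exists>v'\<in>carrier V. v = p \<otimes>\<^bsub>V\<^esub> v')" if v: "v \<in> carrier V" for v
  proof (cases "v = \<zero>\<^bsub>V\<^esub>")
    case True
    then show ?thesis by (intro disjI2 bexI [of _ "\<zero>\<^bsub>V\<^esub>"]) auto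
  next
    case False
    then obtain u n where u: "u \<in> Units V" "v = u \<otimes>\<^bsub>V\<^esub> p [^]\<^bsub>V\<^esub> (n::nat)"
      using assms(1) v unfolding complete_dvr_def by blast
    then have uc: "u \<in> carrier V" by auto
    show ?thesis
    proof (cases n)
      case 0
      then show ?thesis using u uc by simp
    next
      case (Suc k)
      then have "v = p \<otimes>\<^bsub>V\<^esub> (u \<otimes>\<^bsub>V\<^esub> p [^]\<^bsub>V\<^esub> k)" using u uc by (simp add: R.m_ac)
      then show ?thesis using uc by blast
    qed
  qed
  ultimately have "generated_palgebra V A p a m"
    by unfold_locales (use a in \<open>auto simp: a_def G_def\<close>)
  moreover have "M \<subseteq> G" unfolding F(3) G_def im by (rule vspan_mono) auto
  ultimately show ?thesis using G unfolding G_def by blast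
qed

end

section \<open>Extension of a bounded linear map to overconvergent series\<close>

locale lg_map = palgebra V A p + W: pmodule V W p
  for V :: "'v ring" and A :: "('v, 'r) module" and p and W :: "('v, 'w) module" +
  fixes eps :: real and BW :: "'w set set" and f :: "'r \<Rightarrow> 'w"
  assumes dvr: "complete_dvr V p" and fin_gen: "fin_gen_algebra V A"
    and eps: "0 < eps" "eps < 1"
    and BW: "bornology V W BW" and complete: "complete_born V p W BW"
    and f_linear: "linear_map V A W f"
    and f_bounded: "bounded_map (lg eps) BW f"
begin

interpretation Dg: palgebra V D p
  by (rule algebra_palgebra [OF dagger_algebra p_closed])

lemma f_closed [simp]: "x \<in> carrier A \<Longrightarrow> f x \<in> carrier W"
  and f_add: "x \<in> carrier A \<Longrightarrow> y \<in> carrier A \<Longrightarrow> f (x \<oplus>\<^bsub>A\<^esub> y) = f x \<oplus>\<^bsub>W\<^esub> f y"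
  and f_smult: "a \<in> carrier V \<Longrightarrow> x \<in> carrier A \<Longrightarrow> f (a \<odot>\<^bsub>A\<^esub> x) = a \<odot>\<^bsub>W\<^esub> f x"
  using f_linear by (auto simp: linear_map_def)

lemma f_pmul:
  assumes "x \<in> pmul V p A n B" "B \<subseteq> carrier A" "f ` B \<subseteq> N"
  shows "f x \<in> pmul V p W n N"
proof -
  obtain b where b: "b \<in> B" "x = pw n b" using assms(1) unfolding pmul_iff by blast
  then have "f x = W.pw n (f b)" using assms(2) by (auto simp: f_smult)
  then show ?thesis using b(1) assms(3) unfolding W.pmul_iff by blast
qed

text \<open>\<open>y\<close> is the value at \<open>z\<close> of the extension of \<open>f\<close>: a limit of \<open>f\<close> along the partial sums of
  some overconvergent series representing \<open>z\<close>.\<close>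
definition rel :: "(nat \<Rightarrow> 'r set) \<Rightarrow> 'w \<Rightarrow> bool" where
  "rel z y \<longleftrightarrow> (\<exists>M L w N. mw_gens V A M \<and> (\<forall>j. w j \<in> mpow V A M (L * Suc j)) \<and> z = cl (psum w) \<and>
     N \<in> BW \<and> submodule N V W \<and> y \<in> N \<and> (\<forall>n. y \<ominus>\<^bsub>W\<^esub> f (psum w (2 * n)) \<in> pmul V p W n N))"

lemma relI:
  assumes "mw_gens V A M" "\<And>j. w j \<in> mpow V A M (L * Suc j)" "z = cl (psum w)"
    "N \<in> BW" "submodule N V W" "y \<in> N" "\<And>n. y \<ominus>\<^bsub>W\<^esub> f (psum w (2 * n)) \<in> pmul V p W n N"
  shows "rel z y"
  unfolding rel_def
  by (intro exI [of _ M] exI [of _ L] exI [of _ w] exI [of _ N] conjI allI assms)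

lemma relE:
  assumes "rel z y"
  obtains M L w N where "mw_gens V A M" "\<And>j. w j \<in> mpow V A M (L * Suc j)" "\<And>j. w j \<in> carrier A"
    "z = cl (psum w)" "N \<in> BW" "submodule N V W" "y \<in> N" "y \<in> carrier W"
    "\<And>n. y \<ominus>\<^bsub>W\<^esub> f (psum w (2 * n)) \<in> pmul V p W n N"
proof -
  obtain M L w N where *: "mw_gens V A M" "\<And>j. w j \<in> mpow V A M (L * Suc j)"
    "z = cl (psum w)" "N \<in> BW" "submodule N V W" "y \<in> N"
    "\<And>n. y \<ominus>\<^bsub>W\<^esub> f (psum w (2 * n)) \<in> pmul V p W n N"
    using assms unfolding rel_def by blast
  show thesis
    using that [OF *(1,2) submodule_closed(6) [OF dag_filtration [OF *(1)] *(2)] *(3-6)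
        W.submodule_closed(6) [OF *(5,6)] *(7)] .
qed

text \<open>Together with \<open>rel_smult\<close> this makes \<open>rel\<close> a linear relation,
  so that single-valuedness reduces to the fibre over zero.\<close>

lemma rel_add:
  assumes "rel z y" "rel z' y'"
  shows "rel (z \<oplus>\<^bsub>D\<^esub> z') (y \<oplus>\<^bsub>W\<^esub> y')"
proof -
  obtain M L w N where 1: "mw_gens V A M" "\<And>j. w j \<in> mpow V A M (L * Suc j)" "\<And>j. w j \<in> carrier A"
    "z = cl (psum w)" "N \<in> BW" "submodule N V W" "y \<in> N" "y \<in> carrier W"
    "\<And>n. y \<ominus>\<^bsub>W\<^esub> f (psum w (2 * n)) \<in> pmul V p W n N"
    using relE [OF assms(1)] by metis
  obtain M' L' w' N' where 2: "mw_gens V A M'" "\<And>j. w' j \<in> mpow V A M' (L' * Suc j)" "\<And>j. w' j \<in> carrier A"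
    "z' = cl (psum w')" "N' \<in> BW" "submodule N' V W" "y' \<in> N'" "y' \<in> carrier W"
    "\<And>n. y' \<ominus>\<^bsub>W\<^esub> f (psum w' (2 * n)) \<in> pmul V p W n N'"
    using relE [OF assms(2)] by metis
  obtain Q where Q: "mw_gens V A Q" "M \<subseteq> Q" "M' \<subseteq> Q" using mw_gens_Un2 [OF 1(1) 2(1)] by blast
  note Qg = mw_gensD [OF Q(1)]
  obtain P where P: "P \<in> BW" "submodule P V W" "N \<subseteq> P" "N' \<subseteq> P"
    using W.bornology_submodule_Un [OF BW 1(5) 2(5)] .
  have "w j \<in> mpow V A Q (max L L' * Suc j)" "w' j \<in> mpow V A Q (max L L' * Suc j)" for j
    using 1(2) [of j] 2(2) [of j] mpow_mono_set [OF Q(2) Qg(1)] mpow_mono_set [OF Q(3) Qg(1)]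
      mpow_mono [OF Qg(1,2) mult_le_mono1 [OF max.cobounded1]]
      mpow_mono [OF Qg(1,2) mult_le_mono1 [OF max.cobounded2]] by blast+
  then have "w j \<oplus>\<^bsub>A\<^esub> w' j \<in> mpow V A Q (max L L' * Suc j)" for j
    using submodule_closed(3) [OF dag_filtration [OF Q(1)]] by blast
  moreover have "z \<oplus>\<^bsub>D\<^esub> z' = cl (psum (\<lambda>j. w j \<oplus>\<^bsub>A\<^esub> w' j))"
    using 1 2 by (simp add: hadd_cl) (simp add: cl_def psum_add)
  moreover have "y \<oplus>\<^bsub>W\<^esub> y' \<in> P" using W.submodule_closed(3) [OF P(2)] 1(7) 2(7) P(3,4) by blast
  moreover have "(y \<oplus>\<^bsub>W\<^esub> y') \<ominus>\<^bsub>W\<^esub> f (psum (\<lambda>j. w j \<oplus>\<^bsub>A\<^esub> w' j) (2 * n)) \<in> pmul V p W n P" for n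
  proof -
    have "(y \<oplus>\<^bsub>W\<^esub> y') \<ominus>\<^bsub>W\<^esub> f (psum (\<lambda>j. w j \<oplus>\<^bsub>A\<^esub> w' j) (2 * n))
        = (y \<ominus>\<^bsub>W\<^esub> f (psum w (2 * n))) \<oplus>\<^bsub>W\<^esub> (y' \<ominus>\<^bsub>W\<^esub> f (psum w' (2 * n)))"
      using 1(3,8) 2(3,8) by (simp add: psum_add f_add W.M.minus_eq W.M.minus_add W.M.a_ac)
    moreover have "y \<ominus>\<^bsub>W\<^esub> f (psum w (2 * n)) \<in> pmul V p W n P" "y' \<ominus>\<^bsub>W\<^esub> f (psum w' (2 * n)) \<in> pmul V p W n P"
      using W.pmul_mono [OF P(3)] W.pmul_mono [OF P(4)] 1(9) 2(9) by blast+
    ultimately show ?thesis using W.submodule_closed(3) [OF W.pmul_submodule [OF P(2)]] by simp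
  qed
  ultimately show ?thesis by (rule relI [OF Q(1) _ _ P(1,2)])
qed

lemma rel_smult:
  assumes "a \<in> carrier V" "rel z y"
  shows "rel (a \<odot>\<^bsub>D\<^esub> z) (a \<odot>\<^bsub>W\<^esub> y)"
proof -
  obtain M L w N where 1: "mw_gens V A M" "\<And>j. w j \<in> mpow V A M (L * Suc j)" "\<And>j. w j \<in> carrier A"
    "z = cl (psum w)" "N \<in> BW" "submodule N V W" "y \<in> N" "y \<in> carrier W"
    "\<And>n. y \<ominus>\<^bsub>W\<^esub> f (psum w (2 * n)) \<in> pmul V p W n N"
    using relE [OF assms(2)] by metis
  have "a \<odot>\<^bsub>A\<^esub> w j \<in> mpow V A M (L * Suc j)" for j
    using submodule_closed(4) [OF dag_filtration [OF 1(1)] assms(1)] 1(2) by blast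
  moreover have "a \<odot>\<^bsub>D\<^esub> z = cl (psum (\<lambda>j. a \<odot>\<^bsub>A\<^esub> w j))"
    using 1 assms(1) by (simp add: hsmul_cl) (simp add: cl_def psum_smult)
  moreover have "a \<odot>\<^bsub>W\<^esub> y \<in> N" using W.submodule_closed(4) [OF 1(6)] 1(7) assms(1) by blast
  moreover have "a \<odot>\<^bsub>W\<^esub> y \<ominus>\<^bsub>W\<^esub> f (psum (\<lambda>j. a \<odot>\<^bsub>A\<^esub> w j) (2 * n)) \<in> pmul V p W n N" for n
    using W.submodule_closed(4) [OF W.pmul_submodule [OF 1(6)] assms(1) 1(9) [of n]] 1(3,8) assms(1)
    by (simp add: psum_smult f_smult W.smult_r_diff)
  ultimately show ?thesis by (rule relI [OF 1(1) _ _ 1(5,6)])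
qed

lemma rel_hat:
  assumes "x \<in> carrier A"
  shows "rel (hat_emb V p A x) (f x)"
proof -
  obtain M where M: "mw_gens V A M" "vspan V A {x} \<subseteq> M" using mw_gens_fine [of "{x}"] assms by auto
  let ?w = "case_nat x (\<lambda>_. \<zero>\<^bsub>A\<^esub>)"
  have xM: "x \<in> M" using M(2) vspan_base [of x "{x}"] by auto
  have w: "?w j \<in> mpow V A M (1 * Suc j)" for j
    using subset_mpow_1 [OF mw_gensD(1) [OF M(1)]] xM submodule_closed(2) [OF dag_filtration [OF M(1)]]
    by (auto split: nat.split simp del: mpow.simps)
  have z: "hat_emb V p A x = cl (psum ?w)" using hat_emb_psum [OF assms] .
  have "{f x} \<in> BW" using W.bornologyD(2) [OF BW, of "{f x}"] assms by simp
  then obtain N where N: "N \<in> BW" "submodule N V W" "{f x} \<subseteq> N"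
    using W.bornology_submodule_Un [OF BW] by metis
  have "f x \<ominus>\<^bsub>W\<^esub> f (psum ?w (2 * n)) \<in> pmul V p W n N" for n
  proof (cases n)
    \<comment> \<open>The partial sum is empty here; modulo \<open>p^0 N\<close> it only matters
      that \<open>f x\<close> lies in \<open>N\<close>.\<close>
    case 0
    have "f \<zero>\<^bsub>A\<^esub> = \<zero>\<^bsub>W\<^esub>" using f_smult [of "\<zero>\<^bsub>V\<^esub>" "\<zero>\<^bsub>A\<^esub>"] by simp
    then show ?thesis unfolding W.pmul_iff using 0 assms N(3)
      by (intro bexI [of _ "f x"]) (auto simp: W.M.minus_eq)
  next
    case (Suc k)
    then have "psum ?w (2 * n) = x" using psum_single [OF assms, of "Suc (2 * k)"] by simp
    then show ?thesis using assms W.submodule_closed(2) [OF W.pmul_submodule [OF N(2)]]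
      by (simp add: W.M.minus_eq W.M.r_neg)
  qed
  then show ?thesis using relI [OF M(1) w z N(1,2)] N(3) by blast
qed

text \<open>\<open>N\<close> depends on \<open>M\<close> and \<open>L\<close> but not on
  \<open>z\<close>. The lemma thus yields boundedness of the extension along with its
  existence.\<close>

lemma rel_total:
  assumes "mw_gens V A M"
  shows "\<exists>N\<in>BW. \<forall>z\<in>dag M L. \<exists>y\<in>N. rel z y"
proof -
  obtain B where B: "B \<in> lg eps" "submodule B V A"
    "\<And>j x. x \<in> mpow V A M (L * Suc j) \<Longrightarrow> pw j x \<in> pmul V p A (j div 2) B"
    using lg_bound [OF eps assms, of L] by blast
  have "f ` B \<in> BW" using f_bounded B(1) unfolding bounded_map_def by blast
  then obtain N where N: "N \<in> BW" "submodule N V W" "f ` B \<subseteq> N" "padic_complete V p W N"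
    using complete unfolding complete_born_def by blast
  have "\<exists>y\<in>N. rel z y" if z: "z \<in> dag M L" for z
  proof -
    obtain w where w: "\<And>j. w j \<in> mpow V A M (L * Suc j)" "z = cl (psum w)"
      using z unfolding dag_def ser_def by auto
    have wc: "w j \<in> carrier A" for j using submodule_closed(6) [OF dag_filtration [OF assms] w(1)] .
    have "psum w k \<in> B" for k
      unfolding psum_def
      by (rule rsum_in_submodule [OF B(2)]) (rule subsetD [OF pmul_subset [OF B(2)] B(3) [OF w(1)]])
    then have fN: "f (psum w k) \<in> N" for k using N(3) by blast
    \<comment> \<open>The two new terms have index \<open>2n\<close> and \<open>2n + 1\<close>, both
      with \<open>j div 2 = n\<close>. This is why the limit is taken along even partial
      sums.\<close>
    have "f (psum w (2 * Suc n)) \<ominus>\<^bsub>W\<^esub> f (psum w (2 * n)) \<in> pmul V p W n N" for n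
    proof -
      note PN = W.submodule_closed [OF W.pmul_submodule [OF N(2)]]
      have fp: "f (pw j (w j)) \<in> pmul V p W n N" if "j div 2 = n" for j
        using f_pmul [OF B(3) [OF w(1)] submodule_closed(1) [OF B(2)] N(3), of j] that by simp
      have "f (psum w (2 * Suc n)) \<ominus>\<^bsub>W\<^esub> f (psum w (2 * n))
          = f (pw (2 * n) (w (2 * n))) \<oplus>\<^bsub>W\<^esub> f (pw (Suc (2 * n)) (w (Suc (2 * n))))"
        using wc by (simp add: f_add W.M.minus_eq W.M.a_ac W.M.r_neg1 W.M.r_neg2 del: R.nat_pow_Suc)
      then show ?thesis using PN(3) fp [of "2 * n"] fp [of "Suc (2 * n)"] by simp
    qed
    then obtain y where "y \<in> N" "\<And>n. y \<ominus>\<^bsub>W\<^esub> f (psum w (2 * n)) \<in> pmul V p W n N"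
      using N(4) [unfolded padic_complete_def, rule_format, of "\<lambda>n. f (psum w (2 * n))"] fN by blast
    then show ?thesis using relI [OF assms w N(1,2)] by blast
  qed
  then show ?thesis using N(1) by blast
qed

text \<open>The partial sum with \<open>2n\<close> terms has degree at most \<open>2nL\<close> and
  is divisible by \<open>p^(2n)\<close>, so linear division gives a quotient of degree at most
  \<open>2n (L + e)\<close>. The growth bound for the constant \<open>L + e\<close> consumes half of
  \<open>p^(2n)\<close> and leaves \<open>p^n\<close>, which forces \<open>y\<close> into
  \<open>p^n Q\<close> for every \<open>n\<close>.\<close>

lemma rel_zero_unique:
  assumes "rel \<zero>\<^bsub>D\<^esub> y"
  shows "y = \<zero>\<^bsub>W\<^esub>"
proof -
  obtain M L w N where 1: "mw_gens V A M" "\<And>j. w j \<in> mpow V A M (L * Suc j)" "\<And>j. w j \<in> carrier A"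
    "\<zero>\<^bsub>D\<^esub> = cl (psum w)" "N \<in> BW" "submodule N V W" "y \<in> N" "y \<in> carrier W"
    "\<And>n. y \<ominus>\<^bsub>W\<^esub> f (psum w (2 * n)) \<in> pmul V p W n N"
    using relE [OF assms] by metis
  obtain a m where am: "generated_palgebra V A p a m" "M \<subseteq> vspan V A (a ` {..m})"
      "mw_gens V A (vspan V A (a ` {..m}))"
    using fin_gen_presentation [OF dvr fin_gen 1(1)] by blast
  define G where "G = vspan V A (a ` {..m})"
  obtain e where e: "\<And>n k x. x \<in> mpow V A G n \<Longrightarrow> x \<in> pmul V p A k (carrier A)
      \<Longrightarrow> x \<in> pmul V p A k (mpow V A G (n + e * k))"
    using generated_palgebra.linear_division [OF am(1)] unfolding G_def by metis
  have G: "mw_gens V A G" "M \<subseteq> G" using am by (auto simp: G_def)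
  note Gg = mw_gensD [OF G(1)]
  obtain B where B: "B \<in> lg eps" "submodule B V A"
    "\<And>j x. x \<in> mpow V A G ((L + e) * Suc j) \<Longrightarrow> pw j x \<in> pmul V p A (j div 2) B"
    using lg_bound [OF eps G(1), of "L + e"] by blast
  have "f ` B \<in> BW" using f_bounded B(1) unfolding bounded_map_def by blast
  \<comment> \<open>Separatedness is applied to a single bounded submodule, so it must hold both the
    errors of the limit and the image of \<open>B\<close>.\<close>
  then obtain Q where Q: "Q \<in> BW" "submodule Q V W" "N \<subseteq> Q" "f ` B \<subseteq> Q"
    using W.bornology_submodule_Un [OF BW 1(5)] by metis
  have "y \<in> pmul V p W n Q" for n
  proof -
    have "psum w (2 * n) \<in> mpow V A G (L * (2 * n))"
      unfolding psum_def
    proof (rule rsum_in_submodule [OF mpow_submodule [OF Gg(1)]])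
      fix j assume "j < 2 * n"
      then have "L * Suc j \<le> L * (2 * n)" by (intro mult_le_mono2) simp
      then have "w j \<in> mpow V A G (L * (2 * n))"
        using mpow_mono [OF Gg(1,2)] mpow_mono_set [OF G(2) Gg(1)] 1(2) [of j] by blast
      then show "pw j (w j) \<in> mpow V A G (L * (2 * n))"
        using submodule_closed(4) [OF mpow_submodule [OF Gg(1)] ppow_closed] by blast
    qed
    moreover have "psum w (2 * n) \<in> pmul V p A (2 * n) (carrier A)"
    proof -
      have "cl (psum w) = cl (\<lambda>_. \<zero>\<^bsub>A\<^esub>)" using 1(4) by (simp add: hat_emb_cl)
      then have "cong (2 * n) (psum w (2 * n)) \<zero>\<^bsub>A\<^esub>" by (rule cl_eqD) (use 1(3) in auto)
      then show ?thesis using 1(3) by (simp add: A.minus_eq)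
    qed
    ultimately obtain u where u: "u \<in> mpow V A G (L * (2 * n) + e * (2 * n))" "psum w (2 * n) = pw (2 * n) u"
      using e unfolding pmul_iff by blast
    have "L * (2 * n) + e * (2 * n) \<le> (L + e) * Suc (2 * n)" by (simp add: algebra_simps)
    then have "u \<in> mpow V A G ((L + e) * Suc (2 * n))" using mpow_mono [OF Gg(1,2)] u(1) by blast
    then have "psum w (2 * n) \<in> pmul V p A n B" using B(3) [of u "2 * n"] u(2) by simp
    then have fQ: "f (psum w (2 * n)) \<in> pmul V p W n Q"
      using f_pmul submodule_closed(1) [OF B(2)] Q(4) by blast
    have "y \<ominus>\<^bsub>W\<^esub> f (psum w (2 * n)) \<in> pmul V p W n Q" using 1(9) W.pmul_mono [OF Q(3)] by blast
    from W.submodule_closed(3) [OF W.pmul_submodule [OF Q(2)] this fQ]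
    show ?thesis using 1(3,8) by (simp add: W.M.minus_eq W.M.a_assoc W.M.l_neg)
  qed
  moreover have "padic_separated V p W Q" using complete Q(1,2) unfolding complete_born_def by blast
  ultimately show ?thesis unfolding padic_separated_def by blast
qed

lemma rel_carrier:
  assumes "rel z y"
  shows "z \<in> carrier D" "y \<in> carrier W"
proof -
  obtain M L w where 1: "mw_gens V A M" "\<And>j. w j \<in> mpow V A M (L * Suc j)" "z = cl (psum w)" "y \<in> carrier W"
    using relE [OF assms] by metis
  then have "z \<in> dag M L" unfolding dag_def using serI by metis
  then show "z \<in> carrier D" "y \<in> carrier W" using 1 dagger_carrier_iff by auto
qed

lemma rel_unique:
  assumes "rel z y" "rel z y'"
  shows "y = y'"
proof -
  let ?m = "\<ominus>\<^bsub>V\<^esub> \<one>\<^bsub>V\<^esub>"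
  have c: "z \<in> carrier D" "y \<in> carrier W" "y' \<in> carrier W" using rel_carrier assms by auto
  have "rel (z \<oplus>\<^bsub>D\<^esub> ?m \<odot>\<^bsub>D\<^esub> z) (y \<oplus>\<^bsub>W\<^esub> ?m \<odot>\<^bsub>W\<^esub> y')"
    using rel_add [OF assms(1) rel_smult [OF _ assms(2)]] by simp
  moreover have "z \<oplus>\<^bsub>D\<^esub> ?m \<odot>\<^bsub>D\<^esub> z = \<zero>\<^bsub>D\<^esub>"
    using c by (simp add: Dg.smult_l_minus Dg.A.r_neg del: dagger_simps)
  ultimately have "y \<oplus>\<^bsub>W\<^esub> ?m \<odot>\<^bsub>W\<^esub> y' = \<zero>\<^bsub>W\<^esub>" using rel_zero_unique by simp
  then have "y \<oplus>\<^bsub>W\<^esub> \<ominus>\<^bsub>W\<^esub> y' = \<zero>\<^bsub>W\<^esub>" using c by (simp add: W.smult_l_minus)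
  then show ?thesis using W.M.minus_equality [of y "\<ominus>\<^bsub>W\<^esub> y'"] c by simp
qed

text \<open>Uniqueness of the extension: \<open>z\<close> differs from its partial sum with
  \<open>2n\<close> terms by \<open>p^n t\<close>, where \<open>t\<close> stays in the bounded set
  \<open>dag M (2 * L)\<close> for all \<open>n\<close>. A bounded linear \<open>g\<close> therefore
  has to take the limit value.\<close>

lemma rel_extension:
  assumes g: "linear_map V D W g" "bounded_map (dagger_born V p A) BW g"
    "\<And>x. x \<in> carrier A \<Longrightarrow> g (hat_emb V p A x) = f x" and z: "z \<in> carrier D"
  shows "rel z (g z)"
proof -
  obtain M L where gens: "mw_gens V A M" "z \<in> dag M L" using z dagger_carrier_iff by blast
  obtain w where w: "\<And>j. w j \<in> mpow V A M (L * Suc j)" "z = cl (psum w)"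
    using gens(2) unfolding dag_def ser_def by auto
  have wc: "w j \<in> carrier A" for j using submodule_closed(6) [OF dag_filtration [OF gens(1)] w(1)] .
  note M = mw_gensD [OF gens(1)]
  have "dag M (2 * L) \<in> dagger_born V p A" "{z} \<in> dagger_born V p A"
    using gens unfolding dagger_born_iff by blast+
  then have "g ` dag M (2 * L) \<in> BW" "g ` {z} \<in> BW" using g(2) unfolding bounded_map_def by blast+
  then obtain N where N: "N \<in> BW" "submodule N V W" "g ` dag M (2 * L) \<subseteq> N" "g ` {z} \<subseteq> N"
    using W.bornology_submodule_Un [OF BW] by metis
  have "g z \<ominus>\<^bsub>W\<^esub> f (psum w (2 * n)) \<in> pmul V p W n N" for n
  proof -
    let ?u = "\<lambda>j. if j < n then \<zero>\<^bsub>A\<^esub> else w (n + j)"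
    define t where "t = cl (psum ?u)"
    have uc: "?u j \<in> carrier A" for j using wc by simp
    have "?u j \<in> mpow V A M (2 * L * Suc j)" for j
    proof (cases "j < n")
      case True
      then show ?thesis using submodule_closed(2) [OF dag_filtration [OF gens(1)]] by simp
    next
      case False
      then have "n + j + 1 \<le> 2 * Suc j" by simp
      then have "L * Suc (n + j) \<le> 2 * L * Suc j"
        using mult_le_mono2 [of "Suc (n + j)" "2 * Suc j" L] by (simp add: ac_simps)
      from subsetD [OF mpow_mono [OF M(1,2) this] w(1)] show ?thesis using False by simp
    qed
    then have t: "t \<in> dag M (2 * L)" unfolding t_def dag_def by (rule serI)
    then have tc: "t \<in> carrier D" using gens(1) dagger_carrier_iff by blast
    have xc: "psum w (2 * n) \<in> carrier A" using wc by simp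
    have "z = hat_emb V p A (psum w (2 * n)) \<oplus>\<^bsub>D\<^esub> Dg.pw n t"
    proof -
      have "cl (psum w) = cl (\<lambda>k. psum w (2 * n) \<oplus>\<^bsub>A\<^esub> pw n (psum ?u k))"
      proof (rule cl_eqI)
        fix k
        show "cong k (psum w k) (psum w (2 * n) \<oplus>\<^bsub>A\<^esub> pw n (psum ?u k))"
          unfolding psum_tail [of w n k, OF wc]
          by (rule cong_sym [OF cong_psum [OF wc]]) (use wc in auto)
        show "psum w (2 * n) \<oplus>\<^bsub>A\<^esub> pw n (psum ?u k) \<in> carrier A"
          unfolding psum_tail [of w n k, OF wc] using wc by simp
      qed (use wc in auto)
      also have "\<dots> = hat_emb V p A (psum w (2 * n)) \<oplus>\<^bsub>D\<^esub> Dg.pw n t"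
        unfolding t_def hat_emb_cl dagger_simps
        using psum_closed [of ?u] uc xc by (simp add: hsmul_cl hadd_cl)
      finally show ?thesis unfolding w(2) .
    qed
    then have "g z = f (psum w (2 * n)) \<oplus>\<^bsub>W\<^esub> W.pw n (g t)"
      using g(1,3) hat_closed [OF xc] xc tc unfolding linear_map_def by (simp del: dagger_simps)
    moreover have "g t \<in> carrier W" using g(1) tc unfolding linear_map_def by blast
    ultimately have "g z \<ominus>\<^bsub>W\<^esub> f (psum w (2 * n)) = W.pw n (g t)"
      using xc by (simp add: W.M.minus_eq W.M.a_ac W.M.r_neg)
    then show ?thesis using t N(3) unfolding W.pmul_iff by blast
  qed
  then show ?thesis using relI [OF gens(1) w N(1,2)] N(4) by blast
qed

theorem extension:
  "\<exists>g. linear_map V D W g \<and> bounded_map (dagger_born V p A) BW g \<and>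
     (\<forall>x\<in>carrier A. g (hat_emb V p A x) = f x) \<and>
     (\<forall>g'. linear_map V D W g' \<and> bounded_map (dagger_born V p A) BW g' \<and>
         (\<forall>x\<in>carrier A. g' (hat_emb V p A x) = f x) \<longrightarrow> (\<forall>z\<in>carrier D. g' z = g z))"
proof -
  define g where "g z = (SOME y. rel z y)" for z
  have gI: "g z = y" if "rel z y" for z y
    unfolding g_def using that rel_unique by (intro some_equality) blast+
  have rel_g: "rel z (g z)" if z: "z \<in> carrier D" for z
  proof -
    obtain M L where M: "mw_gens V A M" "z \<in> dag M L" 
      using z unfolding dagger_carrier_iff by blast
    obtain N where "\<forall>z\<in>dag M L. \<exists>y\<in>N. rel z y" using rel_total [OF M(1), of L] by blast
    then obtain y where "rel z y" using M(2) by blast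
    then show ?thesis using gI by simp
  qed
  have "linear_map V D W g"
    unfolding linear_map_def
    using rel_carrier(2) [OF rel_g] gI [OF rel_add [OF rel_g rel_g]] gI [OF rel_smult [OF _ rel_g]]
    by (auto simp del: dagger_simps)
  moreover have "bounded_map (dagger_born V p A) BW g"
    unfolding bounded_map_def
  proof
    fix S assume "S \<in> dagger_born V p A"
    then obtain M L where S: "mw_gens V A M" "S \<subseteq> dag M L" unfolding dagger_born_iff by blast
    obtain N where N: "N \<in> BW" "\<And>z. z \<in> dag M L \<Longrightarrow> \<exists>y\<in>N. rel z y" using rel_total [OF S(1)] by blast
    have "g ` S \<subseteq> N" using N(2) S(2) gI by blast
    then show "g ` S \<in> BW" using W.bornologyD(3) [OF BW] N(1) by blast
  qed
  moreover have "\<forall>x\<in>carrier A. g (hat_emb V p A x) = f x" using gI rel_hat by blast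
  moreover have "g' z = g z" if "linear_map V D W g'" "bounded_map (dagger_born V p A) BW g'"
      "\<forall>x\<in>carrier A. g' (hat_emb V p A x) = f x" "z \<in> carrier D" for g' z
    using gI [OF rel_extension [of g' z]] that by simp
  ultimately show ?thesis by blast
qed

end

text \<open>Completeness, boundedness of the canonical map and the universal property determine a
  completion up to a unique bounded linear isomorphism. The overconvergent algebra is thus
  identified with the linear growth completion without constructing another model of it, and its
  multiplication extends that of \<open>R\<close> because \<open>hat_emb\<close> is a ring
  homomorphism.\<close>

theorem mainTheorem3:
  fixes V :: "'v ring" and p :: 'v and eps :: real and R :: "('v, 'r) module"
  assumes "complete_dvr V p"
    and "0 < eps" and "eps < 1"
    and "algebra V R"
    and "fin_gen_algebra V R"
  shows "algebra V (dagger V p R)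
    \<and> alg_bornology V (dagger V p R) (dagger_born V p R)
    \<and> hat_emb V p R \<in> ring_hom R (dagger V p R)
    \<and> linear_map V R (dagger V p R) (hat_emb V p R)
    \<and> bounded_map (lg_bornology V p eps R (fine_bornology V R)) (dagger_born V p R) (hat_emb V p R)
    \<and> complete_born V p (dagger V p R) (dagger_born V p R)
    \<and> (\<forall>(W :: ('v, 'w) module) BW.
         completion_UP V p R (lg_bornology V p eps R (fine_bornology V R))
           (dagger V p R) (dagger_born V p R) (hat_emb V p R) W BW)"
proof -
  have p: "p \<in> carrier V" using assms(1) by (simp add: complete_dvr_def)
  interpret palgebra V R p by (rule algebra_palgebra [OF assms(4) p])
  have "completion_UP V p R (lg_bornology V p eps R (fine_bornology V R))
           (dagger V p R) (dagger_born V p R) (hat_emb V p R) W BW"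
    for W :: "('v, 'w) module" and BW
    unfolding completion_UP_def
  proof (intro impI allI, elim conjE)
    fix f
    assume W: "module V W" "bornology V W BW" "complete_born V p W BW" "linear_map V R W f"
      "bounded_map (lg_bornology V p eps R (fine_bornology V R)) BW f"
    interpret W: pmodule V W p using W(1) p by (simp add: pmodule_def pmodule_axioms_def)
    interpret lg_map V R p W eps BW f
      by unfold_locales (use assms W in auto)
    show "\<exists>g. linear_map V (dagger V p R) W g \<and> bounded_map (dagger_born V p R) BW g \<and>
        (\<forall>x\<in>carrier R. g (hat_emb V p R x) = f x) \<and>
        (\<forall>g'. linear_map V (dagger V p R) W g' \<and> bounded_map (dagger_born V p R) BW g' \<and>
            (\<forall>x\<in>carrier R. g' (hat_emb V p R x) = f x) \<longrightarrow>
          (\<forall>z\<in>carrier (dagger V p R). g' z = g z))"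
      by (rule extension)
  qed
  then show ?thesis
    using dagger_algebra dagger_bornology hat_ring_hom hat_linear hat_bounded [OF assms(2,3)] dagger_complete
    by blast
qed

end
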